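(* Let $\tau$ be a primitive type. Suppose $$\emptyset\mid\emptyset\vdash e:\forall\,\mathsf{auth},\mathsf{m}:\star\Rightarrow\star.\ \mathrm{AuthentikitFunc}\ \mathsf{auth}\ \mathsf{m}\to\mathsf{m}\ \tau .$$ Then for every $i\in I$, if $\langle \mathrm{run}_P\,(e\ \_\ \_\ \mathrm{Authentikit}_P),(\emptyset,\emptyset,i)\rangle\to_{cf}^{*}\langle (p,v),\sigma_1\rangle$, there exist states $\sigma_2,\sigma_3$ such that $$\langle \mathrm{run}_V\,(e\ \_\ \_\ \mathrm{Authentikit}_V)\ p,(\emptyset,\emptyset,i)\rangle\to^{*}\langle \mathsf{Some}\,v,\sigma_2\rangle\quad\text{and}\quad\langle \mathrm{run}_I\,(e\ \_\ \_\ \mathrm{Authentikit}_I),(\emptyset,\emptyset,i)\rangle\to^{*}\langle v,\sigma_3\rangle.$$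
   Context: $F^{\omega}_{\mu,\mathrm{ref}}$ is a call-by-value language with higher-order references and an $F^\omega$-style type system (kinds $\star$, $\kappa_1\Rightarrow\kappa_2$; constructors $\mathbf{1},\mathbf{bool},\mathbf{int},\mathbf{string},\times,+,\to,\mathbf{ref},\forall_\kappa,\exists_\kappa,\mu_\kappa$ iso-recursive), untyped terms, and a primitive $\mathsf{hash}:\mathbf{string}\to\mathbf{string}$. $\mathsf{None}/\mathsf{Some}$ are the injections of $\mathbf{1}+\tau$. Hash functions $(\mathrm{hash}_i)_{i\in I}$; states $(m,h,i)$ (heap, hash history, index); $\mathsf{hash}\ s$ steps to $\mathrm{hash}_i(s)$ and adds $s$ to $h$. $\to_{cf}$ is a step whose resulting state has no two distinct history strings with equal $\mathrm{hash}_i$; $\to^*_{cf}$, $\to^*$ reflexive-transitive closures. A primitive type is $\mathbf{1},\mathbf{bool},\mathbf{int},\mathbf{string}$ or a product/sum of primitive types. $\mathrm{AuthentikitFunc} := \lambda\,\mathsf{auth},\mathsf{m}.\ (\forall\alpha.\alpha\to\mathsf{m}\,\alpha)\times(\forall\alpha,\beta.\mathsf{m}\,\alpha\to(\alpha\to\mathsf{m}\,\beta)\to\mathsf{m}\,\beta)\times\mathrm{Authenticatable}$ with $\mathrm{Authenticatable} := \exists\,\mathsf{evi}:\star\Rightarrow\star.\ (\forall\alpha.\mathsf{evi}(\mathsf{auth}\,\alpha))\times(\forall\alpha,\beta.\mathsf{evi}\,\alpha\to\mathsf{evi}\,\beta\to\mathsf{evi}(\alpha\times\beta))\times(\forall\alpha,\beta.\mathsf{evi}\,\alpha\to\mathsf{evi}\,\beta\to\mathsf{evi}(\alpha+\beta))\times\mathsf{evi}\,\mathbf{string}\times\mathsf{evi}\,\mathbf{int}\times(\forall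 f.\mathsf{evi}(f(\mu_\star f))\to\mathsf{evi}(\mu_\star f))\times(\forall\alpha.\mathsf{evi}\,\alpha\to\alpha\to\mathsf{auth}\,\alpha)\times(\forall\alpha.\mathsf{evi}\,\alpha\to\mathsf{auth}\,\alpha\to\mathsf{m}\,\alpha)$ (return, bind, evidence combinators, $\mathrm{auth}$, $\mathrm{unauth}$). All three implementations use the same fixed serialization scheme for strings, ints, pairs, sums, recursive types, and authenticated values (an authenticated value serializes to its hash string); serialization is injective and independent of the type used. Proofs are lists of strings. $\mathrm{Authentikit}_P$ (prover): $\mathsf{auth}\,\alpha=\alpha\times\mathbf{string}$; $\mathsf{m}\,\alpha=\mathbf{1}\to\mathrm{proof}\times\alpha$; $\mathrm{return}\ a\ ()=([\,],a)$; $\mathrm{bind}\ c\ f\ ()$ computes $(p,a)=c\,()$, $(p',b)=f\,a\,()$ and returns $(p\mathbin{+\!\!+}p',b)$; evidence is a serializer, the evidence for $\mathsf{auth}$ maps $(\_,h)$ to $h$; $\mathrm{auth}\ evi\ a=(a,\mathsf{hash}(evi\ a))$; $\mathrm{unauth}\ evi\ (a,\_)\ ()=([evi\ a],a)$; $\mathrm{run}_P\ c=c\,()$. $\mathrm{Authentikit}_V$ (verifier): $\mathsf{auth}\,\alpha=\mathbf{string}$; $\mathsf{m}\,\alpha=\mathrm{proof}\to\mathbf{1}+(\mathrm{proof}\times\alpha)$; $\mathrm{return}\ a\ p=\mathsf{Some}(p,a)$; $\mathrm{bind}$ propagates $\mathsf{None}$ and otherwise passes the remaining proof; evidence is a (serializer,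 deserializer) pair with deserialization inverting serialization; $\mathrm{auth}\ evi\ a=\mathsf{hash}(\mathrm{serialize}\ a)$; $\mathrm{unauth}\ evi\ h\ p$: if $p=s::ps$ and $\mathsf{hash}\,s=h$, return $\mathsf{Some}(ps,a)$ when $\mathrm{deserialize}\ s=\mathsf{Some}\,a$, else $\mathsf{None}$; otherwise $\mathsf{None}$; $\mathrm{run}_V\ c\ p$ returns $\mathsf{Some}\,a$ if $c\,p=\mathsf{Some}(\_,a)$ and $\mathsf{None}$ otherwise. $\mathrm{Authentikit}_I$ (ideal): $\mathsf{auth}\,\alpha=\alpha$, $\mathsf{m}\,\alpha=\mathbf{1}\to\alpha$, $\mathrm{return}\ a\ ()=a$, $\mathrm{bind}\ c\ f\ ()=f\,(c\,())\,()$, $\mathrm{auth}\ \_\ a=a$, $\mathrm{unauth}\ \_\ a\ ()=a$, $\mathrm{run}_I\ c=c\,()$. *)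

theory Defs
  imports Main
begin

datatype kind = Star | KArr kind kind

datatype tcon =
    TUnitC | TBoolC | TIntC | TStringC
  | TProdC | TSumC | TArrC | TRefC
  | TForallC kind | TExistsC kind | TMuC kind

datatype ty = TV nat | TC tcon | TAbs kind ty | TAp ty ty

primrec tcon_kind :: "tcon \<Rightarrow> kind" where
  "tcon_kind TUnitC = Star"
| "tcon_kind TBoolC = Star"
| "tcon_kind TIntC = Star"
| "tcon_kind TStringC = Star"
| "tcon_kind TProdC = KArr Star (KArr Star Star)"
| "tcon_kind TSumC = KArr Star (KArr Star Star)"
| "tcon_kind TArrC = KArr Star (KArr Star Star)"
| "tcon_kind TRefC = KArr Star Star"
| "tcon_kind (TForallC k) = KArr (KArr k Star) Star"
| "tcon_kind (TExistsC k) = KArr (KArr k Star) Star"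
| "tcon_kind (TMuC k) = KArr (KArr k k) k"

fun tlift :: "nat \<Rightarrow> ty \<Rightarrow> ty" where
  "tlift k (TV n) = (if n < k then TV n else TV (Suc n))"
| "tlift k (TC c) = TC c"
| "tlift k (TAbs \<kappa> t) = TAbs \<kappa> (tlift (Suc k) t)"
| "tlift k (TAp t1 t2) = TAp (tlift k t1) (tlift k t2)"

fun tsubst :: "nat \<Rightarrow> ty \<Rightarrow> ty \<Rightarrow> ty" where
  "tsubst k s (TV n) = (if n < k then TV n else if n = k then s else TV (n - 1))"
| "tsubst k s (TC c) = TC c"
| "tsubst k s (TAbs \<kappa> t) = TAbs \<kappa> (tsubst (Suc k) (tlift 0 s) t)"
| "tsubst k s (TAp t1 t2) = TAp (tsubst k s t1) (tsubst k s t2)"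

inductive kinding :: "kind list \<Rightarrow> ty \<Rightarrow> kind \<Rightarrow> bool" where
  K_Var: "n < length \<Delta> \<Longrightarrow> kinding \<Delta> (TV n) (\<Delta> ! n)"
| K_Con: "kinding \<Delta> (TC c) (tcon_kind c)"
| K_Abs: "kinding (\<kappa> # \<Delta>) t \<kappa>' \<Longrightarrow> kinding \<Delta> (TAbs \<kappa> t) (KArr \<kappa> \<kappa>')"
| K_App: "kinding \<Delta> t1 (KArr \<kappa> \<kappa>') \<Longrightarrow> kinding \<Delta> t2 \<kappa> \<Longrightarrow> kinding \<Delta> (TAp t1 t2) \<kappa>'"

inductive tequiv :: "ty \<Rightarrow> ty \<Rightarrow> bool" where
  TE_refl: "tequiv t t"
| TE_sym: "tequiv t s \<Longrightarrow> tequiv s t"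
| TE_trans: "tequiv t s \<Longrightarrow> tequiv s u \<Longrightarrow> tequiv t u"
| TE_beta: "tequiv (TAp (TAbs \<kappa> t) s) (tsubst 0 s t)"
| TE_abs: "tequiv t s \<Longrightarrow> tequiv (TAbs \<kappa> t) (TAbs \<kappa> s)"
| TE_app: "tequiv t1 s1 \<Longrightarrow> tequiv t2 s2 \<Longrightarrow> tequiv (TAp t1 t2) (TAp s1 s2)"

definition tunit :: ty where "tunit = TC TUnitC"
definition tbool :: ty where "tbool = TC TBoolC"
definition tint :: ty where "tint = TC TIntC"
definition tstring :: ty where "tstring = TC TStringC"
definition tprod :: "ty \<Rightarrow> ty \<Rightarrow> ty" where "tprod a b = TAp (TAp (TC TProdC) a) b"
definition tsum :: "ty \<Rightarrow> ty \<Rightarrow> ty" where "tsum a b = TAp (TAp (TC TSumC) a) b"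
definition tarr :: "ty \<Rightarrow> ty \<Rightarrow> ty" where "tarr a b = TAp (TAp (TC TArrC) a) b"
definition tref :: "ty \<Rightarrow> ty" where "tref a = TAp (TC TRefC) a"
definition tforall :: "kind \<Rightarrow> ty \<Rightarrow> ty" where "tforall \<kappa> t = TAp (TC (TForallC \<kappa>)) (TAbs \<kappa> t)"
definition texists :: "kind \<Rightarrow> ty \<Rightarrow> ty" where "texists \<kappa> t = TAp (TC (TExistsC \<kappa>)) (TAbs \<kappa> t)"
definition tmu :: "kind \<Rightarrow> ty \<Rightarrow> ty" where "tmu \<kappa> F = TAp (TC (TMuC \<kappa>)) F"
definition tapps :: "ty \<Rightarrow> ty list \<Rightarrow> ty" where "tapps t args = foldl TAp t args"

inductive prim_ty :: "ty \<Rightarrow> bool" where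
  "prim_ty tunit" | "prim_ty tbool" | "prim_ty tint" | "prim_ty tstring"
| "prim_ty a \<Longrightarrow> prim_ty b \<Longrightarrow> prim_ty (tprod a b)"
| "prim_ty a \<Longrightarrow> prim_ty b \<Longrightarrow> prim_ty (tsum a b)"

datatype binop = PlusOp | MinusOp | MultOp | LtOp | LeOp | EqOp | ConcatOp
datatype unop = NotOp | IntToStrOp | StrToIntOp | StrLenOp

type_synonym vname = string
type_synonym loc = nat

datatype expr =
    EVar vname
  | ERec vname vname expr          \<comment> \<open>rec f x = e\<close>
  | EApp expr expr
  | ETLam expr                      \<comment> \<open>type abstraction (a value; body run on instantiation)\<close>
  | ETApp expr
  | EPack expr
  | EUnpack expr vname expr
  | EFold expr
  | EUnfold expr
  | EUnit
  | EBool bool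
  | EInt int
  | EStr string
  | ELoc loc
  | EBin binop expr expr
  | EUn unop expr
  | ESubstr expr expr expr
  | EIf expr expr expr
  | EPair expr expr
  | EFst expr
  | ESnd expr
  | EInjL expr
  | EInjR expr
  | ECase expr vname expr vname expr
  | EAlloc expr
  | ELoad expr
  | EStore expr expr
  | EHash expr

primrec is_val :: "expr \<Rightarrow> bool" where
  "is_val (EVar x) = False"
| "is_val (ERec f x e) = True"
| "is_val (EApp e1 e2) = False"
| "is_val (ETLam e) = True"
| "is_val (ETApp e) = False"
| "is_val (EPack v) = is_val v"
| "is_val (EUnpack e1 x e2) = False"
| "is_val (EFold v) = is_val v"
| "is_val (EUnfold e) = False"
| "is_val EUnit = True"
| "is_val (EBool b) = True"
| "is_val (EInt n) = True"
| "is_val (EStr s) = True"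
| "is_val (ELoc l) = True"
| "is_val (EBin op e1 e2) = False"
| "is_val (EUn op e) = False"
| "is_val (ESubstr e1 e2 e3) = False"
| "is_val (EIf e1 e2 e3) = False"
| "is_val (EPair v1 v2) = (is_val v1 \<and> is_val v2)"
| "is_val (EFst e) = False"
| "is_val (ESnd e) = False"
| "is_val (EInjL v) = is_val v"
| "is_val (EInjR v) = is_val v"
| "is_val (ECase e0 x1 e1 x2 e2) = False"
| "is_val (EAlloc e) = False"
| "is_val (ELoad e) = False"
| "is_val (EStore e1 e2) = False"
| "is_val (EHash e) = False"

text \<open>Substitution (only ever used with closed values, so no capture can occur).\<close>
primrec subst :: "vname \<Rightarrow> expr \<Rightarrow> expr \<Rightarrow> expr" where
  "subst y v (EVar x) = (if x = y then v else EVar x)"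
| "subst y v (ERec f x e) = (if y = f \<or> y = x then ERec f x e else ERec f x (subst y v e))"
| "subst y v (EApp e1 e2) = EApp (subst y v e1) (subst y v e2)"
| "subst y v (ETLam e) = ETLam (subst y v e)"
| "subst y v (ETApp e) = ETApp (subst y v e)"
| "subst y v (EPack e) = EPack (subst y v e)"
| "subst y v (EUnpack e1 x e2) =
     EUnpack (subst y v e1) x (if x = y then e2 else subst y v e2)"
| "subst y v (EFold e) = EFold (subst y v e)"
| "subst y v (EUnfold e) = EUnfold (subst y v e)"
| "subst y v EUnit = EUnit"
| "subst y v (EBool b) = EBool b"
| "subst y v (EInt n) = EInt n"
| "subst y v (EStr s) = EStr s"
| "subst y v (ELoc l) = ELoc l"
| "subst y v (EBin op e1 e2) = EBin op (subst y v e1) (subst y v e2)"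
| "subst y v (EUn op e) = EUn op (subst y v e)"
| "subst y v (ESubstr e1 e2 e3) = ESubstr (subst y v e1) (subst y v e2) (subst y v e3)"
| "subst y v (EIf e1 e2 e3) = EIf (subst y v e1) (subst y v e2) (subst y v e3)"
| "subst y v (EPair e1 e2) = EPair (subst y v e1) (subst y v e2)"
| "subst y v (EFst e) = EFst (subst y v e)"
| "subst y v (ESnd e) = ESnd (subst y v e)"
| "subst y v (EInjL e) = EInjL (subst y v e)"
| "subst y v (EInjR e) = EInjR (subst y v e)"
| "subst y v (ECase e0 x1 e1 x2 e2) =
     ECase (subst y v e0) x1 (if x1 = y then e1 else subst y v e1)
                          x2 (if x2 = y then e2 else subst y v e2)"
| "subst y v (EAlloc e) = EAlloc (subst y v e)"
| "subst y v (ELoad e) = ELoad (subst y v e)"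
| "subst y v (EStore e1 e2) = EStore (subst y v e1) (subst y v e2)"
| "subst y v (EHash e) = EHash (subst y v e)"

fun nat_to_str :: "nat \<Rightarrow> string" where
  "nat_to_str n = (if n < 10 then [char_of (48 + n)]
                   else nat_to_str (n div 10) @ [char_of (48 + n mod 10)])"

definition int_to_str :: "int \<Rightarrow> string" where
  "int_to_str z = (if z < 0 then CHR ''-'' # nat_to_str (nat (- z)) else nat_to_str (nat z))"

definition str_to_int :: "string \<Rightarrow> int option" where
  "str_to_int s = (if \<exists>z. int_to_str z = s then Some (THE z. int_to_str z = s) else None)"

definition as_int :: "expr \<Rightarrow> int option" where
  "as_int v = (case v of EInt a \<Rightarrow> Some a | _ \<Rightarrow> None)"
definition as_str :: "expr \<Rightarrow> string option" where
  "as_str v = (case v of EStr a \<Rightarrow> Some a | _ \<Rightarrow> None)"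
definition as_bool :: "expr \<Rightarrow> bool option" where
  "as_bool v = (case v of EBool a \<Rightarrow> Some a | _ \<Rightarrow> None)"

definition lit_eq :: "expr \<Rightarrow> expr \<Rightarrow> bool option" where
  "lit_eq v1 v2 =
     (if v1 = EUnit \<and> v2 = EUnit then Some True
      else if as_int v1 \<noteq> None \<and> as_int v2 \<noteq> None then Some (as_int v1 = as_int v2)
      else if as_str v1 \<noteq> None \<and> as_str v2 \<noteq> None then Some (as_str v1 = as_str v2)
      else if as_bool v1 \<noteq> None \<and> as_bool v2 \<noteq> None then Some (as_bool v1 = as_bool v2)
      else None)"

definition bin_eval :: "binop \<Rightarrow> expr \<Rightarrow> expr \<Rightarrow> expr option" where
  "bin_eval op v1 v2 = (case op of
       PlusOp \<Rightarrow> (case (as_int v1, as_int v2) of (Some a, Some b) \<Rightarrow> Some (EInt (a + b)) | _ \<Rightarrow> None)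
     | MinusOp \<Rightarrow> (case (as_int v1, as_int v2) of (Some a, Some b) \<Rightarrow> Some (EInt (a - b)) | _ \<Rightarrow> None)
     | MultOp \<Rightarrow> (case (as_int v1, as_int v2) of (Some a, Some b) \<Rightarrow> Some (EInt (a * b)) | _ \<Rightarrow> None)
     | LtOp \<Rightarrow> (case (as_int v1, as_int v2) of (Some a, Some b) \<Rightarrow> Some (EBool (a < b)) | _ \<Rightarrow> None)
     | LeOp \<Rightarrow> (case (as_int v1, as_int v2) of (Some a, Some b) \<Rightarrow> Some (EBool (a \<le> b)) | _ \<Rightarrow> None)
     | EqOp \<Rightarrow> map_option EBool (lit_eq v1 v2)
     | ConcatOp \<Rightarrow> (case (as_str v1, as_str v2) of (Some a, Some b) \<Rightarrow> Some (EStr (a @ b)) | _ \<Rightarrow> None))"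

definition un_eval :: "unop \<Rightarrow> expr \<Rightarrow> expr option" where
  "un_eval op v = (case op of
       NotOp \<Rightarrow> map_option (\<lambda>b. EBool (\<not> b)) (as_bool v)
     | IntToStrOp \<Rightarrow> map_option (\<lambda>n. EStr (int_to_str n)) (as_int v)
     | StrToIntOp \<Rightarrow> map_option (\<lambda>s. case str_to_int s of None \<Rightarrow> EInjL EUnit | Some n \<Rightarrow> EInjR (EInt n)) (as_str v)
     | StrLenOp \<Rightarrow> map_option (\<lambda>s. EInt (int (length s))) (as_str v))"

text \<open>States (m, h, i): heap, hash history, index of the hash function.\<close>
type_synonym 'i state = "(loc \<rightharpoonup> expr) \<times> string set \<times> 'i"

definition init_state :: "'i \<Rightarrow> 'i state" where
  "init_state i = (Map.empty, {}, i)"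

inductive head_step :: "('i \<Rightarrow> string \<Rightarrow> string) \<Rightarrow> expr \<Rightarrow> 'i state \<Rightarrow> expr \<Rightarrow> 'i state \<Rightarrow> bool"
  for hashf :: "'i \<Rightarrow> string \<Rightarrow> string" where
  HS_Beta: "is_val v \<Longrightarrow>
     head_step hashf (EApp (ERec f x e) v) \<sigma> (subst f (ERec f x e) (subst x v e)) \<sigma>"
| HS_TBeta: "head_step hashf (ETApp (ETLam e)) \<sigma> e \<sigma>"
| HS_Unpack: "is_val v \<Longrightarrow> head_step hashf (EUnpack (EPack v) x e) \<sigma> (subst x v e) \<sigma>"
| HS_Unfold: "is_val v \<Longrightarrow> head_step hashf (EUnfold (EFold v)) \<sigma> v \<sigma>"
| HS_Bin: "is_val v1 \<Longrightarrow> is_val v2 \<Longrightarrow> bin_eval op v1 v2 = Some w \<Longrightarrow>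
     head_step hashf (EBin op v1 v2) \<sigma> w \<sigma>"
| HS_Un: "is_val v \<Longrightarrow> un_eval op v = Some w \<Longrightarrow> head_step hashf (EUn op v) \<sigma> w \<sigma>"
| HS_Substr: "head_step hashf (ESubstr (EStr s) (EInt a) (EInt b)) \<sigma>
     (EStr (take (nat b) (drop (nat a) s))) \<sigma>"
| HS_IfT: "head_step hashf (EIf (EBool True) e1 e2) \<sigma> e1 \<sigma>"
| HS_IfF: "head_step hashf (EIf (EBool False) e1 e2) \<sigma> e2 \<sigma>"
| HS_Fst: "is_val v1 \<Longrightarrow> is_val v2 \<Longrightarrow> head_step hashf (EFst (EPair v1 v2)) \<sigma> v1 \<sigma>"
| HS_Snd: "is_val v1 \<Longrightarrow> is_val v2 \<Longrightarrow> head_step hashf (ESnd (EPair v1 v2)) \<sigma> v2 \<sigma>"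
| HS_CaseL: "is_val v \<Longrightarrow> head_step hashf (ECase (EInjL v) x1 e1 x2 e2) \<sigma> (subst x1 v e1) \<sigma>"
| HS_CaseR: "is_val v \<Longrightarrow> head_step hashf (ECase (EInjR v) x1 e1 x2 e2) \<sigma> (subst x2 v e2) \<sigma>"
| HS_Alloc: "is_val v \<Longrightarrow> m l = None \<Longrightarrow>
     head_step hashf (EAlloc v) (m, h, i) (ELoc l) (m(l \<mapsto> v), h, i)"
| HS_Load: "m l = Some v \<Longrightarrow> head_step hashf (ELoad (ELoc l)) (m, h, i) v (m, h, i)"
| HS_Store: "is_val v \<Longrightarrow> m l \<noteq> None \<Longrightarrow>
     head_step hashf (EStore (ELoc l) v) (m, h, i) EUnit (m(l \<mapsto> v), h, i)"
| HS_Hash: "head_step hashf (EHash (EStr s)) (m, h, i) (EStr (hashf i s)) (m, insert s h, i)"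

text \<open>Evaluation contexts (call-by-value, left-to-right), as lists of frames, innermost first.\<close>
datatype frame =
    FAppL expr | FAppR expr | FTApp | FPack | FUnpack vname expr | FFold | FUnfold
  | FBinL binop expr | FBinR binop expr | FUn unop
  | FSubstr1 expr expr | FSubstr2 expr expr | FSubstr3 expr expr
  | FIf expr expr | FPairL expr | FPairR expr | FFst | FSnd | FInjL | FInjR
  | FCase vname expr vname expr | FAlloc | FLoad | FStoreL expr | FStoreR expr | FHash

primrec fill_frame :: "frame \<Rightarrow> expr \<Rightarrow> expr" where
  "fill_frame (FAppL e2) e = EApp e e2"
| "fill_frame (FAppR v1) e = EApp v1 e"
| "fill_frame FTApp e = ETApp e"
| "fill_frame FPack e = EPack e"
| "fill_frame (FUnpack x e2) e = EUnpack e x e2"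
| "fill_frame FFold e = EFold e"
| "fill_frame FUnfold e = EUnfold e"
| "fill_frame (FBinL op e2) e = EBin op e e2"
| "fill_frame (FBinR op v1) e = EBin op v1 e"
| "fill_frame (FUn op) e = EUn op e"
| "fill_frame (FSubstr1 e2 e3) e = ESubstr e e2 e3"
| "fill_frame (FSubstr2 v1 e3) e = ESubstr v1 e e3"
| "fill_frame (FSubstr3 v1 v2) e = ESubstr v1 v2 e"
| "fill_frame (FIf e1 e2) e = EIf e e1 e2"
| "fill_frame (FPairL e2) e = EPair e e2"
| "fill_frame (FPairR v1) e = EPair v1 e"
| "fill_frame FFst e = EFst e"
| "fill_frame FSnd e = ESnd e"
| "fill_frame FInjL e = EInjL e"
| "fill_frame FInjR e = EInjR e"
| "fill_frame (FCase x1 e1 x2 e2) e = ECase e x1 e1 x2 e2"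
| "fill_frame FAlloc e = EAlloc e"
| "fill_frame FLoad e = ELoad e"
| "fill_frame (FStoreL e2) e = EStore e e2"
| "fill_frame (FStoreR v1) e = EStore v1 e"
| "fill_frame FHash e = EHash e"

definition frame_ok :: "frame \<Rightarrow> bool" where
  "frame_ok F = (case F of
       FAppR v1 \<Rightarrow> is_val v1
     | FBinR op v1 \<Rightarrow> is_val v1
     | FSubstr2 v1 e3 \<Rightarrow> is_val v1
     | FSubstr3 v1 v2 \<Rightarrow> is_val v1 \<and> is_val v2
     | FPairR v1 \<Rightarrow> is_val v1
     | FStoreR v1 \<Rightarrow> is_val v1
     | _ \<Rightarrow> True)"

fun fill :: "frame list \<Rightarrow> expr \<Rightarrow> expr" where
  "fill [] e = e"
| "fill (F # K) e = fill K (fill_frame F e)"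

inductive step :: "('i \<Rightarrow> string \<Rightarrow> string) \<Rightarrow> expr \<times> 'i state \<Rightarrow> expr \<times> 'i state \<Rightarrow> bool"
  for hashf :: "'i \<Rightarrow> string \<Rightarrow> string" where
  "head_step hashf e \<sigma> e' \<sigma>' \<Longrightarrow> list_all frame_ok K \<Longrightarrow>
     step hashf (fill K e, \<sigma>) (fill K e', \<sigma>')"

definition collision_free :: "('i \<Rightarrow> string \<Rightarrow> string) \<Rightarrow> 'i state \<Rightarrow> bool" where
  "collision_free hashf \<sigma> = (case \<sigma> of (m, h, i) \<Rightarrow>
     (\<forall>s1\<in>h. \<forall>s2\<in>h. s1 \<noteq> s2 \<longrightarrow> hashf i s1 \<noteq> hashf i s2))"

definition cf_step :: "('i \<Rightarrow> string \<Rightarrow> string) \<Rightarrow> expr \<times> 'i state \<Rightarrow> expr \<times> 'i state \<Rightarrow> bool" where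
  "cf_step hashf c c' = (step hashf c c' \<and> collision_free hashf (snd c'))"

abbreviation steps where "steps hashf \<equiv> (step hashf)\<^sup>*\<^sup>*"
abbreviation cf_steps where "cf_steps hashf \<equiv> (cf_step hashf)\<^sup>*\<^sup>*"

inductive base_eq_ty :: "ty \<Rightarrow> bool" where
  "base_eq_ty tunit" | "base_eq_ty tbool" | "base_eq_ty tint" | "base_eq_ty tstring"

inductive binop_ty :: "binop \<Rightarrow> ty \<Rightarrow> ty \<Rightarrow> ty \<Rightarrow> bool" where
  "binop_ty PlusOp tint tint tint"
| "binop_ty MinusOp tint tint tint"
| "binop_ty MultOp tint tint tint"
| "binop_ty LtOp tint tint tbool"
| "binop_ty LeOp tint tint tbool"
| "base_eq_ty t \<Longrightarrow> binop_ty EqOp t t tbool"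
| "binop_ty ConcatOp tstring tstring tstring"

inductive unop_ty :: "unop \<Rightarrow> ty \<Rightarrow> ty \<Rightarrow> bool" where
  "unop_ty NotOp tbool tbool"
| "unop_ty IntToStrOp tint tstring"
| "unop_ty StrToIntOp tstring (tsum tunit tint)"
| "unop_ty StrLenOp tstring tint"

type_synonym tenv = "vname \<rightharpoonup> ty"

definition lift_env :: "tenv \<Rightarrow> tenv" where
  "lift_env \<Gamma> = map_option (tlift 0) \<circ> \<Gamma>"

text \<open>Typing judgment  \<Delta> | \<Gamma> \<turnstile> e : \<tau>  (source terms: no location literals).\<close>
inductive typed :: "kind list \<Rightarrow> tenv \<Rightarrow> expr \<Rightarrow> ty \<Rightarrow> bool" where
  T_Var: "\<Gamma> x = Some \<tau> \<Longrightarrow> typed \<Delta> \<Gamma> (EVar x) \<tau>"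
| T_Unit: "typed \<Delta> \<Gamma> EUnit tunit"
| T_Bool: "typed \<Delta> \<Gamma> (EBool b) tbool"
| T_Int: "typed \<Delta> \<Gamma> (EInt n) tint"
| T_Str: "typed \<Delta> \<Gamma> (EStr s) tstring"
| T_Rec: "kinding \<Delta> \<tau>1 Star \<Longrightarrow> kinding \<Delta> \<tau>2 Star \<Longrightarrow>
     typed \<Delta> (\<Gamma>(f \<mapsto> tarr \<tau>1 \<tau>2, x \<mapsto> \<tau>1)) e \<tau>2 \<Longrightarrow>
     typed \<Delta> \<Gamma> (ERec f x e) (tarr \<tau>1 \<tau>2)"
| T_App: "typed \<Delta> \<Gamma> e1 (tarr \<tau>1 \<tau>2) \<Longrightarrow> typed \<Delta> \<Gamma> e2 \<tau>1 \<Longrightarrow> typed \<Delta> \<Gamma> (EApp e1 e2) \<tau>2"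
| T_TLam: "typed (\<kappa> # \<Delta>) (lift_env \<Gamma>) e \<tau> \<Longrightarrow> typed \<Delta> \<Gamma> (ETLam e) (tforall \<kappa> \<tau>)"
| T_TApp: "typed \<Delta> \<Gamma> e (TAp (TC (TForallC \<kappa>)) F) \<Longrightarrow> kinding \<Delta> \<sigma> \<kappa> \<Longrightarrow>
     typed \<Delta> \<Gamma> (ETApp e) (TAp F \<sigma>)"
| T_Pack: "kinding \<Delta> F (KArr \<kappa> Star) \<Longrightarrow> kinding \<Delta> \<sigma> \<kappa> \<Longrightarrow> typed \<Delta> \<Gamma> e (TAp F \<sigma>) \<Longrightarrow>
     typed \<Delta> \<Gamma> (EPack e) (TAp (TC (TExistsC \<kappa>)) F)"
| T_Unpack: "typed \<Delta> \<Gamma> e1 (TAp (TC (TExistsC \<kappa>)) F) \<Longrightarrow> kinding \<Delta> \<tau> Star \<Longrightarrow>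
     typed (\<kappa> # \<Delta>) ((lift_env \<Gamma>)(x \<mapsto> TAp (tlift 0 F) (TV 0))) e2 (tlift 0 \<tau>) \<Longrightarrow>
     typed \<Delta> \<Gamma> (EUnpack e1 x e2) \<tau>"
| T_Fold: "kinding \<Delta> (tapps (tmu \<kappa> F) args) Star \<Longrightarrow>
     typed \<Delta> \<Gamma> e (tapps (TAp F (tmu \<kappa> F)) args) \<Longrightarrow>
     typed \<Delta> \<Gamma> (EFold e) (tapps (tmu \<kappa> F) args)"
| T_Unfold: "kinding \<Delta> (tapps (TAp F (tmu \<kappa> F)) args) Star \<Longrightarrow>
     typed \<Delta> \<Gamma> e (tapps (tmu \<kappa> F) args) \<Longrightarrow>
     typed \<Delta> \<Gamma> (EUnfold e) (tapps (TAp F (tmu \<kappa> F)) args)"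
| T_Bin: "binop_ty op \<tau>1 \<tau>2 \<tau> \<Longrightarrow> typed \<Delta> \<Gamma> e1 \<tau>1 \<Longrightarrow> typed \<Delta> \<Gamma> e2 \<tau>2 \<Longrightarrow>
     typed \<Delta> \<Gamma> (EBin op e1 e2) \<tau>"
| T_Un: "unop_ty op \<tau>1 \<tau> \<Longrightarrow> typed \<Delta> \<Gamma> e \<tau>1 \<Longrightarrow> typed \<Delta> \<Gamma> (EUn op e) \<tau>"
| T_Substr: "typed \<Delta> \<Gamma> e1 tstring \<Longrightarrow> typed \<Delta> \<Gamma> e2 tint \<Longrightarrow> typed \<Delta> \<Gamma> e3 tint \<Longrightarrow>
     typed \<Delta> \<Gamma> (ESubstr e1 e2 e3) tstring"
| T_If: "typed \<Delta> \<Gamma> e0 tbool \<Longrightarrow> typed \<Delta> \<Gamma> e1 \<tau> \<Longrightarrow> typed \<Delta> \<Gamma> e2 \<tau> \<Longrightarrow>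
     typed \<Delta> \<Gamma> (EIf e0 e1 e2) \<tau>"
| T_Pair: "typed \<Delta> \<Gamma> e1 \<tau>1 \<Longrightarrow> typed \<Delta> \<Gamma> e2 \<tau>2 \<Longrightarrow> typed \<Delta> \<Gamma> (EPair e1 e2) (tprod \<tau>1 \<tau>2)"
| T_Fst: "typed \<Delta> \<Gamma> e (tprod \<tau>1 \<tau>2) \<Longrightarrow> typed \<Delta> \<Gamma> (EFst e) \<tau>1"
| T_Snd: "typed \<Delta> \<Gamma> e (tprod \<tau>1 \<tau>2) \<Longrightarrow> typed \<Delta> \<Gamma> (ESnd e) \<tau>2"
| T_InjL: "kinding \<Delta> \<tau>2 Star \<Longrightarrow> typed \<Delta> \<Gamma> e \<tau>1 \<Longrightarrow> typed \<Delta> \<Gamma> (EInjL e) (tsum \<tau>1 \<tau>2)"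
| T_InjR: "kinding \<Delta> \<tau>1 Star \<Longrightarrow> typed \<Delta> \<Gamma> e \<tau>2 \<Longrightarrow> typed \<Delta> \<Gamma> (EInjR e) (tsum \<tau>1 \<tau>2)"
| T_Case: "typed \<Delta> \<Gamma> e0 (tsum \<tau>1 \<tau>2) \<Longrightarrow> typed \<Delta> (\<Gamma>(x1 \<mapsto> \<tau>1)) e1 \<tau> \<Longrightarrow>
     typed \<Delta> (\<Gamma>(x2 \<mapsto> \<tau>2)) e2 \<tau> \<Longrightarrow> typed \<Delta> \<Gamma> (ECase e0 x1 e1 x2 e2) \<tau>"
| T_Alloc: "typed \<Delta> \<Gamma> e \<tau> \<Longrightarrow> typed \<Delta> \<Gamma> (EAlloc e) (tref \<tau>)"
| T_Load: "typed \<Delta> \<Gamma> e (tref \<tau>) \<Longrightarrow> typed \<Delta> \<Gamma> (ELoad e) \<tau>"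
| T_Store: "typed \<Delta> \<Gamma> e1 (tref \<tau>) \<Longrightarrow> typed \<Delta> \<Gamma> e2 \<tau> \<Longrightarrow> typed \<Delta> \<Gamma> (EStore e1 e2) tunit"
| T_Hash: "typed \<Delta> \<Gamma> e tstring \<Longrightarrow> typed \<Delta> \<Gamma> (EHash e) tstring"
| T_Conv: "typed \<Delta> \<Gamma> e \<tau> \<Longrightarrow> tequiv \<tau> \<tau>' \<Longrightarrow> kinding \<Delta> \<tau>' Star \<Longrightarrow> typed \<Delta> \<Gamma> e \<tau>'"

definition S :: kind where "S = Star"
definition SS :: kind where "SS = KArr Star Star"

definition ret_ty :: "ty \<Rightarrow> ty" where
  "ret_ty m = tforall S (tarr (TV 0) (TAp (tlift 0 m) (TV 0)))"

definition bind_ty :: "ty \<Rightarrow> ty" where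
  "bind_ty m = (let m2 = tlift 0 (tlift 0 m) in
     tforall S (tforall S
       (tarr (TAp m2 (TV 1)) (tarr (tarr (TV 1) (TAp m2 (TV 0))) (TAp m2 (TV 0))))))"

text \<open>Authenticatable auth m = exists evi. ... (evi is TV 0 inside the body).\<close>
definition authenticatable_ty :: "ty \<Rightarrow> ty \<Rightarrow> ty" where
  "authenticatable_ty auth m = (let a1 = tlift 0 auth; m1 = tlift 0 m in
     texists SS
      (tprod (tforall S (TAp (TV 1) (TAp (tlift 0 a1) (TV 0))))
      (tprod (tforall S (tforall S
               (tarr (TAp (TV 2) (TV 1)) (tarr (TAp (TV 2) (TV 0)) (TAp (TV 2) (tprod (TV 1) (TV 0)))))))
      (tprod (tforall S (tforall S
               (tarr (TAp (TV 2) (TV 1)) (tarr (TAp (TV 2) (TV 0)) (TAp (TV 2) (tsum (TV 1) (TV 0)))))))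
      (tprod (TAp (TV 0) tstring)
      (tprod (TAp (TV 0) tint)
      (tprod (tforall SS
               (tarr (TAp (TV 1) (TAp (TV 0) (tmu S (TV 0)))) (TAp (TV 1) (tmu S (TV 0)))))
      (tprod (tforall S (tarr (TAp (TV 1) (TV 0)) (tarr (TV 0) (TAp (tlift 0 a1) (TV 0)))))
             (tforall S (tarr (TAp (TV 1) (TV 0))
                              (tarr (TAp (tlift 0 a1) (TV 0)) (TAp (tlift 0 m1) (TV 0)))))))))))))"

definition authentikit_func_ty :: "ty \<Rightarrow> ty \<Rightarrow> ty" where
  "authentikit_func_ty auth m = tprod (ret_ty m) (tprod (bind_ty m) (authenticatable_ty auth m))"

text \<open>forall auth m : * => *. AuthentikitFunc auth m -> m \<tau>   (\<tau> closed).\<close>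
definition client_ty :: "ty \<Rightarrow> ty" where
  "client_ty \<tau> = tforall SS (tforall SS (tarr (authentikit_func_ty (TV 1) (TV 0)) (TAp (TV 0) \<tau>)))"

definition Lam :: "vname \<Rightarrow> expr \<Rightarrow> expr" where "Lam x e = ERec '''' x e"
definition ELet :: "vname \<Rightarrow> expr \<Rightarrow> expr \<Rightarrow> expr" where "ELet x e1 e2 = EApp (Lam x e2) e1"
definition ENone :: expr where "ENone = EInjL EUnit"
definition ESome :: "expr \<Rightarrow> expr" where "ESome e = EInjR e"
definition EMatch :: "expr \<Rightarrow> expr \<Rightarrow> vname \<Rightarrow> expr \<Rightarrow> expr" where
  "EMatch e0 enone x esome = ECase e0 ''_none'' enone x esome"
definition ECat :: "expr \<Rightarrow> expr \<Rightarrow> expr" where "ECat a b = EBin ConcatOp a b"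
definition EEq :: "expr \<Rightarrow> expr \<Rightarrow> expr" where "EEq a b = EBin EqOp a b"
definition EAdd :: "expr \<Rightarrow> expr \<Rightarrow> expr" where "EAdd a b = EBin PlusOp a b"
definition ESub :: "expr \<Rightarrow> expr \<Rightarrow> expr" where "ESub a b = EBin MinusOp a b"
definition ELt :: "expr \<Rightarrow> expr \<Rightarrow> expr" where "ELt a b = EBin LtOp a b"
definition EApp2 :: "expr \<Rightarrow> expr \<Rightarrow> expr \<Rightarrow> expr" where "EApp2 f a b = EApp (EApp f a) b"
definition V :: "vname \<Rightarrow> expr" where "V = EVar"

text \<open>Lists (proofs are lists of strings): nil = fold (inl ()), cons h t = fold (inr (h, t)).\<close>
definition nilE :: expr where "nilE = EFold (EInjL EUnit)"
definition consE :: "expr \<Rightarrow> expr \<Rightarrow> expr" where "consE h t = EFold (EInjR (EPair h t))"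

definition appendE :: expr where
  "appendE = ERec ''app'' ''l'' (Lam ''r''
     (ECase (EUnfold (V ''l'')) ''_u'' (V ''r'')
        ''p'' (consE (EFst (V ''p'')) (EApp2 (V ''app'') (ESnd (V ''p'')) (V ''r'')))))"

text \<open>Serialization scheme (self-delimiting, tag-prefixed):
  string s: s, decimal length, colon, s;  int n: i, decimal n, colon;
  pair: p, ser a, ser b;  inl: l, ser a;  inr: r, ser b;  fold: f, ser a;
  authenticated value: serialization of its hash string (as a string).\<close>

definition serStrE :: expr where
  "serStrE = Lam ''s'' (ECat (ECat (ECat (EStr ''s'') (EUn IntToStrOp (EUn StrLenOp (V ''s''))))
                              (EStr '':'')) (V ''s''))"

definition serIntE :: expr where
  "serIntE = Lam ''n'' (ECat (ECat (EStr ''i'') (EUn IntToStrOp (V ''n''))) (EStr '':''))"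

text \<open>Deserializers have type string -> int -> 1 + (a * int): parse starting at a position,
  returning the value and the position after it.\<close>

definition tagAt :: "expr \<Rightarrow> expr \<Rightarrow> string \<Rightarrow> expr" where
  "tagAt s i t = EEq (ESubstr s i (EInt 1)) (EStr t)"

definition findColonE :: expr where
  "findColonE = ERec ''fc'' ''s'' (Lam ''j''
     (EIf (ELt (V ''j'') (EUn StrLenOp (V ''s'')))
        (EIf (tagAt (V ''s'') (V ''j'') '':'') (ESome (V ''j''))
             (EApp2 (V ''fc'') (V ''s'') (EAdd (V ''j'') (EInt 1))))
        ENone))"

definition deserIntE :: expr where
  "deserIntE = Lam ''s'' (Lam ''i''
     (EIf (tagAt (V ''s'') (V ''i'') ''i'')
        (EMatch (EApp2 findColonE (V ''s'') (EAdd (V ''i'') (EInt 1))) ENone ''j''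
          (EMatch (EUn StrToIntOp (ESubstr (V ''s'') (EAdd (V ''i'') (EInt 1))
                                     (ESub (V ''j'') (EAdd (V ''i'') (EInt 1))))) ENone ''n''
             (ESome (EPair (V ''n'') (EAdd (V ''j'') (EInt 1))))))
        ENone))"

definition deserStrE :: expr where
  "deserStrE = Lam ''s'' (Lam ''i''
     (EIf (tagAt (V ''s'') (V ''i'') ''s'')
        (EMatch (EApp2 findColonE (V ''s'') (EAdd (V ''i'') (EInt 1))) ENone ''j''
          (EMatch (EUn StrToIntOp (ESubstr (V ''s'') (EAdd (V ''i'') (EInt 1))
                                     (ESub (V ''j'') (EAdd (V ''i'') (EInt 1))))) ENone ''n''
             (EIf (ELt (V ''n'') (EInt 0)) ENone
               (EIf (ELt (EUn StrLenOp (V ''s'')) (EAdd (EAdd (V ''j'') (EInt 1)) (V ''n''))) ENone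
                  (ESome (EPair (ESubstr (V ''s'') (EAdd (V ''j'') (EInt 1)) (V ''n''))
                                (EAdd (EAdd (V ''j'') (EInt 1)) (V ''n''))))))))
        ENone))"

definition deserPairE :: "expr \<Rightarrow> expr \<Rightarrow> expr" where
  "deserPairE da db = Lam ''s'' (Lam ''i''
     (EIf (tagAt (V ''s'') (V ''i'') ''p'')
        (EMatch (EApp2 da (V ''s'') (EAdd (V ''i'') (EInt 1))) ENone ''r1''
          (EMatch (EApp2 db (V ''s'') (ESnd (V ''r1''))) ENone ''r2''
             (ESome (EPair (EPair (EFst (V ''r1'')) (EFst (V ''r2''))) (ESnd (V ''r2''))))))
        ENone))"

definition deserSumE :: "expr \<Rightarrow> expr \<Rightarrow> expr" where
  "deserSumE da db = Lam ''s'' (Lam ''i''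
     (EIf (tagAt (V ''s'') (V ''i'') ''l'')
        (EMatch (EApp2 da (V ''s'') (EAdd (V ''i'') (EInt 1))) ENone ''r1''
           (ESome (EPair (EInjL (EFst (V ''r1''))) (ESnd (V ''r1'')))))
        (EIf (tagAt (V ''s'') (V ''i'') ''r'')
          (EMatch (EApp2 db (V ''s'') (EAdd (V ''i'') (EInt 1))) ENone ''r1''
             (ESome (EPair (EInjR (EFst (V ''r1''))) (ESnd (V ''r1'')))))
          ENone)))"

definition deserMuE :: "expr \<Rightarrow> expr" where
  "deserMuE d = Lam ''s'' (Lam ''i''
     (EIf (tagAt (V ''s'') (V ''i'') ''f'')
        (EMatch (EApp2 d (V ''s'') (EAdd (V ''i'') (EInt 1))) ENone ''r1''
           (ESome (EPair (EFold (EFst (V ''r1''))) (ESnd (V ''r1'')))))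
        ENone))"

definition deserializeE :: expr where
  "deserializeE = Lam ''d'' (Lam ''s''
     (EMatch (EApp2 (V ''d'') (V ''s'') (EInt 0)) ENone ''r''
        (EIf (EEq (ESnd (V ''r'')) (EUn StrLenOp (V ''s''))) (ESome (EFst (V ''r''))) ENone)))"

definition retP :: expr where
  "retP = ETLam (Lam ''a'' (Lam ''u'' (EPair nilE (V ''a''))))"

definition bindP :: expr where
  "bindP = ETLam (ETLam (Lam ''c'' (Lam ''f'' (Lam ''u''
     (ELet ''r1'' (EApp (V ''c'') EUnit)
       (ELet ''r2'' (EApp2 (V ''f'') (ESnd (V ''r1'')) EUnit)
          (EPair (EApp2 appendE (EFst (V ''r1'')) (EFst (V ''r2''))) (ESnd (V ''r2'')))))))))"

definition eviAuthP :: expr where "eviAuthP = ETLam (Lam ''x'' (EApp serStrE (ESnd (V ''x''))))"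
definition eviPairP :: expr where
  "eviPairP = ETLam (ETLam (Lam ''ea'' (Lam ''eb'' (Lam ''x''
     (ECat (ECat (EStr ''p'') (EApp (V ''ea'') (EFst (V ''x'')))) (EApp (V ''eb'') (ESnd (V ''x''))))))))"
definition eviSumP :: expr where
  "eviSumP = ETLam (ETLam (Lam ''ea'' (Lam ''eb'' (Lam ''x''
     (ECase (V ''x'') ''y'' (ECat (EStr ''l'') (EApp (V ''ea'') (V ''y'')))
                      ''y'' (ECat (EStr ''r'') (EApp (V ''eb'') (V ''y''))))))))"
definition eviMuP :: expr where
  "eviMuP = ETLam (Lam ''ef'' (Lam ''x'' (ECat (EStr ''f'') (EApp (V ''ef'') (EUnfold (V ''x''))))))"
definition authP :: expr where
  "authP = ETLam (Lam ''ev'' (Lam ''a'' (EPair (V ''a'') (EHash (EApp (V ''ev'') (V ''a''))))))"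
definition unauthP :: expr where
  "unauthP = ETLam (Lam ''ev'' (Lam ''x'' (Lam ''u''
     (EPair (consE (EApp (V ''ev'') (EFst (V ''x''))) nilE) (EFst (V ''x''))))))"

definition AuthentikitP :: expr where
  "AuthentikitP = EPair retP (EPair bindP (EPack
     (EPair eviAuthP (EPair eviPairP (EPair eviSumP (EPair serStrE (EPair serIntE
       (EPair eviMuP (EPair authP unauthP)))))))))"

definition runP :: expr where "runP = Lam ''c'' (EApp (V ''c'') EUnit)"

subsection \<open>Verifier implementation (evidence = (serializer, deserializer))\<close>

definition retV :: expr where
  "retV = ETLam (Lam ''a'' (Lam ''p'' (ESome (EPair (V ''p'') (V ''a'')))))"

definition bindV :: expr where
  "bindV = ETLam (ETLam (Lam ''c'' (Lam ''f'' (Lam ''p''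
     (EMatch (EApp (V ''c'') (V ''p'')) ENone ''r''
        (EApp2 (V ''f'') (ESnd (V ''r'')) (EFst (V ''r''))))))))"

definition eviStrV :: expr where "eviStrV = EPair serStrE deserStrE"
definition eviIntV :: expr where "eviIntV = EPair serIntE deserIntE"
definition eviAuthV :: expr where "eviAuthV = ETLam eviStrV"
definition eviPairV :: expr where
  "eviPairV = ETLam (ETLam (Lam ''ea'' (Lam ''eb'' (EPair
     (Lam ''x'' (ECat (ECat (EStr ''p'') (EApp (EFst (V ''ea'')) (EFst (V ''x''))))
                      (EApp (EFst (V ''eb'')) (ESnd (V ''x'')))))
     (deserPairE (ESnd (V ''ea'')) (ESnd (V ''eb'')))))))"
definition eviSumV :: expr where
  "eviSumV = ETLam (ETLam (Lam ''ea'' (Lam ''eb'' (EPair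
     (Lam ''x'' (ECase (V ''x'') ''y'' (ECat (EStr ''l'') (EApp (EFst (V ''ea'')) (V ''y'')))
                                 ''y'' (ECat (EStr ''r'') (EApp (EFst (V ''eb'')) (V ''y'')))))
     (deserSumE (ESnd (V ''ea'')) (ESnd (V ''eb'')))))))"
definition eviMuV :: expr where
  "eviMuV = ETLam (Lam ''ef'' (EPair
     (Lam ''x'' (ECat (EStr ''f'') (EApp (EFst (V ''ef'')) (EUnfold (V ''x'')))))
     (deserMuE (ESnd (V ''ef'')))))"
definition authV :: expr where
  "authV = ETLam (Lam ''ev'' (Lam ''a'' (EHash (EApp (EFst (V ''ev'')) (V ''a'')))))"
definition unauthV :: expr where
  "unauthV = ETLam (Lam ''ev'' (Lam ''h'' (Lam ''p''
     (ECase (EUnfold (V ''p'')) ''_e'' ENone ''c''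
        (EIf (EEq (EHash (EFst (V ''c''))) (V ''h''))
           (EMatch (EApp2 deserializeE (ESnd (V ''ev'')) (EFst (V ''c''))) ENone ''a''
              (ESome (EPair (ESnd (V ''c'')) (V ''a''))))
           ENone)))))"

definition AuthentikitV :: expr where
  "AuthentikitV = EPair retV (EPair bindV (EPack
     (EPair eviAuthV (EPair eviPairV (EPair eviSumV (EPair eviStrV (EPair eviIntV
       (EPair eviMuV (EPair authV unauthV)))))))))"

definition runV :: expr where
  "runV = Lam ''c'' (Lam ''p'' (EMatch (EApp (V ''c'') (V ''p'')) ENone ''r'' (ESome (ESnd (V ''r'')))))"

subsection \<open>Ideal implementation (evidence is trivial: unit)\<close>

definition AuthentikitI :: expr where
  "AuthentikitI = EPair
     (ETLam (Lam ''a'' (Lam ''u'' (V ''a''))))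
     (EPair (ETLam (ETLam (Lam ''c'' (Lam ''f'' (Lam ''u''
               (EApp2 (V ''f'') (EApp (V ''c'') EUnit) EUnit))))))
      (EPack
        (EPair (ETLam EUnit)
        (EPair (ETLam (ETLam (Lam ''ea'' (Lam ''eb'' EUnit))))
        (EPair (ETLam (ETLam (Lam ''ea'' (Lam ''eb'' EUnit))))
        (EPair EUnit
        (EPair EUnit
        (EPair (ETLam (Lam ''ef'' EUnit))
        (EPair (ETLam (Lam ''ev'' (Lam ''a'' (V ''a''))))
               (ETLam (Lam ''ev'' (Lam ''a'' (Lam ''u'' (V ''a''))))))))))))))"

definition runI :: expr where "runI = Lam ''c'' (EApp (V ''c'') EUnit)"

definition inst :: "expr \<Rightarrow> expr \<Rightarrow> expr" where "inst e K = EApp (ETApp (ETApp e)) K"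

end

theory Submission
  imports Defs
begin

text \<open>The three runs are compared by a syntactic simulation. Since \<open>auth\<close>, \<open>m\<close> and \<open>evi\<close> are abstract
  for the client, its typing derivation can be read as a derivation that three terms (prover, verifier,
  ideal) are related, where at the abstract types the related values are exactly those that the three
  implementations produce. An authenticated value is then a prover pair of a value and a hash, a verifier hash and an
  ideal value such that the verifier has a counterpart of the value with the same serialization, whose
  hash it is. By induction on the size of a big-step evaluation, an evaluation of the prover term is
  matched by the verifier and ideal terms, with the same locations allocated. Evidence is
  determined by the type, so the string emitted by \<open>unauth\<close> is the one that was hashed by \<open>auth\<close>: the
  verifier's comparison succeeds and, as deserialization inverts serialization, it recovers precisely
  the hidden counterpart. At primitive types related values are equal.

  Typing enters only through canonical forms, which need that convertible types built from constants
  have the same head and convertible arguments; this follows from confluence.\<close>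

subsection \<open>Type substitution\<close>

text \<open>The obstacle is the combination of impredicative polymorphism, recursive types and
  higher-order references: a relation defined by recursion on the meaning of types would need step
  indices and recursively defined worlds. Here \<open>rel\<close> is an inductively defined set of
  triples of terms. It occurs only positively in its own rules, and locations carry syntactic types,
  so no such construction is required. The price is that every value that can inhabit an abstract
  type has to be listed explicitly, including partially applied operations and suspended
  computations.

  A computation of type \<open>m\<close> is a mere closure while the client code runs; return, bind
  and unauth only build it. What it does is the subject of a second simulation,
  \<open>run_sim\<close>, which applies such a closure to unit (prover and ideal) or to a proof
  (verifier) and falls back on the first simulation \<open>sim\<close> whenever bind calls a client
  function. The prover's proof is also only produced there, which is why the statement about the
  verifier's remaining proof belongs to \<open>run_sim\<close> and not to the relation.\<close>

primrec tren :: "(nat \<Rightarrow> nat) \<Rightarrow> ty \<Rightarrow> ty" where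
  "tren r (TV n) = TV (r n)"
| "tren r (TC c) = TC c"
| "tren r (TAbs \<kappa> t) = TAbs \<kappa> (tren (case_nat 0 (Suc \<circ> r)) t)"
| "tren r (TAp t u) = TAp (tren r t) (tren r u)"

definition up :: "(nat \<Rightarrow> ty) \<Rightarrow> nat \<Rightarrow> ty" where
  "up s = case_nat (TV 0) (tlift 0 \<circ> s)"

primrec tms :: "(nat \<Rightarrow> ty) \<Rightarrow> ty \<Rightarrow> ty" where
  "tms s (TV n) = s n"
| "tms s (TC c) = TC c"
| "tms s (TAbs \<kappa> t) = TAbs \<kappa> (tms (up s) t)"
| "tms s (TAp t u) = TAp (tms s t) (tms s u)"

lemma tlift_tren: "tlift k t = tren (\<lambda>n. if n < k then n else Suc n) t"
proof (induction t arbitrary: k)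
  case (TAbs \<kappa> t)
  have "case_nat 0 (Suc \<circ> (\<lambda>n. if n < k then n else Suc n)) = (\<lambda>n. if n < Suc k then n else Suc n)"
    by (auto simp: fun_eq_iff split: nat.splits)
  with TAbs show ?case by simp
qed auto

lemma tlift0_tren: "tlift 0 t = tren Suc t"
  by (simp add: tlift_tren)

lemma tren_tren: "tren r (tren r' t) = tren (r \<circ> r') t"
proof (induction t arbitrary: r r')
  case (TAbs \<kappa> t)
  have "case_nat 0 (Suc \<circ> r) \<circ> case_nat 0 (Suc \<circ> r') = case_nat 0 (Suc \<circ> (r \<circ> r'))"
    by (auto simp: fun_eq_iff split: nat.splits)
  then show ?case by (simp only: tren.simps tms.simps TAbs.IH)
qed auto

lemma tms_tren: "tms s (tren r t) = tms (s \<circ> r) t"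
proof (induction t arbitrary: s r)
  case (TAbs \<kappa> t)
  have "up s \<circ> case_nat 0 (Suc \<circ> r) = up (s \<circ> r)"
    by (auto simp: fun_eq_iff up_def split: nat.splits)
  then show ?case by (simp only: tren.simps tms.simps TAbs.IH)
qed auto

lemma tren_tms: "tren r (tms s t) = tms (tren r \<circ> s) t"
proof (induction t arbitrary: s r)
  case (TAbs \<kappa> t)
  have "tren (case_nat 0 (Suc \<circ> r)) \<circ> up s = up (tren r \<circ> s)"
    by (auto simp: fun_eq_iff up_def tlift0_tren tren_tren comp_def split: nat.splits)
  then show ?case by (simp only: tren.simps tms.simps TAbs.IH)
qed auto

text \<open>Under a binder \<open>up\<close> lifts by a renaming, so this law rests on the two
  preceding ones that mix a renaming with a substitution.\<close>

lemma tms_tms: "tms s (tms s' t) = tms (tms s \<circ> s') t"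
proof (induction t arbitrary: s s')
  case (TAbs \<kappa> t)
  have "tms (up s) \<circ> up s' = up (tms s \<circ> s')"
    by (auto simp: fun_eq_iff up_def tlift0_tren tms_tren tren_tms comp_def split: nat.splits)
  then show ?case by (simp only: tren.simps tms.simps TAbs.IH)
qed auto

lemma tms_TV [simp]: "tms TV t = t"
proof (induction t)
  case (TAbs \<kappa> t)
  have "up TV = TV" by (auto simp: fun_eq_iff up_def split: nat.splits)
  with TAbs show ?case by simp
qed auto

lemma tms_lift: "tms (case_nat u s) (tlift 0 t) = tms s t"
  by (simp add: tlift0_tren tms_tren comp_def)

lemma tsubst_tms: "tsubst k u t = tms (\<lambda>n. if n < k then TV n else if n = k then u else TV (n - 1)) t"
proof (induction t arbitrary: k u)
  case (TAbs \<kappa> t)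
  have "up (\<lambda>n. if n < k then TV n else if n = k then u else TV (n - 1))
      = (\<lambda>n. if n < Suc k then TV n else if n = Suc k then tlift 0 u else TV (n - 1))"
    by (auto simp: fun_eq_iff up_def split: nat.splits)
  with TAbs show ?case by simp
qed auto

lemma tsubst0_tms: "tsubst 0 u t = tms (case_nat u TV) t"
proof -
  have "(\<lambda>n. if n < 0 then TV n else if n = 0 then u else TV (n - 1)) = case_nat u TV"
    by (auto simp: fun_eq_iff split: nat.splits)
  then show ?thesis by (simp add: tsubst_tms)
qed

lemma tsubst_lift [simp]: "tsubst 0 u (tlift 0 t) = t"
  by (simp add: tsubst0_tms tms_lift)

text \<open>Instantiating a bound type variable below an outer substitution amounts to extending
  that substitution by the instance. In \<open>typed_rel\<close> this is what reduces a type
  abstraction to the induction hypothesis at \<open>case_nat u s\<close>.\<close>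

lemma tsubst_tms_up: "tsubst 0 u (tms (up s) t) = tms (case_nat u s) t"
proof -
  have "tms (case_nat u TV) \<circ> up s = case_nat u s"
    by (auto simp: fun_eq_iff up_def tms_lift split: nat.splits)
  then show ?thesis by (simp add: tsubst0_tms tms_tms)
qed

lemma tms_tsubst: "tms s (tsubst 0 u t) = tsubst 0 (tms s u) (tms (up s) t)"
proof -
  have "tms s \<circ> case_nat u TV = case_nat (tms s u) s"
    by (auto simp: fun_eq_iff split: nat.splits)
  then show ?thesis by (simp add: tsubst_tms_up) (simp add: tsubst0_tms tms_tms)
qed

lemma tequiv_tms: "tequiv t u \<Longrightarrow> tequiv (tms s t) (tms s u)"
proof (induction arbitrary: s rule: tequiv.induct)
  case (TE_beta \<kappa> t u)
  then show ?case by (simp add: tms_tsubst tequiv.TE_beta)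
qed (auto intro: tequiv.intros)

subsection \<open>Confluence of type conversion\<close>

text \<open>Parallel reduction in the sense of Tait and Martin-Loef. Single beta steps lack the
  diamond property because a substitution may duplicate or erase redexes; contracting any set of
  existing redexes at once repairs this.\<close>

inductive par :: "ty \<Rightarrow> ty \<Rightarrow> bool" where
  par_TV: "par (TV n) (TV n)"
| par_TC: "par (TC c) (TC c)"
| par_Abs: "par t t' \<Longrightarrow> par (TAbs \<kappa> t) (TAbs \<kappa> t')"
| par_Ap: "par t t' \<Longrightarrow> par u u' \<Longrightarrow> par (TAp t u) (TAp t' u')"
| par_beta: "par t t' \<Longrightarrow> par u u' \<Longrightarrow> par (TAp (TAbs \<kappa> t) u) (tsubst 0 u' t')"

inductive_cases par_elims: "par (TV n) u" "par (TC c) u" "par (TAbs \<kappa> t) u" "par (TAp t1 t2) u"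

lemma par_refl [simp]: "par t t"
  by (induction t) (auto intro: par.intros)

lemma par_tms:
  assumes "par t t'" "\<And>n. par (s n) (s' n)"
  shows "par (tms s t) (tms s' t')"
proof -
  \<comment> \<open>\<open>up\<close> lifts the components of the substitutions, so below a binder
    stability under renaming must already be known.\<close>
  have ren: "par (tren r t) (tren r t')" if "par t t'" for r t t'
    using that
  proof (induction arbitrary: r rule: par.induct)
    case (par_beta t t' u u' \<kappa>)
    have "tren r (tsubst 0 u' t') = tsubst 0 (tren r u') (tren (case_nat 0 (Suc \<circ> r)) t')"
      by (auto simp: tsubst0_tms tren_tms tms_tren comp_def fun_eq_iff
               intro!: arg_cong[where f = "\<lambda>s. tms s t'"] split: nat.splits)
    with par_beta show ?case by (simp add: par.par_beta)
  qed (auto intro: par.intros)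
  from assms show ?thesis
  proof (induction arbitrary: s s' rule: par.induct)
    case (par_Abs t t' \<kappa>)
    have "par (up s n) (up s' n)" for n
      using par_Abs.prems by (auto simp: up_def tlift0_tren ren split: nat.splits)
    with par_Abs.IH show ?case by (simp add: par.par_Abs)
  next
    case (par_beta t t' u u' \<kappa>)
    have "par (up s n) (up s' n)" for n
      using par_beta.prems by (auto simp: up_def tlift0_tren ren split: nat.splits)
    with par_beta show ?case by (simp add: tms_tsubst par.par_beta)
  qed (auto intro: par.intros)
qed

lemma par_tsubst: "par t t' \<Longrightarrow> par u u' \<Longrightarrow> par (tsubst 0 u t) (tsubst 0 u' t')"
  unfolding tsubst0_tms by (rule par_tms) (auto split: nat.splits)

text \<open>Takahashi's complete development: it contracts all redexes of a type at once, so every parallel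
  reduct reduces to it, which gives the diamond property.\<close>

fun dev :: "ty \<Rightarrow> ty" where
  "dev (TV n) = TV n"
| "dev (TC c) = TC c"
| "dev (TAbs \<kappa> t) = TAbs \<kappa> (dev t)"
| "dev (TAp (TAbs \<kappa> t) u) = tsubst 0 (dev u) (dev t)"
| "dev (TAp t u) = TAp (dev t) (dev u)"

lemma par_dev: "par t u \<Longrightarrow> par u (dev t)"
proof (induction rule: par.induct)
  case (par_Ap t t' u u')
  show ?case
  \<comment> \<open>A reduct of an abstraction is an abstraction, so a redex contracted by
    \<open>dev\<close> is still present in the reduct and can be contracted there.\<close>
  proof (cases "\<exists>\<kappa> b. t = TAbs \<kappa> b")
    case True
    then obtain \<kappa> b b' where "t = TAbs \<kappa> b" "t' = TAbs \<kappa> b'"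
      using par_Ap.hyps(1) by (auto elim: par_elims)
    with par_Ap show ?thesis by (auto elim!: par_elims(3) intro: par.par_beta)
  next
    case False
    then have "dev (TAp t u) = TAp (dev t) (dev u)" by (cases t) auto
    with par_Ap show ?thesis by (auto intro: par.intros)
  qed
qed (auto intro: par.intros par_tsubst)

lemma par_diamond:
  assumes "par\<^sup>*\<^sup>* t u" "par\<^sup>*\<^sup>* t v"
  shows "\<exists>w. par\<^sup>*\<^sup>* u w \<and> par\<^sup>*\<^sup>* v w"
proof -
  \<comment> \<open>Strip lemma: the single step to \<open>v\<close> is pushed along the sequence
    from \<open>t\<close> to \<open>u\<close>, each square being closed at the complete development
    of its corner.\<close>
  have strip: "\<exists>w. par u w \<and> par\<^sup>*\<^sup>* v w" if "par\<^sup>*\<^sup>* t u" "par t v" for t u v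
    using that
  proof (induction arbitrary: v rule: converse_rtranclp_induct)
    case (step t t')
    then have "par t' (dev t)" "par v (dev t)" by (auto intro: par_dev)
    with step show ?case by (meson converse_rtranclp_into_rtranclp)
  qed auto
  from assms(2,1) show ?thesis
  proof (induction arbitrary: u rule: converse_rtranclp_induct)
    case (step t t')
    with strip[of t u t'] show ?case by (meson converse_rtranclp_into_rtranclp)
  qed auto
qed

text \<open>Church-Rosser property. Joinability is symmetric and compatible with the constructors by
  itself; confluence enters only through transitivity.\<close>

lemma tequiv_join: "tequiv t u \<Longrightarrow> \<exists>w. par\<^sup>*\<^sup>* t w \<and> par\<^sup>*\<^sup>* u w"
proof (induction rule: tequiv.induct)
  case (TE_trans t s u)
  then obtain w w' where "par\<^sup>*\<^sup>* t w" "par\<^sup>*\<^sup>* s w" "par\<^sup>*\<^sup>* s w'" "par\<^sup>*\<^sup>* u w'" by blast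
  with par_diamond[of s w w'] show ?case by (meson rtranclp_trans)
next
  case (TE_beta \<kappa> t s)
  have "par (TAp (TAbs \<kappa> t) s) (tsubst 0 s t)" by (rule par.par_beta) auto
  then show ?case by blast
next
  case (TE_abs t s \<kappa>)
  have "par\<^sup>*\<^sup>* (TAbs \<kappa> t) (TAbs \<kappa> u)" if "par\<^sup>*\<^sup>* t u" for t u
    using that by (induction rule: rtranclp_induct) (auto intro: par.par_Abs rtranclp.rtrancl_into_rtrancl)
  with TE_abs show ?case by blast
next
  case (TE_app t1 s1 t2 s2)
  have "par\<^sup>*\<^sup>* (TAp t u) (TAp t' u')" if "par\<^sup>*\<^sup>* t t'" "par\<^sup>*\<^sup>* u u'" for t t' u u'
  proof -
    have "par\<^sup>*\<^sup>* (TAp t u) (TAp t' u)"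
      using that(1)
      by (induction rule: rtranclp_induct) (auto intro: par.par_Ap[OF _ par_refl] rtranclp.rtrancl_into_rtrancl)
    also have "par\<^sup>*\<^sup>* (TAp t' u) (TAp t' u')"
      using that(2)
      by (induction rule: rtranclp_induct) (auto intro: par.par_Ap[OF par_refl] rtranclp.rtrancl_into_rtrancl)
    finally show ?thesis .
  qed
  with TE_app show ?case by blast
qed auto

lemma par_tequiv: "par\<^sup>*\<^sup>* t u \<Longrightarrow> tequiv t u"
proof (induction rule: rtranclp_induct)
  case (step u v)
  have "tequiv u v" using step.hyps(2)
  proof (induction rule: par.induct)
    case (par_beta t t' u u' \<kappa>)
    then show ?case by (meson TE_abs TE_app TE_beta TE_trans)
  qed (auto intro: tequiv.intros)
  with step show ?case by (auto intro: tequiv.intros)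
qed (auto intro: tequiv.intros)

lemma tapps_Nil [simp]: "tapps t [] = t"
  and tapps_Cons [simp]: "tapps t (a # as) = tapps (TAp t a) as"
  and tapps_snoc: "tapps t (as @ [a]) = TAp (tapps t as) a"
  by (auto simp: tapps_def)

text \<open>A constant at the head never becomes an abstraction, so no redex can arise along the
  spine and all reduction takes place inside the arguments.\<close>

lemma par_rigid:
  "par (tapps (TC c) as) u \<Longrightarrow> \<exists>bs. u = tapps (TC c) bs \<and> list_all2 par as bs"
proof (induction as arbitrary: u rule: rev_induct)
  case (snoc a as)
  from snoc.prems have "par (TAp (tapps (TC c) as) a) u" by (simp add: tapps_snoc)
  then show ?case
  proof (cases rule: par_elims(4)[consumes 1, case_names Ap beta])
    case (Ap t' a')
    with snoc.IH obtain bs where "t' = tapps (TC c) bs" "list_all2 par as bs" by blast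
    with Ap show ?thesis by (intro exI[of _ "bs @ [a']"]) (auto simp: tapps_snoc intro: list_all2_appendI)
  next
    case (beta t t' u' \<kappa>)
    then show ?thesis by (cases as rule: rev_cases) (auto simp: tapps_snoc)
  qed
qed (auto elim: par_elims)

lemma pars_rigid:
  "par\<^sup>*\<^sup>* (tapps (TC c) as) u \<Longrightarrow> \<exists>bs. u = tapps (TC c) bs \<and> list_all2 (par\<^sup>*\<^sup>*) as bs"
proof (induction rule: rtranclp_induct)
  case base
  then show ?case by (auto intro!: list_all2_refl)
next
  case (step u v)
  then obtain bs where bs: "u = tapps (TC c) bs" "list_all2 (par\<^sup>*\<^sup>*) as bs" by blast
  from par_rigid step.hyps(2) bs(1) obtain cs where "v = tapps (TC c) cs" "list_all2 par bs cs" by metis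
  with bs show ?case
    by (auto intro!: list_all2_trans[of "par\<^sup>*\<^sup>*" par "par\<^sup>*\<^sup>*" as bs] rtranclp.rtrancl_into_rtrancl)
qed

lemma tapps_rigid_inject [simp]:
  "tapps (TC c) as = tapps (TC d) bs \<longleftrightarrow> c = d \<and> as = bs"
proof (induction as arbitrary: bs rule: rev_induct)
  case Nil
  then show ?case by (cases bs rule: rev_cases) (auto simp: tapps_snoc)
next
  case (snoc a as)
  then show ?case by (cases bs rule: rev_cases) (auto simp: tapps_snoc)
qed

text \<open>Injectivity and distinctness of type constructors up to conversion: both types reduce to
  a common reduct, which by \<open>pars_rigid\<close> still displays head and arguments of each. The
  shared type \<open>t\<close> is left arbitrary so that two presentations of one type can be
  compared directly.\<close>

lemma tequiv_rigid:
  assumes "tequiv (tapps (TC c) as) t" "tequiv (tapps (TC d) bs) t"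
  shows "c = d \<and> list_all2 tequiv as bs"
proof -
  from assms have "tequiv (tapps (TC c) as) (tapps (TC d) bs)" by (blast intro: tequiv.intros)
  from tequiv_join[OF this] obtain w where
    w: "par\<^sup>*\<^sup>* (tapps (TC c) as) w" "par\<^sup>*\<^sup>* (tapps (TC d) bs) w" by blast
  from pars_rigid[OF w(1)] pars_rigid[OF w(2)] obtain cs where
    "c = d" "list_all2 (par\<^sup>*\<^sup>*) as cs" "list_all2 (par\<^sup>*\<^sup>*) bs cs" by auto
  then show ?thesis
    unfolding list_all2_conv_all_nth by (metis par_tequiv TE_trans TE_sym)
qed

subsection \<open>Big-step evaluation\<close>

text \<open>The index counts the rule applications other than \<open>B_Val\<close> and serves as the
  induction measure of both simulations. \<open>B_Load\<close> evaluates the loaded content once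
  more: a state carries no guarantee that its heap holds values, and this form lets every small load
  step be absorbed regardless of the state.\<close>

inductive big :: "('i \<Rightarrow> string \<Rightarrow> string) \<Rightarrow> nat \<Rightarrow> expr \<Rightarrow> 'i state \<Rightarrow> expr \<Rightarrow> 'i state \<Rightarrow> bool"
  for hf :: "'i \<Rightarrow> string \<Rightarrow> string" where
  B_Val: "is_val v \<Longrightarrow> big hf 0 v \<sigma> v \<sigma>"
| B_App: "big hf n1 e1 \<sigma> (ERec f x b) \<sigma>1 \<Longrightarrow> big hf n2 e2 \<sigma>1 v \<sigma>2 \<Longrightarrow>
     big hf n3 (subst f (ERec f x b) (subst x v b)) \<sigma>2 w \<sigma>' \<Longrightarrow>
     big hf (Suc (n1 + n2 + n3)) (EApp e1 e2) \<sigma> w \<sigma>'"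
| B_TApp: "big hf n1 e \<sigma> (ETLam b) \<sigma>1 \<Longrightarrow> big hf n2 b \<sigma>1 w \<sigma>' \<Longrightarrow>
     big hf (Suc (n1 + n2)) (ETApp e) \<sigma> w \<sigma>'"
| B_Pack: "big hf n e \<sigma> v \<sigma>' \<Longrightarrow> big hf (Suc n) (EPack e) \<sigma> (EPack v) \<sigma>'"
| B_Unpack: "big hf n1 e1 \<sigma> (EPack v) \<sigma>1 \<Longrightarrow> big hf n2 (subst x v e2) \<sigma>1 w \<sigma>' \<Longrightarrow>
     big hf (Suc (n1 + n2)) (EUnpack e1 x e2) \<sigma> w \<sigma>'"
| B_Fold: "big hf n e \<sigma> v \<sigma>' \<Longrightarrow> big hf (Suc n) (EFold e) \<sigma> (EFold v) \<sigma>'"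
| B_Unfold: "big hf n e \<sigma> (EFold v) \<sigma>' \<Longrightarrow> big hf (Suc n) (EUnfold e) \<sigma> v \<sigma>'"
| B_Bin: "big hf n1 e1 \<sigma> v1 \<sigma>1 \<Longrightarrow> big hf n2 e2 \<sigma>1 v2 \<sigma>' \<Longrightarrow> bin_eval op v1 v2 = Some w \<Longrightarrow>
     big hf (Suc (n1 + n2)) (EBin op e1 e2) \<sigma> w \<sigma>'"
| B_Un: "big hf n e \<sigma> v \<sigma>' \<Longrightarrow> un_eval op v = Some w \<Longrightarrow> big hf (Suc n) (EUn op e) \<sigma> w \<sigma>'"
| B_Substr: "big hf n1 e1 \<sigma> (EStr s) \<sigma>1 \<Longrightarrow> big hf n2 e2 \<sigma>1 (EInt a) \<sigma>2 \<Longrightarrow>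
     big hf n3 e3 \<sigma>2 (EInt b) \<sigma>' \<Longrightarrow>
     big hf (Suc (n1 + n2 + n3)) (ESubstr e1 e2 e3) \<sigma> (EStr (take (nat b) (drop (nat a) s))) \<sigma>'"
| B_IfT: "big hf n1 e0 \<sigma> (EBool True) \<sigma>1 \<Longrightarrow> big hf n2 e1 \<sigma>1 w \<sigma>' \<Longrightarrow>
     big hf (Suc (n1 + n2)) (EIf e0 e1 e2) \<sigma> w \<sigma>'"
| B_IfF: "big hf n1 e0 \<sigma> (EBool False) \<sigma>1 \<Longrightarrow> big hf n2 e2 \<sigma>1 w \<sigma>' \<Longrightarrow>
     big hf (Suc (n1 + n2)) (EIf e0 e1 e2) \<sigma> w \<sigma>'"
| B_Pair: "big hf n1 e1 \<sigma> v1 \<sigma>1 \<Longrightarrow> big hf n2 e2 \<sigma>1 v2 \<sigma>' \<Longrightarrow>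
     big hf (Suc (n1 + n2)) (EPair e1 e2) \<sigma> (EPair v1 v2) \<sigma>'"
| B_Fst: "big hf n e \<sigma> (EPair v1 v2) \<sigma>' \<Longrightarrow> big hf (Suc n) (EFst e) \<sigma> v1 \<sigma>'"
| B_Snd: "big hf n e \<sigma> (EPair v1 v2) \<sigma>' \<Longrightarrow> big hf (Suc n) (ESnd e) \<sigma> v2 \<sigma>'"
| B_InjL: "big hf n e \<sigma> v \<sigma>' \<Longrightarrow> big hf (Suc n) (EInjL e) \<sigma> (EInjL v) \<sigma>'"
| B_InjR: "big hf n e \<sigma> v \<sigma>' \<Longrightarrow> big hf (Suc n) (EInjR e) \<sigma> (EInjR v) \<sigma>'"
| B_CaseL: "big hf n1 e0 \<sigma> (EInjL v) \<sigma>1 \<Longrightarrow> big hf n2 (subst x1 v e1) \<sigma>1 w \<sigma>' \<Longrightarrow>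
     big hf (Suc (n1 + n2)) (ECase e0 x1 e1 x2 e2) \<sigma> w \<sigma>'"
| B_CaseR: "big hf n1 e0 \<sigma> (EInjR v) \<sigma>1 \<Longrightarrow> big hf n2 (subst x2 v e2) \<sigma>1 w \<sigma>' \<Longrightarrow>
     big hf (Suc (n1 + n2)) (ECase e0 x1 e1 x2 e2) \<sigma> w \<sigma>'"
| B_Alloc: "big hf n e \<sigma> v (m, h, i) \<Longrightarrow> m l = None \<Longrightarrow>
     big hf (Suc n) (EAlloc e) \<sigma> (ELoc l) (m(l \<mapsto> v), h, i)"
| B_Load: "big hf n1 e \<sigma> (ELoc l) (m, h, i) \<Longrightarrow> m l = Some u \<Longrightarrow> big hf n2 u (m, h, i) w \<sigma>' \<Longrightarrow>
     big hf (Suc (n1 + n2)) (ELoad e) \<sigma> w \<sigma>'"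
| B_Store: "big hf n1 e1 \<sigma> (ELoc l) \<sigma>1 \<Longrightarrow> big hf n2 e2 \<sigma>1 v (m, h, i) \<Longrightarrow> m l \<noteq> None \<Longrightarrow>
     big hf (Suc (n1 + n2)) (EStore e1 e2) \<sigma> EUnit (m(l \<mapsto> v), h, i)"
| B_Hash: "big hf n e \<sigma> (EStr s) (m, h, i) \<Longrightarrow>
     big hf (Suc n) (EHash e) \<sigma> (EStr (hf i s)) (m, insert s h, i)"

lemma bin_eval_val: "bin_eval op v1 v2 = Some w \<Longrightarrow> is_val w"
  by (auto simp: bin_eval_def split: binop.splits option.splits)

lemma un_eval_val: "un_eval op v = Some w \<Longrightarrow> is_val w"
  by (auto simp: un_eval_def split: unop.splits option.splits)

lemma big_is_val: "big hf n e \<sigma> v \<sigma>' \<Longrightarrow> is_val v"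
  by (induction rule: big.induct) (auto dest: bin_eval_val un_eval_val)

inductive_cases big_cases:
  "big hf n (EVar x) \<sigma> w \<sigma>'" "big hf n (ERec f x b) \<sigma> w \<sigma>'" "big hf n (EApp e1 e2) \<sigma> w \<sigma>'"
  "big hf n (ETLam b) \<sigma> w \<sigma>'" "big hf n (ETApp e) \<sigma> w \<sigma>'" "big hf n (EPack e) \<sigma> w \<sigma>'"
  "big hf n (EUnpack e x e2) \<sigma> w \<sigma>'" "big hf n (EFold e) \<sigma> w \<sigma>'" "big hf n (EUnfold e) \<sigma> w \<sigma>'"
  "big hf n EUnit \<sigma> w \<sigma>'" "big hf n (EBool b) \<sigma> w \<sigma>'" "big hf n (EInt k) \<sigma> w \<sigma>'"
  "big hf n (EStr s) \<sigma> w \<sigma>'" "big hf n (ELoc l) \<sigma> w \<sigma>'" "big hf n (EBin op e1 e2) \<sigma> w \<sigma>'"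
  "big hf n (EUn op1 e) \<sigma> w \<sigma>'" "big hf n (ESubstr e1 e2 e3) \<sigma> w \<sigma>'"
  "big hf n (EIf e1 e2 e3) \<sigma> w \<sigma>'" "big hf n (EPair e1 e2) \<sigma> w \<sigma>'" "big hf n (EFst e) \<sigma> w \<sigma>'"
  "big hf n (ESnd e) \<sigma> w \<sigma>'" "big hf n (EInjL e) \<sigma> w \<sigma>'" "big hf n (EInjR e) \<sigma> w \<sigma>'"
  "big hf n (ECase e1 x1 e2 x2 e3) \<sigma> w \<sigma>'" "big hf n (EAlloc e) \<sigma> w \<sigma>'"
  "big hf n (ELoad e) \<sigma> w \<sigma>'" "big hf n (EStore e1 e2) \<sigma> w \<sigma>'" "big hf n (EHash e) \<sigma> w \<sigma>'"

text \<open>\<open>B_Val\<close> overlaps with the rules for constructors, so a compound value has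
  derivations of various sizes; all of them yield the value itself.\<close>

lemma big_val_cong: "is_val e \<Longrightarrow> big hf n e \<sigma> w \<sigma>' \<Longrightarrow> w = e \<and> \<sigma>' = \<sigma>"
  by (induction e arbitrary: n \<sigma> w \<sigma>') (simp_all, (erule big_cases; ((simp; fail) | blast))+)

definition ev :: "('i \<Rightarrow> string \<Rightarrow> string) \<Rightarrow> expr \<Rightarrow> 'i state \<Rightarrow> expr \<Rightarrow> 'i state \<Rightarrow> bool" where
  "ev hf e \<sigma> w \<sigma>' \<longleftrightarrow> (\<exists>n. big hf n e \<sigma> w \<sigma>')"

lemma ev_val: "is_val e \<Longrightarrow> ev hf e \<sigma> w \<sigma>' \<longleftrightarrow> w = e \<and> \<sigma>' = \<sigma>"
  using big_val_cong B_Val unfolding ev_def by metis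

lemma ev_is_val: "ev hf e \<sigma> w \<sigma>' \<Longrightarrow> is_val w"
  by (auto simp: ev_def dest: big_is_val)

text \<open>Introduction and inversion are merged into one equation per construct. Used as rewrite
  rules, these equations execute library code symbolically in both directions: to read off the
  result of a given prover run and to exhibit runs of the other two sides.\<close>

lemma ev_simps:
  "ev hf (EVar y) \<sigma> w \<sigma>' \<longleftrightarrow> False"
  "ev hf (ERec f x b) \<sigma> w \<sigma>' \<longleftrightarrow> w = ERec f x b \<and> \<sigma>' = \<sigma>"
  "ev hf (ETLam e) \<sigma> w \<sigma>' \<longleftrightarrow> w = ETLam e \<and> \<sigma>' = \<sigma>"
  "ev hf (ETApp e) \<sigma> w \<sigma>' \<longleftrightarrow> (\<exists>b \<sigma>1. ev hf e \<sigma> (ETLam b) \<sigma>1 \<and> ev hf b \<sigma>1 w \<sigma>')"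
  "ev hf (EUnpack e x e2) \<sigma> w \<sigma>' \<longleftrightarrow> (\<exists>v \<sigma>1. ev hf e \<sigma> (EPack v) \<sigma>1 \<and> ev hf (subst x v e2) \<sigma>1 w \<sigma>')"
  "ev hf (EUnfold e) \<sigma> w \<sigma>' \<longleftrightarrow> ev hf e \<sigma> (EFold w) \<sigma>'"
  "ev hf EUnit \<sigma> w \<sigma>' \<longleftrightarrow> w = EUnit \<and> \<sigma>' = \<sigma>"
  "ev hf (EBool c) \<sigma> w \<sigma>' \<longleftrightarrow> w = EBool c \<and> \<sigma>' = \<sigma>"
  "ev hf (EInt k) \<sigma> w \<sigma>' \<longleftrightarrow> w = EInt k \<and> \<sigma>' = \<sigma>"
  "ev hf (EStr s) \<sigma> w \<sigma>' \<longleftrightarrow> w = EStr s \<and> \<sigma>' = \<sigma>"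
  "ev hf (ELoc l) \<sigma> w \<sigma>' \<longleftrightarrow> w = ELoc l \<and> \<sigma>' = \<sigma>"
  "ev hf (EBin op e1 e2) \<sigma> w \<sigma>' \<longleftrightarrow>
     (\<exists>v1 v2 \<sigma>1. ev hf e1 \<sigma> v1 \<sigma>1 \<and> ev hf e2 \<sigma>1 v2 \<sigma>' \<and> bin_eval op v1 v2 = Some w)"
  "ev hf (EUn op1 e) \<sigma> w \<sigma>' \<longleftrightarrow> (\<exists>v. ev hf e \<sigma> v \<sigma>' \<and> un_eval op1 v = Some w)"
  "ev hf (ESubstr e1 e2 e3) \<sigma> w \<sigma>' \<longleftrightarrow>
     (\<exists>t a b \<sigma>1 \<sigma>2. ev hf e1 \<sigma> (EStr t) \<sigma>1 \<and> ev hf e2 \<sigma>1 (EInt a) \<sigma>2 \<and> ev hf e3 \<sigma>2 (EInt b) \<sigma>' \<and>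
        w = EStr (take (nat b) (drop (nat a) t)))"
  "ev hf (EIf e1 e2 e3) \<sigma> w \<sigma>' \<longleftrightarrow>
     (\<exists>\<sigma>1. ev hf e1 \<sigma> (EBool True) \<sigma>1 \<and> ev hf e2 \<sigma>1 w \<sigma>') \<or>
     (\<exists>\<sigma>1. ev hf e1 \<sigma> (EBool False) \<sigma>1 \<and> ev hf e3 \<sigma>1 w \<sigma>')"
  "ev hf (EFst e) \<sigma> w \<sigma>' \<longleftrightarrow> (\<exists>v. ev hf e \<sigma> (EPair w v) \<sigma>')"
  "ev hf (ESnd e) \<sigma> w \<sigma>' \<longleftrightarrow> (\<exists>v. ev hf e \<sigma> (EPair v w) \<sigma>')"
  "ev hf (ECase e1 x1 e2 x2 e3) \<sigma> w \<sigma>' \<longleftrightarrow>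
     (\<exists>u \<sigma>1. ev hf e1 \<sigma> u \<sigma>1 \<and>
        ((\<exists>v. u = EInjL v \<and> ev hf (subst x1 v e2) \<sigma>1 w \<sigma>') \<or>
         (\<exists>v. u = EInjR v \<and> ev hf (subst x2 v e3) \<sigma>1 w \<sigma>')))"
  "ev hf (EAlloc e) \<sigma> w \<sigma>' \<longleftrightarrow>
     (\<exists>v m h i l. ev hf e \<sigma> v (m, h, i) \<and> m l = None \<and> w = ELoc l \<and> \<sigma>' = (m(l \<mapsto> v), h, i))"
  "ev hf (ELoad e) \<sigma> w \<sigma>' \<longleftrightarrow>
     (\<exists>u m h i l. ev hf e \<sigma> (ELoc l) (m, h, i) \<and> m l = Some u \<and> ev hf u (m, h, i) w \<sigma>')"
  "ev hf (EStore e1 e2) \<sigma> w \<sigma>' \<longleftrightarrow>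
     (\<exists>v m h i l \<sigma>1. ev hf e1 \<sigma> (ELoc l) \<sigma>1 \<and> ev hf e2 \<sigma>1 v (m, h, i) \<and> m l \<noteq> None \<and>
        w = EUnit \<and> \<sigma>' = (m(l \<mapsto> v), h, i))"
  "ev hf (EHash e) \<sigma> w \<sigma>' \<longleftrightarrow>
     (\<exists>t m h i. ev hf e \<sigma> (EStr t) (m, h, i) \<and> w = EStr (hf i t) \<and> \<sigma>' = (m, insert t h, i))"
  unfolding ev_def
  by ((rule iffI,
    (elim exE big_cases; ((simp; fail) | blast)),
    ((simp; fail) | ((elim exE conjE disjE)?; hypsubst?; (rule exI, rule big.intros; (assumption | simp)))))[1])+

text \<open>Kept apart because as a rewrite rule it would open every application, also where the
  function is not yet known. Symbolic evaluation uses the directed variants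
  \<open>ev_App_Lam\<close>, \<open>ev_App_fun\<close> and \<open>ev_App_arg\<close>
  instead.\<close>

lemma ev_App:
  "ev hf (EApp e1 e2) \<sigma> w \<sigma>' \<longleftrightarrow> (\<exists>f x b v \<sigma>1 \<sigma>2. ev hf e1 \<sigma> (ERec f x b) \<sigma>1 \<and> ev hf e2 \<sigma>1 v \<sigma>2 \<and>
     ev hf (subst f (ERec f x b) (subst x v b)) \<sigma>2 w \<sigma>')"
  unfolding ev_def
  by ((rule iffI,
    (elim exE big_cases; ((simp; fail) | blast)),
    ((simp; fail) | ((elim exE conjE disjE)?; hypsubst?; (rule exI, rule big.intros; (assumption | simp)))))[1])

lemma ev_constr:
  "ev hf (EPack e) \<sigma> w \<sigma>' \<longleftrightarrow> (\<exists>v. ev hf e \<sigma> v \<sigma>' \<and> w = EPack v)"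
  "ev hf (EFold e) \<sigma> w \<sigma>' \<longleftrightarrow> (\<exists>v. ev hf e \<sigma> v \<sigma>' \<and> w = EFold v)"
  "ev hf (EInjL e) \<sigma> w \<sigma>' \<longleftrightarrow> (\<exists>v. ev hf e \<sigma> v \<sigma>' \<and> w = EInjL v)"
  "ev hf (EInjR e) \<sigma> w \<sigma>' \<longleftrightarrow> (\<exists>v. ev hf e \<sigma> v \<sigma>' \<and> w = EInjR v)"
  "ev hf (EPair e1 e2) \<sigma> w \<sigma>' \<longleftrightarrow> (\<exists>v1 v2 \<sigma>1. ev hf e1 \<sigma> v1 \<sigma>1 \<and> ev hf e2 \<sigma>1 v2 \<sigma>' \<and> w = EPair v1 v2)"
  unfolding ev_def
  by ((rule iffI,
    (elim exE big_cases; ((simp; fail) | blast | (simp only: is_val.simps, blast intro: B_Val))),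
    ((simp; fail) | ((elim exE conjE disjE)?; hypsubst?; (rule exI, rule big.intros; (assumption | simp)))))[1])+

lemma fill_append: "fill (K @ L) e = fill L (fill K e)"
  by (induction K arbitrary: e) auto

text \<open>In an admissible frame only values stand to the left of the hole. The content of the
  hole is therefore the first thing that is really evaluated, and exchanging it affects a single
  premise of the evaluation rule.\<close>

lemma ev_frame:
  assumes "\<And>v \<sigma>''. ev hf e' \<sigma>' v \<sigma>'' \<Longrightarrow> ev hf e \<sigma> v \<sigma>''" "frame_ok F" "ev hf (fill_frame F e') \<sigma>' v \<sigma>''"
  shows "ev hf (fill_frame F e) \<sigma> v \<sigma>''"
  using assms(2,3)
  by (cases F; simp add: frame_ok_def ev_simps ev_App ev_constr ev_val del: split_paired_Ex split del: if_split)
    ((elim exE conjE disjE)?; drule assms(1); blast)+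

lemma ev_head_step:
  assumes "head_step hf e \<sigma> e' \<sigma>'" "ev hf e' \<sigma>' v \<sigma>''"
  shows "ev hf e \<sigma> v \<sigma>''"
  using assms
  by (cases rule: head_step.cases; simp add: ev_simps ev_App ev_constr ev_val bin_eval_val un_eval_val
      del: split_paired_Ex split del: if_split; force?)

lemma ev_step:
  assumes "step hf (e, \<sigma>) (e', \<sigma>')" "ev hf e' \<sigma>' v \<sigma>''"
  shows "ev hf e \<sigma> v \<sigma>''"
proof -
  from assms(1) obtain K r r' where
    K: "e = fill K r" "e' = fill K r'" "head_step hf r \<sigma> r' \<sigma>'" "list_all frame_ok K"
    by cases blast
  have "ev hf (fill K r') \<sigma>' v \<sigma>'' \<Longrightarrow> ev hf (fill K r) \<sigma> v \<sigma>''" for v \<sigma>''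
    using K(4)
  \<comment> \<open>Frames are listed innermost first, so the outermost frame, under which
    evaluation is decomposed, is the last element.\<close>
  proof (induction K arbitrary: v \<sigma>'' rule: rev_induct)
    case Nil
    with ev_head_step[OF K(3)] show ?case by simp
  next
    case (snoc F K)
    then have F: "frame_ok F" and K': "list_all frame_ok K"
      and e: "ev hf (fill_frame F (fill K r')) \<sigma>' v \<sigma>''" by (simp_all add: fill_append)
    have "ev hf (fill_frame F (fill K r)) \<sigma> v \<sigma>''"
      by (rule ev_frame[OF _ F e]) (rule snoc.IH[OF _ K'])
    then show ?case by (simp add: fill_append)
  qed
  with K assms(2) show ?thesis by simp
qed

lemma steps_ev:
  assumes "steps hf (e, \<sigma>) (v, \<sigma>')" "is_val v"
  shows "ev hf e \<sigma> v \<sigma>'"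
  using assms(1)
proof (induction "(e, \<sigma>)" arbitrary: e \<sigma> rule: converse_rtranclp_induct)
  case base
  with assms(2) show ?case by (simp add: ev_val)
next
  case (step c)
  obtain e1 \<sigma>1 where c: "c = (e1, \<sigma>1)" by (cases c)
  from ev_step[OF step.hyps(1)[unfolded c] step.hyps(3)[OF c]] show ?case .
qed

section \<open>From big-step evaluation back to reduction sequences\<close>

lemma steps_frame:
  assumes "steps hf (e, \<sigma>) (e', \<sigma>')" "frame_ok F"
  shows "steps hf (fill_frame F e, \<sigma>) (fill_frame F e', \<sigma>')"
  using assms(1)
proof (induction "(e', \<sigma>')" arbitrary: e' \<sigma>' rule: rtranclp_induct)
  case (step c)
  obtain e1 \<sigma>1 where c: "c = (e1, \<sigma>1)" by (cases c)
  from step.hyps(2)[unfolded c] have "step hf (fill_frame F e1, \<sigma>1) (fill_frame F e', \<sigma>')"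
  proof cases
    case (1 r r' K)
    then have "step hf (fill (K @ [F]) r, \<sigma>1) (fill (K @ [F]) r', \<sigma>')"
      using assms(2) by (intro step.intros) auto
    with 1 show ?thesis by (simp add: fill_append)
  qed
  with step.hyps(3)[OF c] show ?case by (rule rtranclp.rtrancl_into_rtrancl)
qed auto

lemma head_steps: "head_step hf e \<sigma> e' \<sigma>' \<Longrightarrow> steps hf (e, \<sigma>) (e', \<sigma>')"
  using step.intros[of hf e \<sigma> e' \<sigma>' "[]"] by auto

lemma big_steps: "big hf n e \<sigma> v \<sigma>' \<Longrightarrow> steps hf (e, \<sigma>) (v, \<sigma>')"
proof (induction rule: big.induct)
  case (B_Val v \<sigma>)
  show ?case by simp
next
  case (B_App n1 e1 s f x b s1 n2 e2 v s2 n3 w s3)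
  from steps_frame[OF B_App.IH(1), of "FAppL e2"]
    steps_frame[OF B_App.IH(2), of "FAppR (ERec f x b)"]
    B_App.IH(3)
  show ?case by (simp add: frame_ok_def)
    ((erule rtranclp_trans)+,
      rule rtranclp_trans[OF head_steps[OF HS_Beta[OF big_is_val[OF B_App.hyps(2)]]]], (assumption | rule rtranclp.rtrancl_refl))
next
  case (B_TApp n1 e s b s1 n2 w s2)
  from steps_frame[OF B_TApp.IH(1), of FTApp]
    B_TApp.IH(2)
  show ?case by (simp add: frame_ok_def)
    ((erule rtranclp_trans)+,
      rule rtranclp_trans[OF head_steps[OF HS_TBeta]], (assumption | rule rtranclp.rtrancl_refl))
next
  case B_Pack
  from steps_frame[OF B_Pack.IH, of FPack]
  show ?case by (simp add: frame_ok_def)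
next
  case (B_Unpack n1 e1 s v s1 n2 x e2 w s2)
  from steps_frame[OF B_Unpack.IH(1), of "FUnpack x e2"]
    B_Unpack.IH(2)
  show ?case by (simp add: frame_ok_def)
    ((erule rtranclp_trans)+,
      rule rtranclp_trans[OF head_steps[OF HS_Unpack[OF big_is_val[OF B_Unpack.hyps(1), simplified]]]], (assumption | rule rtranclp.rtrancl_refl))
next
  case B_Fold
  from steps_frame[OF B_Fold.IH, of FFold]
  show ?case by (simp add: frame_ok_def)
next
  case B_Unfold
  from steps_frame[OF B_Unfold.IH, of FUnfold]
  show ?case by (simp add: frame_ok_def)
    ((erule rtranclp_trans)+,
      rule rtranclp_trans[OF head_steps[OF HS_Unfold[OF big_is_val[OF B_Unfold.hyps, simplified]]]], (assumption | rule rtranclp.rtrancl_refl))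
next
  case (B_Bin n1 e1 s v1 s1 n2 e2 v2 s2 op w)
  from steps_frame[OF B_Bin.IH(1), of "FBinL op e2"]
    steps_frame[OF B_Bin.IH(2), of "FBinR op v1"]
  show ?case by (simp add: frame_ok_def big_is_val[OF B_Bin.hyps(1)])
    ((erule rtranclp_trans)+,
      rule rtranclp_trans[OF head_steps[OF HS_Bin[OF big_is_val[OF B_Bin.hyps(1)] big_is_val[OF B_Bin.hyps(2)] B_Bin.hyps(3)]]], (assumption | rule rtranclp.rtrancl_refl))
next
  case (B_Un n e s v s1 op w)
  from steps_frame[OF B_Un.IH, of "FUn op"]
  show ?case by (simp add: frame_ok_def)
    ((erule rtranclp_trans)+,
      rule rtranclp_trans[OF head_steps[OF HS_Un[OF big_is_val[OF B_Un.hyps(1)] B_Un.hyps(2)]]], (assumption | rule rtranclp.rtrancl_refl))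
next
  case (B_Substr n1 e1 s t s1 n2 e2 a s2 n3 e3 b s3)
  from steps_frame[OF B_Substr.IH(1), of "FSubstr1 e2 e3"]
    steps_frame[OF B_Substr.IH(2), of "FSubstr2 (EStr t) e3"]
    steps_frame[OF B_Substr.IH(3), of "FSubstr3 (EStr t) (EInt a)"]
  show ?case by (simp add: frame_ok_def)
    ((erule rtranclp_trans)+,
      rule rtranclp_trans[OF head_steps[OF HS_Substr]], (assumption | rule rtranclp.rtrancl_refl))
next
  case (B_IfT n1 e0 s s1 n2 e1 w s2 e2)
  from steps_frame[OF B_IfT.IH(1), of "FIf e1 e2"]
    B_IfT.IH(2)
  show ?case by (simp add: frame_ok_def)
    ((erule rtranclp_trans)+,
      rule rtranclp_trans[OF head_steps[OF HS_IfT]], (assumption | rule rtranclp.rtrancl_refl))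
next
  case (B_IfF n1 e0 s s1 n2 e2 w s2 e1)
  from steps_frame[OF B_IfF.IH(1), of "FIf e1 e2"]
    B_IfF.IH(2)
  show ?case by (simp add: frame_ok_def)
    ((erule rtranclp_trans)+,
      rule rtranclp_trans[OF head_steps[OF HS_IfF]], (assumption | rule rtranclp.rtrancl_refl))
next
  case (B_Pair n1 e1 s v1 s1 n2 e2 v2 s2)
  from steps_frame[OF B_Pair.IH(1), of "FPairL e2"]
    steps_frame[OF B_Pair.IH(2), of "FPairR v1"]
  show ?case by (simp add: frame_ok_def big_is_val[OF B_Pair.hyps(1)])
next
  case (B_Fst n e s v1 v2 s1)
  from steps_frame[OF B_Fst.IH, of FFst]
  show ?case by (simp add: frame_ok_def)
    ((erule rtranclp_trans)+,
      rule rtranclp_trans[OF head_steps[OF HS_Fst[OF conjunct1[OF big_is_val[OF B_Fst.hyps, simplified]] conjunct2[OF big_is_val[OF B_Fst.hyps, simplified]]]]], (assumption | rule rtranclp.rtrancl_refl))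
next
  case (B_Snd n e s v1 v2 s1)
  from steps_frame[OF B_Snd.IH, of FSnd]
  show ?case by (simp add: frame_ok_def)
    ((erule rtranclp_trans)+,
      rule rtranclp_trans[OF head_steps[OF HS_Snd[OF conjunct1[OF big_is_val[OF B_Snd.hyps, simplified]] conjunct2[OF big_is_val[OF B_Snd.hyps, simplified]]]]], (assumption | rule rtranclp.rtrancl_refl))
next
  case B_InjL
  from steps_frame[OF B_InjL.IH, of FInjL]
  show ?case by (simp add: frame_ok_def)
next
  case B_InjR
  from steps_frame[OF B_InjR.IH, of FInjR]
  show ?case by (simp add: frame_ok_def)
next
  case (B_CaseL n1 e0 s v s1 n2 x1 e1 w s2 x2 e2)
  from steps_frame[OF B_CaseL.IH(1), of "FCase x1 e1 x2 e2"]
    B_CaseL.IH(2)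
  show ?case by (simp add: frame_ok_def)
    ((erule rtranclp_trans)+,
      rule rtranclp_trans[OF head_steps[OF HS_CaseL[OF big_is_val[OF B_CaseL.hyps(1), simplified]]]], (assumption | rule rtranclp.rtrancl_refl))
next
  case (B_CaseR n1 e0 s v s1 n2 x2 e2 w s2 x1 e1)
  from steps_frame[OF B_CaseR.IH(1), of "FCase x1 e1 x2 e2"]
    B_CaseR.IH(2)
  show ?case by (simp add: frame_ok_def)
    ((erule rtranclp_trans)+,
      rule rtranclp_trans[OF head_steps[OF HS_CaseR[OF big_is_val[OF B_CaseR.hyps(1), simplified]]]], (assumption | rule rtranclp.rtrancl_refl))
next
  case B_Alloc
  from steps_frame[OF B_Alloc.IH, of FAlloc]
  show ?case by (simp add: frame_ok_def)
    ((erule rtranclp_trans)+,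
      rule head_steps, rule HS_Alloc, rule big_is_val[OF B_Alloc.hyps(1)], rule B_Alloc.hyps(2))
next
  case B_Load
  from steps_frame[OF B_Load.IH(1), of FLoad]
    B_Load.IH(2)
  show ?case by (simp add: frame_ok_def)
    ((erule rtranclp_trans)+,
      rule rtranclp_trans[OF head_steps], rule HS_Load, rule B_Load.hyps(2), assumption)
next
  case (B_Store n1 e1 s l s1 n2 e2 v m h i)
  from steps_frame[OF B_Store.IH(1), of "FStoreL e2"]
    steps_frame[OF B_Store.IH(2), of "FStoreR (ELoc l)"]
  show ?case by (simp add: frame_ok_def)
    ((erule rtranclp_trans)+,
      rule head_steps, rule HS_Store, rule big_is_val[OF B_Store.hyps(2)], rule B_Store.hyps(3))
next
  case B_Hash
  from steps_frame[OF B_Hash.IH, of FHash]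
  show ?case by (simp add: frame_ok_def)
    ((erule rtranclp_trans)+,
      rule rtranclp_trans[OF head_steps[OF HS_Hash]], (assumption | rule rtranclp.rtrancl_refl))
qed

lemma ev_steps: "ev hf e \<sigma> v \<sigma>' \<Longrightarrow> steps hf (e, \<sigma>) (v, \<sigma>')"
  by (auto simp: ev_def intro: big_steps)

declare split_paired_Ex [simp del]

subsection \<open>Decimal notation\<close>

declare nat_to_str.simps [simp del]

text \<open>Codes 48 to 57 are the decimal digits. Their range excludes the minus sign, which
  separates negative from nonnegative numerals, and the colon, which the serialization uses as
  delimiter.\<close>

lemma nat_to_str_digits: "c \<in> set (nat_to_str n) \<Longrightarrow> 48 \<le> (of_char c :: nat) \<and> (of_char c :: nat) \<le> 57"
proof (induction n rule: nat_to_str.induct)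
  case (1 n)
  have "n mod 10 < 10" by simp
  with 1 show ?case by (subst (asm) (2) nat_to_str.simps) (auto split: if_splits)
qed

text \<open>Horner's rule reads the digits back and is an explicit left inverse, which gives
  injectivity at once; 48 is the code of the digit zero.\<close>

lemma nat_to_str_decode: "foldl (\<lambda>a c. 10 * a + (of_char c - 48)) 0 (nat_to_str n) = n"
proof (induction n rule: nat_to_str.induct)
  case (1 n)
  have "n mod 10 < 10" by simp
  with 1 show ?case by (subst nat_to_str.simps) auto
qed

lemma nat_to_str_inject: "nat_to_str m = nat_to_str n \<longleftrightarrow> m = n"
  by (metis nat_to_str_decode)

lemma nat_to_str_neq: "nat_to_str n \<noteq> CHR ''-'' # t"
proof
  assume "nat_to_str n = CHR ''-'' # t"
  then have "CHR ''-'' \<in> set (nat_to_str n)" by simp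
  then show False by (auto dest!: nat_to_str_digits)
qed

lemma int_to_str_inject: "int_to_str a = int_to_str b \<Longrightarrow> a = b"
  by (auto simp: int_to_str_def nat_to_str_inject nat_to_str_neq nat_to_str_neq[symmetric] split: if_splits)

lemma str_to_int_inverse [simp]: "str_to_int (int_to_str z) = Some z"
  unfolding str_to_int_def by (auto dest: int_to_str_inject intro!: the_equality)

lemma int_to_str_no_colon: "CHR '':'' \<notin> set (int_to_str z)"
  by (auto simp: int_to_str_def dest!: nat_to_str_digits)

subsection \<open>Symbolic evaluation of the library code\<close>

text \<open>\<open>Lam\<close> is a recursive function whose own name is the empty string, so each
  beta step also substitutes the closure for that name. This rule stops that second substitution at
  nested abstractions.\<close>

lemma subst_Lam [simp]:
  "subst y v (Lam x e) = (if y = '''' \<or> y = x then Lam x e else Lam x (subst y v e))"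
  by (simp add: Lam_def)

lemma subst_code [simp]:
  "subst y v (V x) = (if x = y then v else V x)"
  "subst y v (ECat a b) = ECat (subst y v a) (subst y v b)"
  "subst y v (EEq a b) = EEq (subst y v a) (subst y v b)"
  "subst y v (EAdd a b) = EAdd (subst y v a) (subst y v b)"
  "subst y v (ESub a b) = ESub (subst y v a) (subst y v b)"
  "subst y v (ELt a b) = ELt (subst y v a) (subst y v b)"
  "subst y v (EApp2 f a b) = EApp2 (subst y v f) (subst y v a) (subst y v b)"
  "subst y v (ESome a) = ESome (subst y v a)"
  "subst y v ENone = ENone"
  "subst y v nilE = nilE"
  "subst y v (consE a b) = consE (subst y v a) (subst y v b)"
  "subst y v (tagAt a b t) = tagAt (subst y v a) (subst y v b) t"
  "subst y v (ELet x a b) = ELet x (subst y v a) (if y = '''' \<or> y = x then b else subst y v b)"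
  "subst y v (EMatch a b x c) =
     EMatch (subst y v a) (if ''_none'' = y then b else subst y v b) x (if x = y then c else subst y v c)"
  by (simp_all add: V_def ECat_def EEq_def EAdd_def ESub_def ELt_def EApp2_def ESome_def ENone_def
      nilE_def consE_def tagAt_def ELet_def EMatch_def)

lemma is_val_code [simp]:
  "is_val (Lam x e)" "is_val nilE" "is_val (consE a b) = (is_val a \<and> is_val b)"
  "is_val (ESome a) = is_val a" "is_val ENone" "\<not> is_val (EApp2 f a b)" "\<not> is_val (V x)"
  "\<not> is_val (ECat a b)"
  by (simp_all add: Lam_def nilE_def consE_def ESome_def ENone_def EApp2_def V_def ECat_def)

lemma as_iff: "as_int v = Some a \<longleftrightarrow> v = EInt a" "as_str v = Some s \<longleftrightarrow> v = EStr s"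
    "as_bool v = Some c \<longleftrightarrow> v = EBool c"
  by (cases v; auto simp: as_int_def as_str_def as_bool_def)+

lemma op_eval_iff:
  "bin_eval ConcatOp u v = Some w \<longleftrightarrow> (\<exists>s t. u = EStr s \<and> v = EStr t \<and> w = EStr (s @ t))" (is ?c)
  "bin_eval PlusOp u v = Some w \<longleftrightarrow> (\<exists>s t. u = EInt s \<and> v = EInt t \<and> w = EInt (s + t))" (is ?p)
  "bin_eval MinusOp u v = Some w \<longleftrightarrow> (\<exists>s t. u = EInt s \<and> v = EInt t \<and> w = EInt (s - t))" (is ?m)
  "bin_eval MultOp u v = Some w \<longleftrightarrow> (\<exists>s t. u = EInt s \<and> v = EInt t \<and> w = EInt (s * t))" (is ?t)
  "bin_eval LtOp u v = Some w \<longleftrightarrow> (\<exists>s t. u = EInt s \<and> v = EInt t \<and> w = EBool (s < t))" (is ?l)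
  "bin_eval LeOp u v = Some w \<longleftrightarrow> (\<exists>s t. u = EInt s \<and> v = EInt t \<and> w = EBool (s \<le> t))" (is ?e)
  "bin_eval EqOp u v = Some w \<longleftrightarrow> (\<exists>c. lit_eq u v = Some c \<and> w = EBool c)"
  "un_eval NotOp u = Some w \<longleftrightarrow> (\<exists>c. u = EBool c \<and> w = EBool (\<not> c))"
  "un_eval IntToStrOp u = Some w \<longleftrightarrow> (\<exists>n. u = EInt n \<and> w = EStr (int_to_str n))"
  "un_eval StrLenOp u = Some w \<longleftrightarrow> (\<exists>s. u = EStr s \<and> w = EInt (int (length s)))"
  "un_eval StrToIntOp u = Some w \<longleftrightarrow>
     (\<exists>s. u = EStr s \<and> w = (case str_to_int s of None \<Rightarrow> ENone | Some n \<Rightarrow> ESome (EInt n)))"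
proof -
  have *: "(case x of None \<Rightarrow> None | Some a \<Rightarrow> case y of None \<Rightarrow> None | Some b \<Rightarrow> Some (f a b)) = Some w \<longleftrightarrow>
      (\<exists>a b. x = Some a \<and> y = Some b \<and> w = f a b)" for x :: "'a option" and y :: "'b option" and f and w :: expr
    by (cases x; cases y) auto
  show ?c ?p ?m ?t ?l ?e by (simp_all add: bin_eval_def * as_iff)
qed (auto simp: bin_eval_def un_eval_def as_iff ENone_def ESome_def split: option.splits)

lemma ev_App_Lam:
  "ev hf (EApp (Lam x b) a) \<sigma> w \<sigma>' \<longleftrightarrow>
     (\<exists>v \<sigma>1. ev hf a \<sigma> v \<sigma>1 \<and> ev hf (subst '''' (Lam x b) (subst x v b)) \<sigma>1 w \<sigma>')"
  by (simp add: ev_App ev_simps Lam_def)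

lemma ev_App_ERec:
  "ev hf (EApp (ERec f x b) a) \<sigma> w \<sigma>' \<longleftrightarrow>
     (\<exists>v \<sigma>1. ev hf a \<sigma> v \<sigma>1 \<and> ev hf (subst f (ERec f x b) (subst x v b)) \<sigma>1 w \<sigma>')"
  by (simp add: ev_App ev_simps)

text \<open>The side condition prevents looping: the head is replaced by its value once, after which
  the rule no longer applies. Together with \<open>ev_App_arg\<close> this enforces the order
  function, argument, body.\<close>

lemma ev_App_fun:
  "\<not> is_val f \<Longrightarrow> ev hf (EApp f a) \<sigma> w \<sigma>' \<longleftrightarrow> (\<exists>g \<sigma>1. ev hf f \<sigma> g \<sigma>1 \<and> ev hf (EApp g a) \<sigma>1 w \<sigma>')"
proof
  assume "\<exists>g \<sigma>1. ev hf f \<sigma> g \<sigma>1 \<and> ev hf (EApp g a) \<sigma>1 w \<sigma>'"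
  then obtain g \<sigma>1 where g: "ev hf f \<sigma> g \<sigma>1" and "ev hf (EApp g a) \<sigma>1 w \<sigma>'" by blast
  then show "ev hf (EApp f a) \<sigma> w \<sigma>'"
    unfolding ev_App ev_val[OF ev_is_val[OF g]] by blast
next
  assume "ev hf (EApp f a) \<sigma> w \<sigma>'"
  then obtain g x b v \<sigma>1 \<sigma>2 where f: "ev hf f \<sigma> (ERec g x b) \<sigma>1" and "ev hf a \<sigma>1 v \<sigma>2"
    and "ev hf (subst g (ERec g x b) (subst x v b)) \<sigma>2 w \<sigma>'"
    unfolding ev_App by blast
  then have "ev hf (EApp (ERec g x b) a) \<sigma>1 w \<sigma>'" unfolding ev_App_ERec by blast
  with f show "\<exists>g \<sigma>1. ev hf f \<sigma> g \<sigma>1 \<and> ev hf (EApp g a) \<sigma>1 w \<sigma>'" by blast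
qed

lemma ev_App_arg:
  assumes "is_val f" "\<not> is_val a"
  shows "ev hf (EApp f a) \<sigma> w \<sigma>' \<longleftrightarrow> (\<exists>v \<sigma>1. ev hf a \<sigma> v \<sigma>1 \<and> ev hf (EApp f v) \<sigma>1 w \<sigma>')"
proof
  assume "\<exists>v \<sigma>1. ev hf a \<sigma> v \<sigma>1 \<and> ev hf (EApp f v) \<sigma>1 w \<sigma>'"
  then obtain v \<sigma>1 where v: "ev hf a \<sigma> v \<sigma>1" and "ev hf (EApp f v) \<sigma>1 w \<sigma>'" by blast
  then show "ev hf (EApp f a) \<sigma> w \<sigma>'"
    unfolding ev_App ev_val[OF assms(1)] ev_val[OF ev_is_val[OF v]] by blast
next
  assume "ev hf (EApp f a) \<sigma> w \<sigma>'"
  then obtain g x b v \<sigma>2 where f: "f = ERec g x b" and v: "ev hf a \<sigma> v \<sigma>2"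
    and w: "ev hf (subst g (ERec g x b) (subst x v b)) \<sigma>2 w \<sigma>'"
    unfolding ev_App ev_val[OF assms(1)] by blast
  from w have "ev hf (EApp f v) \<sigma>2 w \<sigma>'"
    unfolding f ev_App_ERec ev_val[OF ev_is_val[OF v]] by blast
  with v show "\<exists>v \<sigma>1. ev hf a \<sigma> v \<sigma>1 \<and> ev hf (EApp f v) \<sigma>1 w \<sigma>'" by blast
qed

lemma ev_code:
  "ev hf (Lam x e) \<sigma> w \<sigma>' \<longleftrightarrow> w = Lam x e \<and> \<sigma>' = \<sigma>"
  "ev hf ENone \<sigma> w \<sigma>' \<longleftrightarrow> w = ENone \<and> \<sigma>' = \<sigma>"
  "ev hf nilE \<sigma> w \<sigma>' \<longleftrightarrow> w = nilE \<and> \<sigma>' = \<sigma>"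
  "ev hf (ESome a) \<sigma> w \<sigma>' \<longleftrightarrow> (\<exists>v. ev hf a \<sigma> v \<sigma>' \<and> w = ESome v)"
  "ev hf (consE a b) \<sigma> w \<sigma>' \<longleftrightarrow> (\<exists>v1 v2 \<sigma>1. ev hf a \<sigma> v1 \<sigma>1 \<and> ev hf b \<sigma>1 v2 \<sigma>' \<and> w = consE v1 v2)"
  "ev hf (ELet x a b) \<sigma> w \<sigma>' \<longleftrightarrow> ev hf (EApp (Lam x b) a) \<sigma> w \<sigma>'"
  "ev hf (EApp2 f a b) \<sigma> w \<sigma>' \<longleftrightarrow> ev hf (EApp (EApp f a) b) \<sigma> w \<sigma>'"
  "ev hf (EMatch a b x c) \<sigma> w \<sigma>' \<longleftrightarrow> ev hf (ECase a ''_none'' b x c) \<sigma> w \<sigma>'"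
  "ev hf (ECat a b) \<sigma> w \<sigma>' \<longleftrightarrow>
     (\<exists>s t \<sigma>1. ev hf a \<sigma> (EStr s) \<sigma>1 \<and> ev hf b \<sigma>1 (EStr t) \<sigma>' \<and> w = EStr (s @ t))"
  "ev hf (EAdd a b) \<sigma> w \<sigma>' \<longleftrightarrow>
     (\<exists>s t \<sigma>1. ev hf a \<sigma> (EInt s) \<sigma>1 \<and> ev hf b \<sigma>1 (EInt t) \<sigma>' \<and> w = EInt (s + t))"
  "ev hf (ESub a b) \<sigma> w \<sigma>' \<longleftrightarrow>
     (\<exists>s t \<sigma>1. ev hf a \<sigma> (EInt s) \<sigma>1 \<and> ev hf b \<sigma>1 (EInt t) \<sigma>' \<and> w = EInt (s - t))"
  "ev hf (ELt a b) \<sigma> w \<sigma>' \<longleftrightarrow>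
     (\<exists>s t \<sigma>1. ev hf a \<sigma> (EInt s) \<sigma>1 \<and> ev hf b \<sigma>1 (EInt t) \<sigma>' \<and> w = EBool (s < t))"
  "ev hf (EEq a b) \<sigma> w \<sigma>' \<longleftrightarrow>
     (\<exists>s t c \<sigma>1. ev hf a \<sigma> s \<sigma>1 \<and> ev hf b \<sigma>1 t \<sigma>' \<and> lit_eq s t = Some c \<and> w = EBool c)"
  "ev hf (EUn IntToStrOp a) \<sigma> w \<sigma>' \<longleftrightarrow> (\<exists>n. ev hf a \<sigma> (EInt n) \<sigma>' \<and> w = EStr (int_to_str n))"
  "ev hf (EUn StrLenOp a) \<sigma> w \<sigma>' \<longleftrightarrow> (\<exists>s. ev hf a \<sigma> (EStr s) \<sigma>' \<and> w = EInt (int (length s)))"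
  "ev hf (EUn StrToIntOp a) \<sigma> w \<sigma>' \<longleftrightarrow> (\<exists>s. ev hf a \<sigma> (EStr s) \<sigma>' \<and>
     w = (case str_to_int s of None \<Rightarrow> ENone | Some n \<Rightarrow> ESome (EInt n)))"
  unfolding ENone_def nilE_def ESome_def consE_def ELet_def EApp2_def EMatch_def ECat_def EAdd_def
    ESub_def ELt_def EEq_def Lam_def ev_simps ev_constr op_eval_iff
  by blast+

lemma lit_eq_simps [simp]:
  "lit_eq (EStr s) (EStr t) = Some (s = t)" "lit_eq (EInt a) (EInt b) = Some (a = b)"
  "lit_eq (EBool c) (EBool d) = Some (c = d)" "lit_eq EUnit EUnit = Some True"
  by (auto simp: lit_eq_def as_int_def as_str_def as_bool_def)

lemma inj_code [simp]:
  "ESome a = EInjR b \<longleftrightarrow> a = b" "EInjR b = ESome a \<longleftrightarrow> b = a" "ESome a = ESome b \<longleftrightarrow> a = b"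
  "ESome a \<noteq> EInjL b" "EInjL b \<noteq> ESome a" "ENone \<noteq> EInjR b" "EInjR b \<noteq> ENone"
  "ENone = EInjL b \<longleftrightarrow> b = EUnit" "EInjL b = ENone \<longleftrightarrow> b = EUnit"
  "ENone \<noteq> ESome a" "ESome a \<noteq> ENone"
  by (auto simp: ESome_def ENone_def)

text \<open>The symbolic evaluator. Allocation, load and store are left out since library code never
  touches the heap.\<close>

lemmas sx = ev_simps(1-18,22) ev_constr ev_code op_eval_iff ev_App_Lam ev_App_fun ev_App_arg

subsection \<open>Evidence and serialization\<close>

text \<open>Closedness is expressed as invariance under substitution, the only consequence of having
  no free variables that the proof uses.\<close>

definition cl :: "expr \<Rightarrow> bool" where
  "cl e \<longleftrightarrow> (\<forall>y v. subst y v e = e)"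

lemma cl_subst [simp]: "cl e \<Longrightarrow> subst y v e = e"
  by (simp add: cl_def)

lemma cl_simps [simp]:
  "cl EUnit" "cl (EStr s)" "cl (EInt n)" "cl (EBool c)" "cl (ELoc l)"
  "cl (EPair a b) \<longleftrightarrow> cl a \<and> cl b" "cl (EInjL a) \<longleftrightarrow> cl a" "cl (EInjR a) \<longleftrightarrow> cl a"
  "cl (EFold a) \<longleftrightarrow> cl a" "cl (EPack a) \<longleftrightarrow> cl a"
  by (auto simp: cl_def)

text \<open>All evidence a client can obtain is built by the library's combinators, so a finite tree
  of combinators encodes it for all implementations at once. The tree is finer than the verifier's
  closure: \<open>DAuth\<close> and \<open>DStr\<close> have the same image under
  \<open>eviV\<close> but different prover serializers.\<close>

datatype evd = DAuth | DStr | DInt | DPair evd evd | DSum evd evd | DMu evd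

primrec eviP :: "evd \<Rightarrow> expr" where
  "eviP DAuth = Lam ''x'' (EApp serStrE (ESnd (V ''x'')))"
| "eviP DStr = serStrE"
| "eviP DInt = serIntE"
| "eviP (DPair a b) = Lam ''x''
     (ECat (ECat (EStr ''p'') (EApp (eviP a) (EFst (V ''x'')))) (EApp (eviP b) (ESnd (V ''x''))))"
| "eviP (DSum a b) = Lam ''x''
     (ECase (V ''x'') ''y'' (ECat (EStr ''l'') (EApp (eviP a) (V ''y'')))
                      ''y'' (ECat (EStr ''r'') (EApp (eviP b) (V ''y''))))"
| "eviP (DMu a) = Lam ''x'' (ECat (EStr ''f'') (EApp (eviP a) (EUnfold (V ''x''))))"

primrec eviV :: "evd \<Rightarrow> expr" where
  "eviV DAuth = eviStrV"
| "eviV DStr = eviStrV"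
| "eviV DInt = eviIntV"
| "eviV (DPair a b) = EPair
     (Lam ''x'' (ECat (ECat (EStr ''p'') (EApp (EFst (eviV a)) (EFst (V ''x''))))
                      (EApp (EFst (eviV b)) (ESnd (V ''x'')))))
     (deserPairE (ESnd (eviV a)) (ESnd (eviV b)))"
| "eviV (DSum a b) = EPair
     (Lam ''x'' (ECase (V ''x'') ''y'' (ECat (EStr ''l'') (EApp (EFst (eviV a)) (V ''y'')))
                                 ''y'' (ECat (EStr ''r'') (EApp (EFst (eviV b)) (V ''y'')))))
     (deserSumE (ESnd (eviV a)) (ESnd (eviV b)))"
| "eviV (DMu a) = EPair
     (Lam ''x'' (ECat (EStr ''f'') (EApp (EFst (eviV a)) (EUnfold (V ''x'')))))
     (deserMuE (ESnd (eviV a)))"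

definition "serV d = (case eviV d of EPair a b \<Rightarrow> a)"
definition "deserV d = (case eviV d of EPair a b \<Rightarrow> b)"

lemma eviV_eq: "eviV d = EPair (serV d) (deserV d)"
  by (cases d) (auto simp: serV_def deserV_def eviStrV_def eviIntV_def)

lemma subst_lib [simp]:
  "subst y v serStrE = serStrE" "subst y v serIntE = serIntE"
  "subst y v deserStrE = deserStrE" "subst y v deserIntE = deserIntE" "subst y v findColonE = findColonE"
  "subst y v appendE = appendE" "subst y v deserializeE = deserializeE"
  by (auto simp: serStrE_def serIntE_def deserStrE_def deserIntE_def findColonE_def appendE_def deserializeE_def)

lemma is_val_lib [simp]:
  "is_val serStrE" "is_val serIntE" "is_val deserStrE" "is_val deserIntE" "is_val findColonE" "is_val appendE"
  "is_val (deserPairE a b)" "is_val (deserSumE a b)" "is_val (deserMuE a)" "is_val deserializeE"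
  by (auto simp: serStrE_def serIntE_def deserStrE_def deserIntE_def findColonE_def appendE_def
      deserPairE_def deserSumE_def deserMuE_def deserializeE_def)

lemma subst_evi [simp]: "subst y v (eviP d) = eviP d" "subst y v (eviV d) = eviV d"
  by (induction d) (auto simp: eviStrV_def eviIntV_def deserPairE_def deserSumE_def deserMuE_def)

lemma is_val_evi [simp]: "is_val (eviP d)" "is_val (eviV d)"
  by (cases d; simp add: eviStrV_def eviIntV_def)+

lemma subst_serV [simp]: "subst y v (serV d) = serV d" "subst y v (deserV d) = deserV d"
  using subst_evi(2)[of y v d] by (simp_all add: eviV_eq)

lemma is_val_serV [simp]: "is_val (serV d)" "is_val (deserV d)"
  using is_val_evi(2)[of d] by (simp_all add: eviV_eq)

lemma eviV_iff [simp]: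
  "EPair a b = eviV d \<longleftrightarrow> a = serV d \<and> b = deserV d" "eviV d = EPair a b \<longleftrightarrow> a = serV d \<and> b = deserV d"
  by (auto simp: eviV_eq)

lemma serV_simps:
  "serV DAuth = serStrE" "serV DStr = serStrE" "serV DInt = serIntE"
  "serV (DPair a b) = Lam ''x'' (ECat (ECat (EStr ''p'') (EApp (EFst (eviV a)) (EFst (V ''x''))))
                      (EApp (EFst (eviV b)) (ESnd (V ''x''))))"
  "serV (DSum a b) =
     Lam ''x'' (ECase (V ''x'') ''y'' (ECat (EStr ''l'') (EApp (EFst (eviV a)) (V ''y'')))
                                 ''y'' (ECat (EStr ''r'') (EApp (EFst (eviV b)) (V ''y''))))"
  "serV (DMu a) = Lam ''x'' (ECat (EStr ''f'') (EApp (EFst (eviV a)) (EUnfold (V ''x''))))"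
  "deserV DAuth = deserStrE" "deserV DStr = deserStrE" "deserV DInt = deserIntE"
  "deserV (DPair a b) = deserPairE (ESnd (eviV a)) (ESnd (eviV b))"
  "deserV (DSum a b) = deserSumE (ESnd (eviV a)) (ESnd (eviV b))"
  "deserV (DMu a) = deserMuE (ESnd (eviV a))"
  by (simp_all add: serV_def deserV_def eviStrV_def eviIntV_def)

definition sstr :: "string \<Rightarrow> string" where
  "sstr s = ''s'' @ int_to_str (int (length s)) @ '':'' @ s"

text \<open>The common serialization \<open>s\<close> of a prover value and its verifier counterpart
  under given evidence. For \<open>DAuth\<close> the payload \<open>a\<close> may be any closed
  value, because only its hash is serialized; here the verifier holds strictly less than the
  prover.\<close>

inductive srel :: "evd \<Rightarrow> expr \<Rightarrow> expr \<Rightarrow> string \<Rightarrow> bool" where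
  "is_val a \<Longrightarrow> cl a \<Longrightarrow> srel DAuth (EPair a (EStr h)) (EStr h) (sstr h)"
| "srel DStr (EStr s) (EStr s) (sstr s)"
| "srel DInt (EInt n) (EInt n) (''i'' @ int_to_str n @ '':'')"
| "srel d1 a a' s \<Longrightarrow> srel d2 b b' t \<Longrightarrow> srel (DPair d1 d2) (EPair a b) (EPair a' b') (''p'' @ s @ t)"
| "srel d1 a a' s \<Longrightarrow> srel (DSum d1 d2) (EInjL a) (EInjL a') (''l'' @ s)"
| "srel d2 a a' s \<Longrightarrow> srel (DSum d1 d2) (EInjR a) (EInjR a') (''r'' @ s)"
| "srel d a a' s \<Longrightarrow> srel (DMu d) (EFold a) (EFold a') (''f'' @ s)"

lemma srel_val: "srel d a a' s \<Longrightarrow> is_val a \<and> is_val a' \<and> cl a \<and> cl a'"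
  by (induction rule: srel.induct) auto

lemma not_val_code [simp]: "\<not> is_val (EAdd a b)" "\<not> is_val (ESub a b)" "\<not> is_val (EEq a b)"
  by (simp_all add: EAdd_def ESub_def EEq_def)

lemma ev_serStrE: "ev hf (EApp serStrE (EStr s)) \<sigma> w \<sigma>' \<longleftrightarrow> w = EStr (sstr s) \<and> \<sigma>' = \<sigma>"
  unfolding serStrE_def by (simp add: sx sstr_def; rule conj_commute)

lemma ev_serIntE: "ev hf (EApp serIntE (EInt n)) \<sigma> w \<sigma>' \<longleftrightarrow> w = EStr (''i'' @ int_to_str n @ '':'') \<and> \<sigma>' = \<sigma>"
  unfolding serIntE_def by (simp add: sx; rule conj_commute)

text \<open>The equivalence also records determinism and that serialization leaves the state
  alone.\<close>

lemma ev_serP: "srel d a a' s \<Longrightarrow> ev hf (EApp (eviP d) a) \<sigma> w \<sigma>' \<longleftrightarrow> w = EStr s \<and> \<sigma>' = \<sigma>"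
  by (induction arbitrary: \<sigma> w \<sigma>' rule: srel.induct;
      simp add: sx ev_serStrE ev_serIntE srel_val ev_val; rule conj_commute)

lemma ev_serV: "srel d a a' s \<Longrightarrow> ev hf (EApp (serV d) a') \<sigma> w \<sigma>' \<longleftrightarrow> w = EStr s \<and> \<sigma>' = \<sigma>"
  by (induction arbitrary: \<sigma> w \<sigma>' rule: srel.induct;
      simp add: sx serV_simps ev_serStrE ev_serIntE srel_val ev_val; rule conj_commute)

section \<open>Parsing at a position inside a longer string\<close>

definition atI :: "string \<Rightarrow> int \<Rightarrow> string \<Rightarrow> bool" where
  "atI S' k s \<longleftrightarrow> (\<exists>pre post. S' = pre @ s @ post \<and> k = int (length pre))"

lemma atI_append: "atI S' k (s @ t) \<Longrightarrow> atI S' k s \<and> atI S' (k + int (length s)) t"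
  unfolding atI_def
  by (elim exE conjE, intro conjI, metis append.assoc)
    (metis append.assoc length_append of_nat_add)

lemma atI_Cons: "atI S' k (c # t) \<Longrightarrow> atI S' k [c] \<and> atI S' (k + 1) t"
  using atI_append[of S' k "[c]" t] by simp

lemma atI_take: "atI S' k s \<Longrightarrow> take (length s) (drop (nat k) S') = s"
  by (auto simp: atI_def)

lemma atI_head: "atI S' k (c # t) \<Longrightarrow> take (Suc 0) (drop (nat k) S') = [c]"
  using atI_take[of S' k "[c]"] atI_Cons[of S' k c t] by simp

lemma atI_length: "atI S' k s \<Longrightarrow> 0 \<le> k \<and> k + int (length s) \<le> int (length S')"
  by (auto simp: atI_def)

lemma ev_tagAt:
  "ev hf (tagAt (EStr S') (EInt k) t) \<sigma> w \<sigma>' \<longleftrightarrow> w = EBool (take (Suc 0) (drop (nat k) S') = t) \<and> \<sigma>' = \<sigma>"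
  unfolding tagAt_def by (simp add: sx; rule conj_commute)

text \<open>The closure that remains after the first of two curried arguments has been consumed.
  Naming such intermediate closures keeps symbolic evaluation from copying whole function bodies;
  \<open>deserAt\<close>, \<open>deserializeAt\<close> and \<open>appendAt\<close> follow the same
  pattern.\<close>

definition findColonAt :: "string \<Rightarrow> expr" where
  "findColonAt t = Lam ''j''
     (EIf (ELt (V ''j'') (EUn StrLenOp (EStr t)))
        (EIf (tagAt (EStr t) (V ''j'') '':'') (ESome (V ''j''))
             (EApp2 findColonE (EStr t) (EAdd (V ''j'') (EInt 1))))
        ENone)"

lemma findColonAt_simps [simp]: "is_val (findColonAt t)" "subst y v (findColonAt t) = findColonAt t"
  by (simp_all add: findColonAt_def)

lemma ev_findColonE: "ev hf (EApp findColonE (EStr t)) \<sigma> w \<sigma>' \<longleftrightarrow> w = findColonAt t \<and> \<sigma>' = \<sigma>"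
  by (subst findColonE_def, simp add: ev_App_ERec ev_simps ev_code findColonAt_def)
    (simp add: findColonE_def)

text \<open>Since \<open>ds\<close> contains no colon the scan stops exactly at the delimiter,
  whatever colons occur in the payload behind it.\<close>

lemma ev_findColonAt:
  assumes "atI S' k (ds @ CHR '':'' # t)" "CHR '':'' \<notin> set ds"
  shows "ev hf (EApp (findColonAt S') (EInt k)) \<sigma> w \<sigma>' \<longleftrightarrow> w = ESome (EInt (k + int (length ds))) \<and> \<sigma>' = \<sigma>"
  using assms
proof (induction ds arbitrary: k)
  case Nil
  have "k < int (length S')" using atI_length[OF Nil(1)] by simp
  with atI_head[of S' k "CHR '':''" t] Nil show ?case
    by (subst findColonAt_def) (simp add: sx ev_tagAt; rule conj_commute)
next
  case (Cons c ds)
  have "k < int (length S')" using atI_length[OF Cons.prems(1)] by simp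
  moreover have "atI S' (k + 1) (ds @ CHR '':'' # t)" using Cons.prems(1) atI_Cons by simp
  ultimately show ?case using atI_head[of S' k c "ds @ CHR '':'' # t"] Cons.prems Cons.IH[of "k + 1"]
    by (subst findColonAt_def) (simp add: sx ev_tagAt ev_findColonE algebra_simps; blast)
qed

text \<open>Every parser is an abstraction, but which one depends on the evidence. This opens it
  uniformly and feeds it the string, so that its partial application has a name independent of the
  case.\<close>

definition bodyAt :: "expr \<Rightarrow> string \<Rightarrow> expr" where
  "bodyAt e t = (case e of ERec f x b \<Rightarrow> subst x (EStr t) b)"

lemma bodyAt_Lam [simp]: "bodyAt (Lam x b) t = subst x (EStr t) b"
  by (simp add: bodyAt_def Lam_def)

definition deserAt :: "evd \<Rightarrow> string \<Rightarrow> expr" where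
  "deserAt d t = bodyAt (deserV d) t"

lemma deserAt_simps:
  "deserAt DAuth t = bodyAt deserStrE t" "deserAt DStr t = bodyAt deserStrE t"
  "deserAt DInt t = bodyAt deserIntE t"
  "deserAt (DPair a b) t = bodyAt (deserPairE (ESnd (eviV a)) (ESnd (eviV b))) t"
  "deserAt (DSum a b) t = bodyAt (deserSumE (ESnd (eviV a)) (ESnd (eviV b))) t"
  "deserAt (DMu a) t = bodyAt (deserMuE (ESnd (eviV a))) t"
  by (simp_all add: deserAt_def serV_simps)

lemmas deser_defs = deserStrE_def deserIntE_def deserPairE_def deserSumE_def deserMuE_def

lemma is_val_deserAt [simp]: "is_val (deserAt d t)"
  by (cases d) (simp_all add: deserAt_simps deser_defs)

lemma ev_deserV: "ev hf (EApp (deserV d) (EStr t)) \<sigma> w \<sigma>' \<longleftrightarrow> w = deserAt d t \<and> \<sigma>' = \<sigma>"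
  by (cases d; simp add: deserAt_simps deser_defs serV_simps sx; rule conj_commute)

text \<open>The encoding is self-delimiting: each parser knows where its part ends without looking
  at what follows. Arbitrary surroundings are needed in the statement because the second parser of a
  pair starts where the first one stopped.\<close>

lemma ev_deserAt:
  "srel d a a' s \<Longrightarrow> atI t k s \<Longrightarrow>
   ev hf (EApp (deserAt d t) (EInt k)) \<sigma> w \<sigma>' \<longleftrightarrow> w = ESome (EPair a' (EInt (k + int (length s)))) \<and> \<sigma>' = \<sigma>"
proof (induction arbitrary: k \<sigma> w \<sigma>' rule: srel.induct)
  \<comment> \<open>Shared by authenticated values and strings, which the verifier parses with the
    same code.\<close>
  have str: "ev hf (EApp (bodyAt deserStrE t) (EInt k)) \<sigma> w \<sigma>' \<longleftrightarrow>
      w = ESome (EPair (EStr s) (EInt (k + int (length (sstr s))))) \<and> \<sigma>' = \<sigma>"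
    if "atI t k (sstr s)" for k \<sigma> w \<sigma>' s
  proof -
    let ?n = "int_to_str (int (length s))"
    from that have at: "atI t k (CHR ''s'' # ?n @ CHR '':'' # s)" by (simp add: sstr_def)
    then have 1: "atI t (k + 1) (?n @ CHR '':'' # s)" by (blast dest: atI_Cons)
    then have 2: "atI t (k + 1) ?n" "atI t (k + 1 + int (length ?n)) (CHR '':'' # s)" by (auto dest: atI_append)
    \<comment> \<open>The payload follows the tag, the digits and the colon; the two added ones
      account for tag and colon.\<close>
    then have 3: "atI t (k + 1 + int (length ?n) + 1) s" by (blast dest: atI_Cons)
    from atI_head[OF at] atI_take[OF 2(1)] atI_take[OF 3] atI_length[OF 3] show ?thesis
      by (simp add: ev_findColonAt[OF 1 int_to_str_no_colon] deserStrE_def sx ev_tagAt ev_findColonE sstr_def)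
        (auto simp: algebra_simps)
  qed
  {
    case (1 a h)
    then show ?case by (simp add: deserAt_simps str)
  next
    case (2 s)
    then show ?case by (simp add: deserAt_simps str)
  next
    case (3 n)
    let ?n = "int_to_str n"
    from 3 have at: "atI t k (CHR ''i'' # ?n @ CHR '':'' # [])" by simp
    then have 1: "atI t (k + 1) (?n @ CHR '':'' # [])" by (blast dest: atI_Cons)
    then have 2: "atI t (k + 1) ?n" by (auto dest: atI_append)
    from atI_head[OF at] atI_take[OF 2] show ?case
      by (simp add: ev_findColonAt[OF 1 int_to_str_no_colon] deserAt_simps deserIntE_def sx ev_tagAt ev_findColonE)
        (auto simp: algebra_simps)
  next
    case (4 d1 a a' s1 d2 b b' s2)
    from 4(5) have at: "atI t k (CHR ''p'' # s1 @ s2)" by simp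
    then have 1: "atI t (k + 1) (s1 @ s2)" by (blast dest: atI_Cons)
    then have 2: "atI t (k + 1) s1" "atI t (k + 1 + int (length s1)) s2" by (auto dest: atI_append)
    from 4 atI_head[OF at] 2 show ?case
      by (simp add: deserAt_simps deserPairE_def sx ev_tagAt ev_deserV srel_val ev_val algebra_simps)
        (auto simp: algebra_simps)
  next
    case (5 d1 a a' s d2)
    from 5(3) have at: "atI t k (CHR ''l'' # s)" by simp
    from 5 atI_head[OF at] atI_Cons[OF at] show ?case
      by (simp add: deserAt_simps deserSumE_def sx ev_tagAt ev_deserV srel_val ev_val)
        (auto simp: algebra_simps)
  next
    case (6 d2 a a' s d1)
    from 6(3) have at: "atI t k (CHR ''r'' # s)" by simp
    from 6 atI_head[OF at] atI_Cons[OF at] show ?case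
      by (simp add: deserAt_simps deserSumE_def sx ev_tagAt ev_deserV srel_val ev_val)
        (auto simp: algebra_simps)
  next
    case (7 d a a' s)
    from 7(3) have at: "atI t k (CHR ''f'' # s)" by simp
    from 7 atI_head[OF at] atI_Cons[OF at] show ?case
      by (simp add: deserAt_simps deserMuE_def sx ev_tagAt ev_deserV srel_val ev_val)
        (auto simp: algebra_simps)
  }
qed

definition deserializeAt :: "evd \<Rightarrow> expr" where
  "deserializeAt d = Lam ''s''
     (EMatch (EApp2 (deserV d) (V ''s'') (EInt 0)) ENone ''r''
        (EIf (EEq (ESnd (V ''r'')) (EUn StrLenOp (V ''s''))) (ESome (EFst (V ''r''))) ENone))"

lemma is_val_deserializeAt [simp]: "is_val (deserializeAt d)"
  by (simp add: deserializeAt_def)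

lemma ev_deserializeE: "ev hf (EApp deserializeE (deserV d)) \<sigma> w \<sigma>' \<longleftrightarrow> w = deserializeAt d \<and> \<sigma>' = \<sigma>"
  by (simp add: deserializeE_def deserializeAt_def sx ev_val; rule conj_commute)

lemma ex_bool [simp]: "\<exists>c. c" "\<exists>c. \<not> c"
  by blast+

lemma ev_deserializeAt:
  assumes "srel d a a' s"
  shows "ev hf (EApp (deserializeAt d) (EStr s)) \<sigma> w \<sigma>' \<longleftrightarrow> w = ESome a' \<and> \<sigma>' = \<sigma>"
proof -
  have "atI s 0 s" unfolding atI_def by (rule exI[of _ "[]"]) auto
  with srel_val[OF assms] show ?thesis
    by (simp add: ev_deserAt[OF assms] deserializeAt_def sx ev_deserV ev_val; blast)
qed

subsection \<open>The operations of the three implementations\<close>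

text \<open>The client can only obtain computations through return, bind and unauth, so a value of
  type \<open>m\<close> has one of three shapes: the closure left by such an operation once its
  arguments are supplied. The ideal unauth behaves like return, hence no separate ideal shape for
  it.\<close>

definition mretP :: "expr \<Rightarrow> expr" where "mretP a = Lam ''u'' (EPair nilE a)"
definition mretV :: "expr \<Rightarrow> expr" where "mretV a = Lam ''p'' (ESome (EPair (V ''p'') a))"
definition mretI :: "expr \<Rightarrow> expr" where "mretI a = Lam ''u'' a"

definition mbindP :: "expr \<Rightarrow> expr \<Rightarrow> expr" where
  "mbindP c f = Lam ''u''
     (ELet ''r1'' (EApp c EUnit)
       (ELet ''r2'' (EApp2 f (ESnd (V ''r1'')) EUnit)
          (EPair (EApp2 appendE (EFst (V ''r1'')) (EFst (V ''r2''))) (ESnd (V ''r2'')))))"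
definition mbindV :: "expr \<Rightarrow> expr \<Rightarrow> expr" where
  "mbindV c f = Lam ''p''
     (EMatch (EApp c (V ''p'')) ENone ''r'' (EApp2 f (ESnd (V ''r'')) (EFst (V ''r''))))"
definition mbindI :: "expr \<Rightarrow> expr \<Rightarrow> expr" where
  "mbindI c f = Lam ''u'' (EApp2 f (EApp c EUnit) EUnit)"

definition munauthP :: "expr \<Rightarrow> expr \<Rightarrow> expr" where
  "munauthP e x = Lam ''u'' (EPair (consE (EApp e (EFst x)) nilE) (EFst x))"
definition munauthV :: "expr \<Rightarrow> expr \<Rightarrow> expr" where
  "munauthV e h = Lam ''p''
     (ECase (EUnfold (V ''p'')) ''_e'' ENone ''c''
        (EIf (EEq (EHash (EFst (V ''c''))) h)
           (EMatch (EApp2 deserializeE (ESnd e) (EFst (V ''c''))) ENone ''a''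
              (ESome (EPair (ESnd (V ''c'')) (V ''a''))))
           ENone))"

definition authFP :: "expr \<Rightarrow> expr" where
  "authFP e = Lam ''a'' (EPair (V ''a'') (EHash (EApp e (V ''a''))))"
definition authFV :: "expr \<Rightarrow> expr" where
  "authFV e = Lam ''a'' (EHash (EApp (EFst e) (V ''a'')))"

definition pairP :: "expr \<Rightarrow> expr \<Rightarrow> expr" where
  "pairP a b = Lam ''x''
     (ECat (ECat (EStr ''p'') (EApp a (EFst (V ''x'')))) (EApp b (ESnd (V ''x''))))"
definition pairV :: "expr \<Rightarrow> expr \<Rightarrow> expr" where
  "pairV a b = EPair
     (Lam ''x'' (ECat (ECat (EStr ''p'') (EApp (EFst a) (EFst (V ''x''))))
                      (EApp (EFst b) (ESnd (V ''x'')))))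
     (deserPairE (ESnd a) (ESnd b))"
definition sumP :: "expr \<Rightarrow> expr \<Rightarrow> expr" where
  "sumP a b = Lam ''x''
     (ECase (V ''x'') ''y'' (ECat (EStr ''l'') (EApp a (V ''y'')))
                      ''y'' (ECat (EStr ''r'') (EApp b (V ''y''))))"
definition sumV :: "expr \<Rightarrow> expr \<Rightarrow> expr" where
  "sumV a b = EPair
     (Lam ''x'' (ECase (V ''x'') ''y'' (ECat (EStr ''l'') (EApp (EFst a) (V ''y'')))
                                 ''y'' (ECat (EStr ''r'') (EApp (EFst b) (V ''y'')))))
     (deserSumE (ESnd a) (ESnd b))"
definition muP :: "expr \<Rightarrow> expr" where
  "muP a = Lam ''x'' (ECat (EStr ''f'') (EApp a (EUnfold (V ''x''))))"
definition muV :: "expr \<Rightarrow> expr" where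
  "muV a = EPair
     (Lam ''x'' (ECat (EStr ''f'') (EApp (EFst a) (EUnfold (V ''x'')))))
     (deserMuE (ESnd a))"

lemmas opcode_defs = mretP_def mretV_def mretI_def mbindP_def mbindV_def mbindI_def munauthP_def munauthV_def
  authFP_def authFV_def pairP_def pairV_def sumP_def sumV_def muP_def muV_def

text \<open>The abstract constructors auth, m and evi of the client are interpreted by ill-kinded
  applications of base types. The relation below ignores kinds, so these are rigid types that are
  convertible to no type of the language.\<close>

definition tauth :: "ty \<Rightarrow> ty" where "tauth a = TAp tunit a"
definition tm :: "ty \<Rightarrow> ty" where "tm a = TAp tbool a"
definition tevi :: "ty \<Rightarrow> ty" where "tevi a = TAp tint a"

text \<open>Conversion is built in so that rules stated with \<open>rig\<close> hold for every type
  convertible to the displayed one, and no separate conversion rule obstructs case analysis.\<close>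

definition rig :: "tcon \<Rightarrow> ty list \<Rightarrow> ty \<Rightarrow> bool" where
  "rig c as t \<longleftrightarrow> tequiv (tapps (TC c) as) t"

lemma tequiv_tapps:
  assumes "tequiv t u" "list_all2 tequiv as bs"
  shows "tequiv (tapps t as) (tapps u bs)"
  using assms(2,1) by (induction arbitrary: t u) (auto intro: TE_app)

lemma rig_tapps: "rig c as (tapps (TC d) bs) \<longleftrightarrow> c = d \<and> list_all2 tequiv as bs"
  unfolding rig_def using tequiv_rigid[of c as "tapps (TC d) bs" d bs] tequiv_tapps[OF TE_refl[of "TC c"]]
  by (blast intro: TE_refl)

text \<open>\<open>tauth\<close>, \<open>tm\<close> and \<open>tevi\<close> share their heads with
  \<open>tunit\<close>, \<open>tbool\<close> and \<open>tint\<close> and are told apart from them by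
  the number of arguments alone.\<close>

lemma rig_simps [simp]:
  "rig c as tunit \<longleftrightarrow> c = TUnitC \<and> as = []"
  "rig c as tbool \<longleftrightarrow> c = TBoolC \<and> as = []"
  "rig c as tint \<longleftrightarrow> c = TIntC \<and> as = []"
  "rig c as tstring \<longleftrightarrow> c = TStringC \<and> as = []"
  "rig c as (tprod a b) \<longleftrightarrow> c = TProdC \<and> list_all2 tequiv as [a, b]"
  "rig c as (tsum a b) \<longleftrightarrow> c = TSumC \<and> list_all2 tequiv as [a, b]"
  "rig c as (tarr a b) \<longleftrightarrow> c = TArrC \<and> list_all2 tequiv as [a, b]"
  "rig c as (tref a) \<longleftrightarrow> c = TRefC \<and> list_all2 tequiv as [a]"
  "rig c as (TAp (TC (TForallC \<kappa>)) F) \<longleftrightarrow> c = TForallC \<kappa> \<and> list_all2 tequiv as [F]"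
  "rig c as (TAp (TC (TExistsC \<kappa>)) F) \<longleftrightarrow> c = TExistsC \<kappa> \<and> list_all2 tequiv as [F]"
  "rig c as (tapps (tmu \<kappa> F) args) \<longleftrightarrow> c = TMuC \<kappa> \<and> list_all2 tequiv as (F # args)"
  "rig c as (tmu \<kappa> F) \<longleftrightarrow> c = TMuC \<kappa> \<and> list_all2 tequiv as [F]"
  "rig c as (tauth a) \<longleftrightarrow> c = TUnitC \<and> list_all2 tequiv as [a]"
  "rig c as (tm a) \<longleftrightarrow> c = TBoolC \<and> list_all2 tequiv as [a]"
  "rig c as (tevi a) \<longleftrightarrow> c = TIntC \<and> list_all2 tequiv as [a]"
  using rig_tapps[of c as _ "[]"] rig_tapps[of c as _ "[_]"] rig_tapps[of c as _ "[_, _]"]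
    rig_tapps[of c as _ "_ # args"]
  by (simp_all add: tunit_def tbool_def tint_def tstring_def tprod_def tsum_def tarr_def tref_def tmu_def
      tauth_def tm_def tevi_def)

lemma rig_conv: "rig c as t \<Longrightarrow> tequiv t u \<Longrightarrow> rig c as u"
  unfolding rig_def by (rule TE_trans)

lemma rig_unique: "rig c as t \<Longrightarrow> rig d bs t \<Longrightarrow> c = d \<and> list_all2 tequiv as bs"
  unfolding rig_def by (rule tequiv_rigid)

text \<open>The recursion follows the evidence and not the type: in \<open>HE_Mu\<close> the
  evidence shrinks while the type is unrolled and may grow.\<close>

inductive hasevi :: "evd \<Rightarrow> ty \<Rightarrow> bool" where
  HE_Auth: "rig TUnitC [a] t \<Longrightarrow> hasevi DAuth t"
| HE_Str: "rig TStringC [] t \<Longrightarrow> hasevi DStr t"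
| HE_Int: "rig TIntC [] t \<Longrightarrow> hasevi DInt t"
| HE_Pair: "hasevi d1 a \<Longrightarrow> hasevi d2 b \<Longrightarrow> rig TProdC [a, b] t \<Longrightarrow> hasevi (DPair d1 d2) t"
| HE_Sum: "hasevi d1 a \<Longrightarrow> hasevi d2 b \<Longrightarrow> rig TSumC [a, b] t \<Longrightarrow> hasevi (DSum d1 d2) t"
| HE_Mu: "hasevi d (TAp F (tmu Star F)) \<Longrightarrow> rig (TMuC Star) [F] t \<Longrightarrow> hasevi (DMu d) t"

lemma hasevi_conv: "hasevi d t \<Longrightarrow> tequiv t u \<Longrightarrow> hasevi d u"
  by (cases rule: hasevi.cases) (auto intro: hasevi.intros rig_conv)

lemma tequiv_unroll: "tequiv F G \<Longrightarrow> tequiv (TAp F (tmu \<kappa> F)) (TAp G (tmu \<kappa> G))"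
  unfolding tmu_def by (intro TE_app TE_refl)

text \<open>Distinct rules require distinct rigid heads, so both derivations end in the same rule;
  injectivity makes the component types convertible, and \<open>hasevi_conv\<close> carries the
  second derivation over to the types of the first.\<close>

lemma hasevi_unique: "hasevi d t \<Longrightarrow> hasevi d' t \<Longrightarrow> d' = d"
proof (induction arbitrary: d' rule: hasevi.induct)
  case (HE_Auth a t)
  from HE_Auth(2,1) show ?case by cases (drule (1) rig_unique; simp)+
next
  case (HE_Str t)
  from HE_Str(2,1) show ?case by cases (drule (1) rig_unique; simp)+
next
  case (HE_Int t)
  from HE_Int(2,1) show ?case by cases (drule (1) rig_unique; simp)+
next
  case (HE_Pair d1 a d2 b t)
  from HE_Pair.prems HE_Pair.hyps(3) show ?case
    by cases (drule (1) rig_unique; auto intro!: HE_Pair.IH intro: hasevi_conv TE_sym)+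
next
  case (HE_Sum d1 a d2 b t)
  from HE_Sum.prems HE_Sum.hyps(3) show ?case
    by cases (drule (1) rig_unique; auto intro!: HE_Sum.IH intro: hasevi_conv TE_sym)+
next
  case (HE_Mu d F t)
  from HE_Mu.prems HE_Mu.hyps(2) show ?case
    by cases (drule (1) rig_unique; auto intro!: HE_Mu.IH intro: hasevi_conv tequiv_unroll TE_sym)+
qed

text \<open>Return and the evidence for recursive types are the operations that finish after one
  argument. Those with two are listed separately because their partial applications are values that
  the client can store and pass around.\<close>

inductive op1 :: "expr \<Rightarrow> expr \<Rightarrow> expr \<Rightarrow> ty \<Rightarrow> ty \<Rightarrow> bool" where
  "op1 (Lam ''a'' (mretP (V ''a''))) (Lam ''a'' (mretV (V ''a''))) (Lam ''a'' (mretI (V ''a''))) a (tm a)"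
| "op1 (Lam ''ef'' (muP (V ''ef''))) (Lam ''ef'' (muV (V ''ef''))) (Lam ''ef'' EUnit)
     (tevi (TAp F (tmu Star F))) (tevi (tmu Star F))"

text \<open>The arguments \<open>fP\<close>, \<open>fV\<close>, \<open>fI\<close> of \<open>op2\<close> map the first argument of the curried operation to
  the resulting closure.\<close>

inductive op2 ::
  "expr \<Rightarrow> expr \<Rightarrow> expr \<Rightarrow> (expr \<Rightarrow> expr) \<Rightarrow> (expr \<Rightarrow> expr) \<Rightarrow> (expr \<Rightarrow> expr) \<Rightarrow> ty \<Rightarrow> ty \<Rightarrow> ty \<Rightarrow> bool" where
  op2_bind: "op2 (Lam ''c'' (Lam ''f'' (mbindP (V ''c'') (V ''f''))))
       (Lam ''c'' (Lam ''f'' (mbindV (V ''c'') (V ''f''))))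
       (Lam ''c'' (Lam ''f'' (mbindI (V ''c'') (V ''f''))))
       (\<lambda>c. Lam ''f'' (mbindP c (V ''f''))) (\<lambda>c. Lam ''f'' (mbindV c (V ''f''))) (\<lambda>c. Lam ''f'' (mbindI c (V ''f'')))
       (tm a) (tarr a (tm b)) (tm b)"
| op2_pair: "op2 (Lam ''ea'' (Lam ''eb'' (pairP (V ''ea'') (V ''eb''))))
       (Lam ''ea'' (Lam ''eb'' (pairV (V ''ea'') (V ''eb'')))) (Lam ''ea'' (Lam ''eb'' EUnit))
       (\<lambda>c. Lam ''eb'' (pairP c (V ''eb''))) (\<lambda>c. Lam ''eb'' (pairV c (V ''eb''))) (\<lambda>c. Lam ''eb'' EUnit)
       (tevi a) (tevi b) (tevi (tprod a b))"
| op2_sum: "op2 (Lam ''ea'' (Lam ''eb'' (sumP (V ''ea'') (V ''eb''))))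
       (Lam ''ea'' (Lam ''eb'' (sumV (V ''ea'') (V ''eb'')))) (Lam ''ea'' (Lam ''eb'' EUnit))
       (\<lambda>c. Lam ''eb'' (sumP c (V ''eb''))) (\<lambda>c. Lam ''eb'' (sumV c (V ''eb''))) (\<lambda>c. Lam ''eb'' EUnit)
       (tevi a) (tevi b) (tevi (tsum a b))"
| op2_auth: "op2 (Lam ''ev'' (authFP (V ''ev''))) (Lam ''ev'' (authFV (V ''ev''))) (Lam ''ev'' (Lam ''a'' (V ''a'')))
       authFP authFV (\<lambda>c. Lam ''a'' (V ''a'')) (tevi a) a (tauth a)"
| op2_unauth: "op2 (Lam ''ev'' (Lam ''x'' (munauthP (V ''ev'') (V ''x''))))
       (Lam ''ev'' (Lam ''h'' (munauthV (V ''ev'') (V ''h''))))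
       (Lam ''ev'' (Lam ''a'' (mretI (V ''a''))))
       (\<lambda>c. Lam ''x'' (munauthP c (V ''x''))) (\<lambda>c. Lam ''h'' (munauthV c (V ''h''))) (\<lambda>c. Lam ''a'' (mretI (V ''a'')))
       (tevi a) (tauth a) (tm a)"

lemma subst_deser [simp]:
  "y \<notin> {'''', ''s'', ''i'', ''r1'', ''r2''} \<Longrightarrow> subst y v (deserPairE a b) = deserPairE (subst y v a) (subst y v b)"
  "y \<notin> {'''', ''s'', ''i'', ''r1''} \<Longrightarrow> subst y v (deserSumE a b) = deserSumE (subst y v a) (subst y v b)"
  "y \<notin> {'''', ''s'', ''i'', ''r1''} \<Longrightarrow> subst y v (deserMuE a) = deserMuE (subst y v a)"
  "subst '''' v (deserPairE a b) = deserPairE a b" "subst '''' v (deserSumE a b) = deserSumE a b"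
  "subst '''' v (deserMuE a) = deserMuE a"
  by (auto simp: deserPairE_def deserSumE_def deserMuE_def)

lemma cl_opcode:
  "cl a \<Longrightarrow> cl (mretP a)" "cl a \<Longrightarrow> cl (mretV a)" "cl a \<Longrightarrow> cl (mretI a)"
  "cl a \<Longrightarrow> cl b \<Longrightarrow> cl (mbindP a b)" "cl a \<Longrightarrow> cl b \<Longrightarrow> cl (mbindV a b)" "cl a \<Longrightarrow> cl b \<Longrightarrow> cl (mbindI a b)"
  "cl a \<Longrightarrow> cl b \<Longrightarrow> cl (munauthP a b)" "cl a \<Longrightarrow> cl b \<Longrightarrow> cl (munauthV a b)"
  "cl (eviP d)" "cl (eviV d)"
  by (auto simp: cl_def opcode_defs)

lemma is_val_opcode [simp]:
  "is_val (mretP a)" "is_val (mretV a)" "is_val (mretI a)" "is_val (mbindP a b)" "is_val (mbindV a b)" "is_val (mbindI a b)"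
  "is_val (munauthP a b)" "is_val (munauthV a b)" "is_val (authFP a)" "is_val (authFV a)"
  "is_val (pairP a b)" "is_val (pairV a b)" "is_val (sumP a b)" "is_val (sumV a b)" "is_val (muP a)" "is_val (muV a)"
  by (simp_all add: opcode_defs)

lemma op1_val: "op1 cP cV cI a b \<Longrightarrow> is_val cP \<and> is_val cV \<and> is_val cI \<and> cl cP \<and> cl cV \<and> cl cI"
  by (cases rule: op1.cases) (auto simp: cl_def opcode_defs deser_defs)

lemma op2_val:
  "op2 cP cV cI fP fV fI a b c \<Longrightarrow> is_val cP \<and> is_val cV \<and> is_val cI \<and> cl cP \<and> cl cV \<and> cl cI"
  by (cases rule: op2.cases) (auto simp: cl_def opcode_defs deser_defs)

lemma op2_part_val:
  "op2 cP cV cI fP fV fI a b c \<Longrightarrow> is_val (fP x) \<and> is_val (fV x) \<and> is_val (fI x)"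
  "op2 cP cV cI fP fV fI a b c \<Longrightarrow> cl x \<Longrightarrow> cl (fP x) \<and> cl (fV x) \<and> cl (fI x)"
  by (auto elim!: op2.cases simp: cl_def opcode_defs deser_defs)

lemma op2_ev:
  assumes "op2 cP cV cI fP fV fI a b c" "is_val x" "cl x"
  shows "ev hf (EApp cP x) \<sigma> w \<sigma>' \<longleftrightarrow> w = fP x \<and> \<sigma>' = \<sigma>"
    and "ev hf (EApp cV x) \<sigma> w \<sigma>' \<longleftrightarrow> w = fV x \<and> \<sigma>' = \<sigma>"
    and "ev hf (EApp cI x) \<sigma> w \<sigma>' \<longleftrightarrow> w = fI x \<and> \<sigma>' = \<sigma>"
  using assms(1) by (cases; simp add: sx ev_val assms opcode_defs; rule conj_commute)+

subsection \<open>The ternary relation\<close>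

text \<open>Instead of extending a type context, \<open>R_TLam\<close> and \<open>R_Unpack\<close> quantify over all types, so
  no substitution lemma for types is needed. The verifier value \<open>aV\<close> behind a hash is not part of the
  related triple; it survives only in the premises of \<open>R_Auth\<close>.\<close>

inductive rel :: "(string \<Rightarrow> string) \<Rightarrow> (loc \<rightharpoonup> ty) \<Rightarrow> tenv \<Rightarrow> expr \<Rightarrow> expr \<Rightarrow> expr \<Rightarrow> ty \<Rightarrow> bool"
  for H :: "string \<Rightarrow> string" and \<Sigma> :: "loc \<rightharpoonup> ty" where
  R_Var: "\<Gamma> x = Some \<tau>0 \<Longrightarrow> tequiv \<tau>0 \<tau> \<Longrightarrow> rel H \<Sigma> \<Gamma> (EVar x) (EVar x) (EVar x) \<tau>"
| R_Unit: "rig TUnitC [] \<tau> \<Longrightarrow> rel H \<Sigma> \<Gamma> EUnit EUnit EUnit \<tau>"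
| R_Bool: "rig TBoolC [] \<tau> \<Longrightarrow> rel H \<Sigma> \<Gamma> (EBool b) (EBool b) (EBool b) \<tau>"
| R_Int: "rig TIntC [] \<tau> \<Longrightarrow> rel H \<Sigma> \<Gamma> (EInt n) (EInt n) (EInt n) \<tau>"
| R_Str: "rig TStringC [] \<tau> \<Longrightarrow> rel H \<Sigma> \<Gamma> (EStr s) (EStr s) (EStr s) \<tau>"
| R_Loc: "\<Sigma> l = Some \<tau>0 \<Longrightarrow> rig TRefC [\<tau>0] \<tau> \<Longrightarrow> rel H \<Sigma> \<Gamma> (ELoc l) (ELoc l) (ELoc l) \<tau>"
| R_Rec: "rel H \<Sigma> (\<Gamma>(f \<mapsto> tarr \<tau>1 \<tau>2, x \<mapsto> \<tau>1)) eP eV eI \<tau>2 \<Longrightarrow> rig TArrC [\<tau>1, \<tau>2] \<tau> \<Longrightarrow>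
     rel H \<Sigma> \<Gamma> (ERec f x eP) (ERec f x eV) (ERec f x eI) \<tau>"
| R_App: "rel H \<Sigma> \<Gamma> eP eV eI (tarr \<tau>1 \<tau>2) \<Longrightarrow> rel H \<Sigma> \<Gamma> aP aV aI \<tau>1 \<Longrightarrow> tequiv \<tau>2 \<tau> \<Longrightarrow>
     rel H \<Sigma> \<Gamma> (EApp eP aP) (EApp eV aV) (EApp eI aI) \<tau>"
| R_TLam: "(\<And>\<sigma>. rel H \<Sigma> \<Gamma> eP eV eI (TAp F \<sigma>)) \<Longrightarrow> rig (TForallC \<kappa>) [F] \<tau> \<Longrightarrow>
     rel H \<Sigma> \<Gamma> (ETLam eP) (ETLam eV) (ETLam eI) \<tau>"
| R_TApp: "rel H \<Sigma> \<Gamma> eP eV eI (TAp (TC (TForallC \<kappa>)) F) \<Longrightarrow> tequiv (TAp F \<sigma>) \<tau> \<Longrightarrow>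
     rel H \<Sigma> \<Gamma> (ETApp eP) (ETApp eV) (ETApp eI) \<tau>"
| R_Pack: "rel H \<Sigma> \<Gamma> eP eV eI (TAp F \<sigma>) \<Longrightarrow> rig (TExistsC \<kappa>) [F] \<tau> \<Longrightarrow>
     rel H \<Sigma> \<Gamma> (EPack eP) (EPack eV) (EPack eI) \<tau>"
| R_Unpack: "rel H \<Sigma> \<Gamma> eP eV eI (TAp (TC (TExistsC \<kappa>)) F) \<Longrightarrow>
     (\<And>\<sigma>. rel H \<Sigma> (\<Gamma>(x \<mapsto> TAp F \<sigma>)) bP bV bI \<tau>) \<Longrightarrow>
     rel H \<Sigma> \<Gamma> (EUnpack eP x bP) (EUnpack eV x bV) (EUnpack eI x bI) \<tau>"
| R_Fold: "rel H \<Sigma> \<Gamma> eP eV eI (tapps (TAp F (tmu \<kappa> F)) args) \<Longrightarrow> rig (TMuC \<kappa>) (F # args) \<tau> \<Longrightarrow>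
     rel H \<Sigma> \<Gamma> (EFold eP) (EFold eV) (EFold eI) \<tau>"
| R_Unfold: "rel H \<Sigma> \<Gamma> eP eV eI (tapps (tmu \<kappa> F) args) \<Longrightarrow> tequiv (tapps (TAp F (tmu \<kappa> F)) args) \<tau> \<Longrightarrow>
     rel H \<Sigma> \<Gamma> (EUnfold eP) (EUnfold eV) (EUnfold eI) \<tau>"
| R_Bin: "binop_ty op \<tau>1 \<tau>2 \<tau>0 \<Longrightarrow> rel H \<Sigma> \<Gamma> eP eV eI \<tau>1 \<Longrightarrow> rel H \<Sigma> \<Gamma> aP aV aI \<tau>2 \<Longrightarrow> tequiv \<tau>0 \<tau> \<Longrightarrow>
     rel H \<Sigma> \<Gamma> (EBin op eP aP) (EBin op eV aV) (EBin op eI aI) \<tau>"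
| R_Un: "unop_ty uop \<tau>1 \<tau>0 \<Longrightarrow> rel H \<Sigma> \<Gamma> eP eV eI \<tau>1 \<Longrightarrow> tequiv \<tau>0 \<tau> \<Longrightarrow>
     rel H \<Sigma> \<Gamma> (EUn uop eP) (EUn uop eV) (EUn uop eI) \<tau>"
| R_Substr: "rel H \<Sigma> \<Gamma> eP eV eI tstring \<Longrightarrow> rel H \<Sigma> \<Gamma> aP aV aI tint \<Longrightarrow> rel H \<Sigma> \<Gamma> bP bV bI tint \<Longrightarrow>
     rig TStringC [] \<tau> \<Longrightarrow> rel H \<Sigma> \<Gamma> (ESubstr eP aP bP) (ESubstr eV aV bV) (ESubstr eI aI bI) \<tau>"
| R_If: "rel H \<Sigma> \<Gamma> eP eV eI tbool \<Longrightarrow> rel H \<Sigma> \<Gamma> aP aV aI \<tau> \<Longrightarrow> rel H \<Sigma> \<Gamma> bP bV bI \<tau> \<Longrightarrow>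
     rel H \<Sigma> \<Gamma> (EIf eP aP bP) (EIf eV aV bV) (EIf eI aI bI) \<tau>"
| R_Pair: "rel H \<Sigma> \<Gamma> eP eV eI \<tau>1 \<Longrightarrow> rel H \<Sigma> \<Gamma> aP aV aI \<tau>2 \<Longrightarrow> rig TProdC [\<tau>1, \<tau>2] \<tau> \<Longrightarrow>
     rel H \<Sigma> \<Gamma> (EPair eP aP) (EPair eV aV) (EPair eI aI) \<tau>"
| R_Fst: "rel H \<Sigma> \<Gamma> eP eV eI (tprod \<tau>1 \<tau>2) \<Longrightarrow> tequiv \<tau>1 \<tau> \<Longrightarrow> rel H \<Sigma> \<Gamma> (EFst eP) (EFst eV) (EFst eI) \<tau>"
| R_Snd: "rel H \<Sigma> \<Gamma> eP eV eI (tprod \<tau>1 \<tau>2) \<Longrightarrow> tequiv \<tau>2 \<tau> \<Longrightarrow> rel H \<Sigma> \<Gamma> (ESnd eP) (ESnd eV) (ESnd eI) \<tau>"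
| R_InjL: "rel H \<Sigma> \<Gamma> eP eV eI \<tau>1 \<Longrightarrow> rig TSumC [\<tau>1, \<tau>2] \<tau> \<Longrightarrow> rel H \<Sigma> \<Gamma> (EInjL eP) (EInjL eV) (EInjL eI) \<tau>"
| R_InjR: "rel H \<Sigma> \<Gamma> eP eV eI \<tau>2 \<Longrightarrow> rig TSumC [\<tau>1, \<tau>2] \<tau> \<Longrightarrow> rel H \<Sigma> \<Gamma> (EInjR eP) (EInjR eV) (EInjR eI) \<tau>"
| R_Case: "rel H \<Sigma> \<Gamma> eP eV eI (tsum \<tau>1 \<tau>2) \<Longrightarrow> rel H \<Sigma> (\<Gamma>(x1 \<mapsto> \<tau>1)) aP aV aI \<tau> \<Longrightarrow>
     rel H \<Sigma> (\<Gamma>(x2 \<mapsto> \<tau>2)) bP bV bI \<tau> \<Longrightarrow>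
     rel H \<Sigma> \<Gamma> (ECase eP x1 aP x2 bP) (ECase eV x1 aV x2 bV) (ECase eI x1 aI x2 bI) \<tau>"
| R_Alloc: "rel H \<Sigma> \<Gamma> eP eV eI \<tau>0 \<Longrightarrow> rig TRefC [\<tau>0] \<tau> \<Longrightarrow> rel H \<Sigma> \<Gamma> (EAlloc eP) (EAlloc eV) (EAlloc eI) \<tau>"
| R_Load: "rel H \<Sigma> \<Gamma> eP eV eI (tref \<tau>0) \<Longrightarrow> tequiv \<tau>0 \<tau> \<Longrightarrow> rel H \<Sigma> \<Gamma> (ELoad eP) (ELoad eV) (ELoad eI) \<tau>"
| R_Store: "rel H \<Sigma> \<Gamma> eP eV eI (tref \<tau>0) \<Longrightarrow> rel H \<Sigma> \<Gamma> aP aV aI \<tau>0 \<Longrightarrow> rig TUnitC [] \<tau> \<Longrightarrow>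
     rel H \<Sigma> \<Gamma> (EStore eP aP) (EStore eV aV) (EStore eI aI) \<tau>"
| R_Hash: "rel H \<Sigma> \<Gamma> eP eV eI tstring \<Longrightarrow> rig TStringC [] \<tau> \<Longrightarrow> rel H \<Sigma> \<Gamma> (EHash eP) (EHash eV) (EHash eI) \<tau>"
| R_Auth: "hasevi d \<tau>0 \<Longrightarrow> rel H \<Sigma> Map.empty aP aV aI \<tau>0 \<Longrightarrow> is_val aI \<Longrightarrow> srel d aP aV s \<Longrightarrow>
     rig TUnitC [\<tau>0] \<tau> \<Longrightarrow> rel H \<Sigma> \<Gamma> (EPair aP (EStr (H s))) (EStr (H s)) aI \<tau>"
| R_Evi: "hasevi d \<tau>0 \<Longrightarrow> rig TIntC [\<tau>0] \<tau> \<Longrightarrow> rel H \<Sigma> \<Gamma> (eviP d) (eviV d) EUnit \<tau>"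
| R_MRet: "rel H \<Sigma> Map.empty aP aV aI \<tau>0 \<Longrightarrow> is_val aP \<Longrightarrow> rig TBoolC [\<tau>0] \<tau> \<Longrightarrow>
     rel H \<Sigma> \<Gamma> (mretP aP) (mretV aV) (mretI aI) \<tau>"
| R_MBind: "rel H \<Sigma> Map.empty cP cV cI (tm \<tau>1) \<Longrightarrow> is_val cP \<Longrightarrow>
     rel H \<Sigma> Map.empty fP fV fI (tarr \<tau>1 (tm \<tau>2)) \<Longrightarrow> is_val fP \<Longrightarrow> rig TBoolC [\<tau>2] \<tau> \<Longrightarrow>
     rel H \<Sigma> \<Gamma> (mbindP cP fP) (mbindV cV fV) (mbindI cI fI) \<tau>"
| R_MUnauth: "hasevi d \<tau>0 \<Longrightarrow> rel H \<Sigma> Map.empty xP xV xI (tauth \<tau>0) \<Longrightarrow> is_val xP \<Longrightarrow> rig TBoolC [\<tau>0] \<tau> \<Longrightarrow>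
     rel H \<Sigma> \<Gamma> (munauthP (eviP d) xP) (munauthV (eviV d) xV) (mretI xI) \<tau>"
| R_Op1: "op1 cP cV cI \<tau>1 \<tau>2 \<Longrightarrow> rig TArrC [\<tau>1, \<tau>2] \<tau> \<Longrightarrow> rel H \<Sigma> \<Gamma> cP cV cI \<tau>"
| R_Op2: "op2 cP cV cI fP fV fI \<tau>1 \<tau>2 \<tau>3 \<Longrightarrow> rig TArrC [\<tau>1, tarr \<tau>2 \<tau>3] \<tau> \<Longrightarrow> rel H \<Sigma> \<Gamma> cP cV cI \<tau>"
| R_Part: "op2 cP cV cI fP fV fI \<tau>1 \<tau>2 \<tau>3 \<Longrightarrow> rel H \<Sigma> Map.empty aP aV aI \<tau>1 \<Longrightarrow> is_val aP \<Longrightarrow>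
     rig TArrC [\<tau>2, \<tau>3] \<tau> \<Longrightarrow> pP = fP aP \<Longrightarrow> pV = fV aV \<Longrightarrow> pI = fI aI \<Longrightarrow> rel H \<Sigma> \<Gamma> pP pV pI \<tau>"

section \<open>Closure properties: conversion, weakening, store extension, substitution\<close>

abbreviation vrel where "vrel H \<Sigma> \<equiv> rel H \<Sigma> Map.empty"

text \<open>Each rule either ends in a type given up to conversion, where the step is absorbed, or
  hands its result type to subderivations, as for unpack, conditional and case, where the induction
  hypothesis is used.\<close>

lemma rel_conv: "rel H \<Sigma> \<Gamma> eP eV eI \<tau> \<Longrightarrow> tequiv \<tau> \<tau>' \<Longrightarrow> rel H \<Sigma> \<Gamma> eP eV eI \<tau>'"
proof (induction arbitrary: \<tau>' rule: rel.induct)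
  case R_Unpack
  show ?case by (rule rel.R_Unpack[OF R_Unpack.hyps(1)]) (rule R_Unpack.IH(2)[OF R_Unpack.prems])
next
  case R_If
  then show ?case by (blast intro: rel.R_If)
next
  case R_Case
  then show ?case by (blast intro: rel.R_Case)
qed ((drule (1) TE_trans | drule (1) rig_conv), (rule rel.intros; assumption))+

lemma rel_weaken: "rel H \<Sigma> \<Gamma> eP eV eI \<tau> \<Longrightarrow> \<Gamma> \<subseteq>\<^sub>m \<Gamma>' \<Longrightarrow> rel H \<Sigma> \<Gamma>' eP eV eI \<tau>"
proof (induction arbitrary: \<Gamma>' rule: rel.induct)
  case (R_Var \<Gamma> x \<tau>0 \<tau>)
  then have "\<Gamma>' x = Some \<tau>0" by (auto simp: map_le_def dom_def)
  with R_Var show ?case by (blast intro: rel.R_Var)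
next
  case R_Rec
  show ?case by (rule rel.R_Rec[OF R_Rec.IH R_Rec.hyps(2)]) (intro map_le_upd R_Rec.prems)
next
  case (R_Unpack \<Gamma> eP eV eI \<kappa> F x bP bV bI \<tau>)
  have "rel H \<Sigma> (\<Gamma>'(x \<mapsto> TAp F \<sigma>)) bP bV bI \<tau>" for \<sigma>
    by (rule R_Unpack.IH(2)[of \<sigma>]) (intro map_le_upd R_Unpack.prems)
  then show ?case by (rule rel.R_Unpack[OF R_Unpack.IH(1)[OF R_Unpack.prems]])
next
  case R_Case
  show ?case
    by (rule rel.R_Case[OF R_Case.IH(1)[OF R_Case.prems] R_Case.IH(2) R_Case.IH(3)])
      (intro map_le_upd R_Case.prems)+
qed (rule rel.intros; (assumption | blast))+

text \<open>The store typing is consulted only at location literals, and positively, so extension is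
  a plain induction. In a semantic model the worlds would have to be built with this
  monotonicity.\<close>

lemma rel_store_mono: "rel H \<Sigma> \<Gamma> eP eV eI \<tau> \<Longrightarrow> \<Sigma> \<subseteq>\<^sub>m \<Sigma>' \<Longrightarrow> rel H \<Sigma>' \<Gamma> eP eV eI \<tau>"
proof (induction rule: rel.induct)
  case (R_Loc l \<tau>0 \<tau> \<Gamma>)
  then have "\<Sigma>' l = Some \<tau>0" by (auto simp: map_le_def dom_def)
  with R_Loc show ?case by (blast intro: rel.R_Loc)
qed (rule rel.intros; (assumption | blast))+

lemma rel_val: "rel H \<Sigma> \<Gamma> eP eV eI \<tau> \<Longrightarrow> is_val eP \<Longrightarrow> is_val eV \<and> is_val eI"
  by (induction rule: rel.induct) (auto dest: srel_val op1_val op2_val op2_part_val(1))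

lemma rel_cl':
  "rel H \<Sigma> \<Gamma> eP eV eI \<tau> \<Longrightarrow> \<Gamma> y = None \<Longrightarrow> subst y v eP = eP \<and> subst y v eV = eV \<and> subst y v eI = eI"
proof (induction arbitrary: y v rule: rel.induct)
  case (R_Auth d \<tau>0 aP aV aI s \<tau> \<Gamma>)
  then show ?case by simp
next
  case (R_MRet aP aV aI \<tau>0 \<tau> \<Gamma>)
  then have "cl aP" "cl aV" "cl aI" by (simp_all add: cl_def)
  then show ?case by (simp add: cl_opcode)
next
  case (R_MBind cP cV cI \<tau>1 fP fV fI \<tau>2 \<tau> \<Gamma>)
  then have "cl cP" "cl cV" "cl cI" "cl fP" "cl fV" "cl fI" by (simp_all add: cl_def)
  then show ?case by (simp add: cl_opcode)
next
  case (R_MUnauth d \<tau>0 xP xV xI \<tau> \<Gamma>)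
  then have "cl xP" "cl xV" "cl xI" by (simp_all add: cl_def)
  then show ?case by (simp add: cl_opcode)
next
  case (R_Part cP cV cI fP fV fI \<tau>1 \<tau>2 \<tau>3 aP aV aI \<tau> pP pV pI \<Gamma>)
  then have "cl aP" "cl aV" "cl aI" by (simp_all add: cl_def)
  with op2_part_val(2)[OF R_Part.hyps(1)] R_Part.hyps show ?case by simp
qed (auto dest: op1_val op2_val)

lemma rel_cl: "vrel H \<Sigma> eP eV eI \<tau> \<Longrightarrow> cl eP \<and> cl eV \<and> cl eI"
  by (simp add: cl_def rel_cl')

lemma rel_closed_env: "vrel H \<Sigma> eP eV eI \<tau> \<Longrightarrow> rel H \<Sigma> \<Gamma> eP eV eI \<tau>"
  by (erule rel_weaken) simp

text \<open>Deleting \<open>y\<close> from the environment makes the binder cases uniform: the bound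
  name either shadows \<open>y\<close>, and the body is untouched, or the two updates commute.
  Library values are closed and remain as they are.\<close>

lemma rel_subst:
  assumes "rel H \<Sigma> \<Gamma> eP eV eI \<tau>" "\<Gamma> y = Some \<tau>1" "vrel H \<Sigma> vP vV vI \<tau>1"
  shows "rel H \<Sigma> (\<Gamma>(y := None)) (subst y vP eP) (subst y vV eV) (subst y vI eI) \<tau>"
  using assms(1,2)
proof (induction rule: rel.induct)
  case (R_Var \<Gamma> x \<tau>0 \<tau>)
  then show ?case
    using assms(3) by (auto intro: rel.R_Var rel_conv rel_closed_env)
next
  case (R_Rec \<Gamma> f \<tau>2 \<tau>3 x eP eV eI \<tau>)
  show ?case
  proof (cases "y = f \<or> y = x")
    case True
    then have "(\<Gamma>(y := None))(f \<mapsto> tarr \<tau>2 \<tau>3, x \<mapsto> \<tau>2) = \<Gamma>(f \<mapsto> tarr \<tau>2 \<tau>3, x \<mapsto> \<tau>2)"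
      by (auto simp: fun_eq_iff)
    with rel.R_Rec[of H \<Sigma> "\<Gamma>(y := None)" f \<tau>2 \<tau>3 x eP eV eI \<tau>] R_Rec.hyps True show ?thesis by (auto simp del: fun_upd_apply)
  next
    case False
    then have "(\<Gamma>(y := None))(f \<mapsto> tarr \<tau>2 \<tau>3, x \<mapsto> \<tau>2) = (\<Gamma>(f \<mapsto> tarr \<tau>2 \<tau>3, x \<mapsto> \<tau>2))(y := None)"
      by (auto simp: fun_eq_iff)
    moreover have "(\<Gamma>(f \<mapsto> tarr \<tau>2 \<tau>3, x \<mapsto> \<tau>2)) y = Some \<tau>1" using False R_Rec.prems by simp
    ultimately show ?thesis
      using rel.R_Rec[of H \<Sigma> "\<Gamma>(y := None)" f \<tau>2 \<tau>3 x _ _ _ \<tau>] R_Rec.IH R_Rec.hyps(2) False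
      by (simp del: fun_upd_apply)
  qed
next
  case (R_Unpack \<Gamma> eP eV eI \<kappa> F x bP bV bI \<tau>)
  have e: "rel H \<Sigma> (\<Gamma>(y := None)) (subst y vP eP) (subst y vV eV) (subst y vI eI) (TAp (TC (TExistsC \<kappa>)) F)"
    by (rule R_Unpack.IH(1)[OF R_Unpack.prems])
  show ?case
  proof (cases "x = y")
    case True
    with rel.R_Unpack[OF e, of x bP bV bI \<tau>] R_Unpack.hyps show ?thesis by (simp del: fun_upd_apply)
  next
    case False
    then have *: "(\<Gamma>(y := None))(x \<mapsto> t) = (\<Gamma>(x \<mapsto> t))(y := None)" for t by (auto simp: fun_eq_iff)
    have "(\<Gamma>(x \<mapsto> t)) y = Some \<tau>1" for t using False R_Unpack.prems by simp
    from R_Unpack.IH(2)[OF this] False show ?thesis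
      using rel.R_Unpack[OF e, of x "subst y vP bP" "subst y vV bV" "subst y vI bI" \<tau>, unfolded *] by (simp del: fun_upd_apply)
  qed
next
  case (R_Case \<Gamma> eP eV eI \<tau>2 \<tau>3 x1 aP aV aI \<tau> x2 bP bV bI)
  have *: "rel H \<Sigma> ((\<Gamma>(y := None))(x \<mapsto> t)) (if x = y then cP else subst y vP cP)
      (if x = y then cV else subst y vV cV) (if x = y then cI else subst y vI cI) \<tau>"
    if "rel H \<Sigma> (\<Gamma>(x \<mapsto> t)) cP cV cI \<tau>"
      and "(\<Gamma>(x \<mapsto> t)) y = Some \<tau>1 \<Longrightarrow>
        rel H \<Sigma> ((\<Gamma>(x \<mapsto> t))(y := None)) (subst y vP cP) (subst y vV cV) (subst y vI cI) \<tau>" for x t cP cV cI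
    using that R_Case.prems by (cases "x = y") (simp_all add: fun_upd_twist del: fun_upd_apply, simp)
  show ?case
    using rel.R_Case[OF R_Case.IH(1)[OF R_Case.prems] *[OF R_Case.hyps(2) R_Case.IH(2)] *[OF R_Case.hyps(3) R_Case.IH(3)]]
    by (simp del: fun_upd_apply)
next
  case (R_Auth d \<tau>0 aP aV aI s \<tau> \<Gamma>)
  then show ?case using rel.R_Auth[OF R_Auth.hyps] rel_cl[OF R_Auth.hyps(2)] by (simp del: fun_upd_apply)
next
  case (R_Evi d \<tau>0 \<tau> \<Gamma>)
  then show ?case using rel.R_Evi[OF R_Evi.hyps] by (simp del: fun_upd_apply)
next
  case (R_MRet aP aV aI \<tau>0 \<tau> \<Gamma>)
  then show ?case using rel.R_MRet[OF R_MRet.hyps] rel_cl[OF R_MRet.hyps(1)] by (simp add: cl_opcode del: fun_upd_apply)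
next
  case (R_MBind cP cV cI \<tau>1 fP fV fI \<tau>2 \<tau> \<Gamma>)
  then show ?case
    using rel.R_MBind[OF R_MBind.hyps] rel_cl[OF R_MBind.hyps(1)] rel_cl[OF R_MBind.hyps(3)] by (simp add: cl_opcode del: fun_upd_apply)
next
  case (R_MUnauth d \<tau>0 xP xV xI \<tau> \<Gamma>)
  then show ?case
    using rel.R_MUnauth[OF R_MUnauth.hyps] rel_cl[OF R_MUnauth.hyps(2)] by (simp add: cl_opcode del: fun_upd_apply)
next
  case (R_Op1 cP cV cI \<tau>1 \<tau>2 \<tau> \<Gamma>)
  then show ?case using rel.R_Op1[OF R_Op1.hyps] op1_val[OF R_Op1.hyps(1)] by (simp del: fun_upd_apply)
next
  case (R_Op2 cP cV cI fP fV fI \<tau>1 \<tau>2 \<tau>3 \<tau> \<Gamma>)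
  then show ?case using rel.R_Op2[OF R_Op2.hyps] op2_val[OF R_Op2.hyps(1)] by (simp del: fun_upd_apply)
next
  case (R_Part cP cV cI fP fV fI \<tau>1 \<tau>2 \<tau>3 aP aV aI \<tau> pP pV pI \<Gamma>)
  then show ?case using rel.R_Part[OF R_Part.hyps] rel_cl[OF R_Part.hyps(2)] op2_part_val(2)[OF R_Part.hyps(1)] by (simp del: fun_upd_apply)
qed (simp, rule rel.intros; (assumption | blast))+

lemma upd_None: "Map.empty(x := None) = Map.empty"
  by auto

lemma rel_beta:
  assumes "rel H \<Sigma> [f \<mapsto> tarr \<tau>1 \<tau>2, x \<mapsto> \<tau>1] bP bV bI \<tau>2"
    and v: "vrel H \<Sigma> vP vV vI \<tau>1"
  shows "vrel H \<Sigma> (subst f (ERec f x bP) (subst x vP bP)) (subst f (ERec f x bV) (subst x vV bV))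
     (subst f (ERec f x bI) (subst x vI bI)) \<tau>2"
proof -
  have r: "vrel H \<Sigma> (ERec f x bP) (ERec f x bV) (ERec f x bI) (tarr \<tau>1 \<tau>2)"
    by (rule rel.R_Rec[OF assms(1)]) (simp add: TE_refl)
  have 1: "rel H \<Sigma> ([f \<mapsto> tarr \<tau>1 \<tau>2, x \<mapsto> \<tau>1](x := None)) (subst x vP bP) (subst x vV bV) (subst x vI bI) \<tau>2"
    by (rule rel_subst[OF assms(1) _ v]) simp
  show ?thesis
  \<comment> \<open>If both names coincide the parameter shadows the function, and the second
    substitution meets a term that is already closed.\<close>
  proof (cases "f = x")
    case True
    with 1 have "vrel H \<Sigma> (subst x vP bP) (subst x vV bV) (subst x vI bI) \<tau>2" by simp
    with rel_cl[OF this] True show ?thesis by simp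
  next
    case False
    with 1 have "rel H \<Sigma> [f \<mapsto> tarr \<tau>1 \<tau>2] (subst x vP bP) (subst x vV bV) (subst x vI bI) \<tau>2"
      by (simp add: fun_upd_twist)
    from rel_subst[OF this fun_upd_same r] show ?thesis by (simp add: upd_None del: fun_upd_apply)
  qed
qed

lemma rel_subst1:
  assumes "rel H \<Sigma> [x \<mapsto> \<tau>1] bP bV bI \<tau>2" "vrel H \<Sigma> vP vV vI \<tau>1"
  shows "vrel H \<Sigma> (subst x vP bP) (subst x vV bV) (subst x vI bI) \<tau>2"
  using rel_subst[OF assms(1) fun_upd_same assms(2)] by (simp add: upd_None del: fun_upd_apply)

subsection \<open>Canonical forms\<close>

text \<open>Data abstraction is enforced here: evidence and computations are functions
  syntactically, but their types have other rigid heads, so related terms of arrow type are never of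
  that kind.\<close>

lemma canon_arr:
  assumes "rel H \<Sigma> \<Gamma> vP vV vI (tarr \<tau>1 \<tau>2)" "is_val vP"
  obtains (rec) f x a b bP bV bI where "vP = ERec f x bP" "vV = ERec f x bV" "vI = ERec f x bI"
      "rel H \<Sigma> (\<Gamma>(f \<mapsto> tarr a b, x \<mapsto> a)) bP bV bI b" "tequiv a \<tau>1" "tequiv b \<tau>2"
  | (op1) a b where "op1 vP vV vI a b" "tequiv a \<tau>1" "tequiv b \<tau>2"
  | (op2) a b c fP fV fI where "op2 vP vV vI fP fV fI a b c" "tequiv a \<tau>1" "tequiv (tarr b c) \<tau>2"
  | (part) a b c cP cV cI fP fV fI aP aV aI where "op2 cP cV cI fP fV fI a b c" "vrel H \<Sigma> aP aV aI a"
      "is_val aP" "vP = fP aP" "vV = fV aV" "vI = fI aI" "tequiv b \<tau>1" "tequiv c \<tau>2"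
  using assms by (cases rule: rel.cases) auto

lemma canon_forall:
  assumes "rel H \<Sigma> \<Gamma> vP vV vI (TAp (TC (TForallC \<kappa>)) F)" "is_val vP"
  obtains eP eV eI where "vP = ETLam eP" "vV = ETLam eV" "vI = ETLam eI"
    "\<And>\<sigma>. rel H \<Sigma> \<Gamma> eP eV eI (TAp F \<sigma>)"
  using assms by (cases rule: rel.cases) (auto, meson TE_app TE_refl rel_conv)

lemma canon_exists:
  assumes "rel H \<Sigma> \<Gamma> vP vV vI (TAp (TC (TExistsC \<kappa>)) F)" "is_val vP"
  obtains eP eV eI \<sigma> where "vP = EPack eP" "vV = EPack eV" "vI = EPack eI" "rel H \<Sigma> \<Gamma> eP eV eI (TAp F \<sigma>)"
  using assms by (cases rule: rel.cases) (auto, meson TE_app TE_refl rel_conv)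

lemma canon_mu:
  assumes "rel H \<Sigma> \<Gamma> vP vV vI (tapps (tmu \<kappa> F) args)" "is_val vP"
  obtains eP eV eI where "vP = EFold eP" "vV = EFold eV" "vI = EFold eI"
    "rel H \<Sigma> \<Gamma> eP eV eI (tapps (TAp F (tmu \<kappa> F)) args)"
  using assms by (cases rule: rel.cases) (auto, meson tequiv_tapps tequiv_unroll rel_conv)

text \<open>The prover's authenticated values are pairs too; their type has a different head, so a
  client projection never reaches into one.\<close>

lemma canon_prod:
  assumes "rel H \<Sigma> \<Gamma> vP vV vI (tprod \<tau>1 \<tau>2)" "is_val vP"
  obtains eP eV eI aP aV aI where "vP = EPair eP aP" "vV = EPair eV aV" "vI = EPair eI aI"
    "rel H \<Sigma> \<Gamma> eP eV eI \<tau>1" "rel H \<Sigma> \<Gamma> aP aV aI \<tau>2"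
  using assms by (cases rule: rel.cases) (auto intro: rel_conv dest: op1_val op2_val)

lemma canon_sum:
  assumes "rel H \<Sigma> \<Gamma> vP vV vI (tsum \<tau>1 \<tau>2)" "is_val vP"
  obtains (inl) eP eV eI where "vP = EInjL eP" "vV = EInjL eV" "vI = EInjL eI" "rel H \<Sigma> \<Gamma> eP eV eI \<tau>1"
  | (inr) eP eV eI where "vP = EInjR eP" "vV = EInjR eV" "vI = EInjR eI" "rel H \<Sigma> \<Gamma> eP eV eI \<tau>2"
  using assms by (cases rule: rel.cases) (auto intro: rel_conv)

lemma canon_ref:
  assumes "rel H \<Sigma> \<Gamma> vP vV vI (tref \<tau>)" "is_val vP"
  obtains l \<tau>0 where "vP = ELoc l" "vV = ELoc l" "vI = ELoc l" "\<Sigma> l = Some \<tau>0" "tequiv \<tau>0 \<tau>"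
  using assms by (cases rule: rel.cases) auto

lemma canon_unit:
  assumes "rel H \<Sigma> \<Gamma> vP vV vI tunit" "is_val vP"
  shows "vP = EUnit \<and> vV = EUnit \<and> vI = EUnit"
  using assms by (cases rule: rel.cases) auto

lemma canon_bool:
  assumes "rel H \<Sigma> \<Gamma> vP vV vI tbool" "is_val vP"
  shows "\<exists>b. vP = EBool b \<and> vV = EBool b \<and> vI = EBool b"
  using assms by (cases rule: rel.cases) auto

lemma canon_int:
  assumes "rel H \<Sigma> \<Gamma> vP vV vI tint" "is_val vP"
  shows "\<exists>n. vP = EInt n \<and> vV = EInt n \<and> vI = EInt n"
  using assms by (cases rule: rel.cases) auto

lemma canon_str:
  assumes "rel H \<Sigma> \<Gamma> vP vV vI tstring" "is_val vP"
  shows "\<exists>s. vP = EStr s \<and> vV = EStr s \<and> vI = EStr s"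
  using assms by (cases rule: rel.cases) auto

lemma canon_auth:
  assumes "rel H \<Sigma> \<Gamma> vP vV vI (tauth \<tau>)" "is_val vP"
  obtains d aP aV s where "vP = EPair aP (EStr (H s))" "vV = EStr (H s)" "srel d aP aV s" "hasevi d \<tau>"
    "vrel H \<Sigma> aP aV vI \<tau>" "is_val vI"
  using assms by (cases rule: rel.cases) (auto intro: rel_conv hasevi_conv)

lemma canon_evi:
  assumes "rel H \<Sigma> \<Gamma> vP vV vI (tevi \<tau>)" "is_val vP"
  obtains d where "vP = eviP d" "vV = eviV d" "vI = EUnit" "hasevi d \<tau>"
  using assms by (cases rule: rel.cases) (auto intro: hasevi_conv)

lemma canon_m:
  assumes "rel H \<Sigma> \<Gamma> vP vV vI (tm \<tau>)" "is_val vP"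
  obtains (ret) aP aV aI where "vP = mretP aP" "vV = mretV aV" "vI = mretI aI"
      "vrel H \<Sigma> aP aV aI \<tau>" "is_val aP"
  | (bind) cP cV cI fP fV fI \<tau>1 where "vP = mbindP cP fP" "vV = mbindV cV fV" "vI = mbindI cI fI"
      "vrel H \<Sigma> cP cV cI (tm \<tau>1)" "is_val cP" "vrel H \<Sigma> fP fV fI (tarr \<tau>1 (tm \<tau>))" "is_val fP"
  | (unauth) d xP xV xI where "vP = munauthP (eviP d) xP" "vV = munauthV (eviV d) xV" "vI = mretI xI"
      "hasevi d \<tau>" "vrel H \<Sigma> xP xV xI (tauth \<tau>)" "is_val xP"
  using assms(1)
proof (cases rule: rel.cases)
  case (R_MBind cP cV cI \<tau>1 fP fV fI \<tau>2)
  then have "tequiv \<tau>2 \<tau>" by simp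
  then have "tequiv (tarr \<tau>1 (tm \<tau>2)) (tarr \<tau>1 (tm \<tau>))"
    unfolding tarr_def tm_def by (intro TE_app TE_refl)
  from bind[OF R_MBind(1-5) rel_conv[OF R_MBind(6) this] R_MBind(7)] show ?thesis .
next
  case (R_MUnauth d \<tau>0 xP xV xI)
  then have t: "tequiv \<tau>0 \<tau>" by simp
  then have "tequiv (tauth \<tau>0) (tauth \<tau>)"
    unfolding tauth_def by (intro TE_app TE_refl)
  from unauth[OF R_MUnauth(1-3) hasevi_conv[OF R_MUnauth(4) t] rel_conv[OF R_MUnauth(5) this] R_MUnauth(6)]
  show ?thesis .
next
  case (R_MRet aP aV aI \<tau>0)
  then have "tequiv \<tau>0 \<tau>" by simp
  from ret[OF R_MRet(1-3) rel_conv[OF R_MRet(4) this] R_MRet(5)] show ?thesis .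
qed (use assms(2) in auto)

text \<open>Canonical forms follow the type as the evidence does, so induction on the evidence
  derivation takes the values apart in step. Authentication needs this in order to hash the same
  string on both sides.\<close>

lemma rel_srel:
  "hasevi d \<tau> \<Longrightarrow> vrel H \<Sigma> vP vV vI \<tau> \<Longrightarrow> is_val vP \<Longrightarrow> \<exists>s. srel d vP vV s"
proof (induction arbitrary: vP vV vI rule: hasevi.induct)
  case (HE_Auth a \<tau>)
  then have "vrel H \<Sigma> vP vV vI (tauth a)"
    by (auto simp: rig_def tauth_def tunit_def intro: rel_conv TE_sym)
  from canon_auth[OF this HE_Auth.prems(2)] show ?case
    by (metis srel.intros(1) srel_val)
next
  case (HE_Str \<tau>)
  then have "vrel H \<Sigma> vP vV vI tstring"
    by (auto simp: rig_def tstring_def intro: rel_conv TE_sym)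
  from canon_str[OF this HE_Str.prems(2)] show ?case by (auto intro: srel.intros)
next
  case (HE_Int \<tau>)
  then have "vrel H \<Sigma> vP vV vI tint"
    by (auto simp: rig_def tint_def intro: rel_conv TE_sym)
  from canon_int[OF this HE_Int.prems(2)] show ?case by (auto intro: srel.intros)
next
  case (HE_Pair d1 a d2 b \<tau>)
  then have "vrel H \<Sigma> vP vV vI (tprod a b)"
    by (auto simp: rig_def tprod_def intro: rel_conv TE_sym)
  from this HE_Pair.prems(2) show ?case
  proof (cases rule: canon_prod)
    case (1 eP eV eI aP aV aI)
    then show ?thesis using HE_Pair.IH(1)[of eP eV eI] HE_Pair.IH(2)[of aP aV aI] HE_Pair.prems(2)
      by (auto intro: srel.intros)
  qed
next
  case (HE_Sum d1 a d2 b \<tau>)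
  then have "vrel H \<Sigma> vP vV vI (tsum a b)"
    by (auto simp: rig_def tsum_def intro: rel_conv TE_sym)
  from this HE_Sum.prems(2) show ?case
  proof (cases rule: canon_sum)
    case (inl eP eV eI)
    then show ?thesis using HE_Sum.IH(1)[of eP eV eI] HE_Sum.prems(2) by (auto intro: srel.intros)
  next
    case (inr eP eV eI)
    then show ?thesis using HE_Sum.IH(2)[of eP eV eI] HE_Sum.prems(2) by (auto intro: srel.intros)
  qed
next
  case (HE_Mu d F \<tau>)
  then have "vrel H \<Sigma> vP vV vI (tapps (tmu Star F) [])"
    by (auto simp: rig_def tmu_def intro: rel_conv TE_sym)
  from this HE_Mu.prems(2) show ?case
  proof (cases rule: canon_mu)
    case (1 eP eV eI)
    then show ?thesis using HE_Mu.IH[of eP eV eI] HE_Mu.prems(2) by (auto intro: srel.intros)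
  qed
qed

subsection \<open>Related configurations\<close>

text \<open>The case of an untyped location forces the three heaps to share one domain, so that a
  location free for the prover is free for the others.\<close>

definition cell_rel :: "(string \<Rightarrow> string) \<Rightarrow> (loc \<rightharpoonup> ty) \<Rightarrow> expr option \<Rightarrow> expr option \<Rightarrow> expr option \<Rightarrow> ty option \<Rightarrow> bool" where
  "cell_rel H \<Sigma> cP cV cI t \<longleftrightarrow> (case t of None \<Rightarrow> cP = None \<and> cV = None \<and> cI = None
     | Some \<tau> \<Rightarrow> \<exists>uP uV uI. cP = Some uP \<and> cV = Some uV \<and> cI = Some uI \<and> is_val uP \<and> vrel H \<Sigma> uP uV uI \<tau>)"

lemma cell_rel_mono: "cell_rel H \<Sigma> a b c t \<Longrightarrow> \<Sigma> \<subseteq>\<^sub>m \<Sigma>' \<Longrightarrow> cell_rel H \<Sigma>' a b c t"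
  unfolding cell_rel_def by (cases t) (simp, simp, blast intro: rel_store_mono)

text \<open>The hash histories are left unrelated because they do diverge: the ideal library never
  hashes, and the verifier hashes again on each unauth. The index is common, and \<open>H\<close> is
  the hash function it selects.\<close>

definition conf :: "('i \<Rightarrow> string \<Rightarrow> string) \<Rightarrow> (string \<Rightarrow> string) \<Rightarrow> (loc \<rightharpoonup> ty) \<Rightarrow> 'i state \<Rightarrow> 'i state \<Rightarrow> 'i state \<Rightarrow> bool" where
  "conf hf H \<Sigma> sP sV sI \<longleftrightarrow> (\<exists>mP mV mI hP hV hI i.
     sP = (mP, hP, i) \<and> sV = (mV, hV, i) \<and> sI = (mI, hI, i) \<and> hf i = H \<and>
     (\<forall>l. cell_rel H \<Sigma> (mP l) (mV l) (mI l) (\<Sigma> l)))"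

lemma op1_apply:
  assumes op: "op1 cP cV cI a b" and x: "vrel H \<Sigma> xP xV xI a" "is_val xP"
    and ev: "ev hf (EApp cP xP) sP w sP'"
  shows "sP' = sP \<and> (\<exists>wV wI. (\<forall>\<sigma>. ev hf (EApp cV xV) \<sigma> wV \<sigma>) \<and>
    (\<forall>\<sigma>. ev hf (EApp cI xI) \<sigma> wI \<sigma>) \<and> vrel H \<Sigma> w wV wI b)"
proof -
  note v = x(2) conjunct1[OF rel_val[OF x]] conjunct2[OF rel_val[OF x]]
  note c = rel_cl[OF x(1)]
  from op show ?thesis
  proof cases
    case 1
    with ev have "w = mretP xP \<and> sP' = sP"
      by (simp add: sx ev_val v c mretP_def)
    moreover have "ev hf (EApp cV xV) \<sigma> (mretV xV) \<sigma>" "ev hf (EApp cI xI) \<sigma> (mretI xI) \<sigma>" for \<sigma>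
      unfolding 1 by (simp_all add: sx ev_val v c mretV_def mretI_def)
    moreover have "vrel H \<Sigma> (mretP xP) (mretV xV) (mretI xI) b"
      by (rule rel.R_MRet[OF x]) (simp add: 1 TE_refl)
    ultimately show ?thesis by blast
  next
    case (2 F)
    from x[unfolded 2] obtain d where d: "xP = eviP d" "xV = eviV d" "xI = EUnit"
      and h: "hasevi d (TAp F (tmu Star F))" by (rule canon_evi)
    from ev 2 d have "w = eviP (DMu d) \<and> sP' = sP"
      by (simp add: sx ev_val opcode_defs)
    moreover have "ev hf (EApp cV xV) \<sigma> (eviV (DMu d)) \<sigma>" "ev hf (EApp cI xI) \<sigma> EUnit \<sigma>" for \<sigma>
      unfolding 2 d by (simp_all add: sx ev_val opcode_defs)
    moreover have "vrel H \<Sigma> (eviP (DMu d)) (eviV (DMu d)) EUnit b"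
      by (rule rel.R_Evi[OF hasevi.HE_Mu[OF h, of "tmu Star F"]]) (simp_all add: 2 TE_refl)
    ultimately show ?thesis by blast
  qed
qed

lemma part_apply:
  assumes op: "op2 cP cV cI fP fV fI a b c" and y: "vrel H \<Sigma> yP yV yI a" "is_val yP"
    and x: "vrel H \<Sigma> xP xV xI b" "is_val xP"
    and ev: "ev hf (EApp (fP yP) xP) sP w sP'" and conf: "conf hf H \<Sigma> sP sV sI"
  shows "\<exists>wV wI sV' sI'. ev hf (EApp (fV yV) xV) sV wV sV' \<and> ev hf (EApp (fI yI) xI) sI wI sI' \<and>
    vrel H \<Sigma> w wV wI c \<and> conf hf H \<Sigma> sP' sV' sI'"
proof -
  note v = x(2) conjunct1[OF rel_val[OF x]] conjunct2[OF rel_val[OF x]]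
    y(2) conjunct1[OF rel_val[OF y]] conjunct2[OF rel_val[OF y]]
  note c = rel_cl[OF x(1)] rel_cl[OF y(1)]
  from op show ?thesis
  proof cases
    case (op2_bind a b)
    with ev have "w = mbindP yP xP \<and> sP' = sP"
      by (simp add: sx ev_val v c mbindP_def)
    moreover have "ev hf (EApp (fV yV) xV) sV (mbindV yV xV) sV" "ev hf (EApp (fI yI) xI) sI (mbindI yI xI) sI"
      unfolding op2_bind by (simp_all add: sx ev_val v c mbindV_def mbindI_def)
    moreover have "vrel H \<Sigma> (mbindP yP xP) (mbindV yV xV) (mbindI yI xI) c"
      using y x by (intro rel.R_MBind[of H \<Sigma> yP yV yI a xP xV xI b]) (simp_all add: op2_bind TE_refl)
    ultimately show ?thesis using conf by blast
  next
    case (op2_pair t u)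
    from y[unfolded op2_pair] obtain d where d: "yP = eviP d" "yV = eviV d" "yI = EUnit" "hasevi d t" by (rule canon_evi)
    from x[unfolded op2_pair] obtain d' where d': "xP = eviP d'" "xV = eviV d'" "xI = EUnit" "hasevi d' u" by (rule canon_evi)
    from ev op2_pair d d' have "w = eviP (DPair d d') \<and> sP' = sP"
      by (simp add: sx ev_val opcode_defs)
    moreover have "ev hf (EApp (fV yV) xV) sV (eviV (DPair d d')) sV" "ev hf (EApp (fI yI) xI) sI EUnit sI"
      unfolding op2_pair d d' by (simp_all add: sx ev_val opcode_defs)
    moreover have "vrel H \<Sigma> (eviP (DPair d d')) (eviV (DPair d d')) EUnit c"
      by (rule rel.R_Evi[OF hasevi.HE_Pair[OF d(4) d'(4), of "tprod t u"]]) (simp_all add: op2_pair TE_refl)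
    ultimately show ?thesis using conf by blast
  next
    case (op2_sum t u)
    from y[unfolded op2_sum] obtain d where d: "yP = eviP d" "yV = eviV d" "yI = EUnit" "hasevi d t" by (rule canon_evi)
    from x[unfolded op2_sum] obtain d' where d': "xP = eviP d'" "xV = eviV d'" "xI = EUnit" "hasevi d' u" by (rule canon_evi)
    from ev op2_sum d d' have "w = eviP (DSum d d') \<and> sP' = sP"
      by (simp add: sx ev_val opcode_defs)
    moreover have "ev hf (EApp (fV yV) xV) sV (eviV (DSum d d')) sV" "ev hf (EApp (fI yI) xI) sI EUnit sI"
      unfolding op2_sum d d' by (simp_all add: sx ev_val opcode_defs)
    moreover have "vrel H \<Sigma> (eviP (DSum d d')) (eviV (DSum d d')) EUnit c"
      by (rule rel.R_Evi[OF hasevi.HE_Sum[OF d(4) d'(4), of "tsum t u"]]) (simp_all add: op2_sum TE_refl)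
    ultimately show ?thesis using conf by blast
  next
    case op2_auth
    from y[unfolded op2_auth] obtain d where d: "yP = eviP d" "yV = eviV d" "yI = EUnit" "hasevi d b" by (rule canon_evi)
    \<comment> \<open>Value and evidence have the same type, so both serializers return this one
      string \<open>s\<close>, which both sides then hash.\<close>
    from rel_srel[OF d(4) x] obtain s where s: "srel d xP xV s" by blast
    from conf obtain mP mV mI hP hV hI i where
      st: "sP = (mP, hP, i)" "sV = (mV, hV, i)" "sI = (mI, hI, i)" and H: "hf i = H" by (auto simp: conf_def)
    from ev have "w = EPair xP (EStr (H s)) \<and> sP' = (mP, insert s hP, i)"
      by (simp add: op2_auth d st sx ev_val v c authFP_def ev_serP[OF s] H)
    moreover have "ev hf (EApp (fV yV) xV) sV (EStr (H s)) (mV, insert s hV, i)" "ev hf (EApp (fI yI) xI) sI xI sI"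
      unfolding op2_auth d st by (simp_all add: sx ev_val v c authFV_def ev_serV[OF s] H)
    moreover have "vrel H \<Sigma> (EPair xP (EStr (H s))) (EStr (H s)) xI c"
      by (rule rel.R_Auth[OF d(4) x(1) v(3) s]) (simp add: op2_auth TE_refl)
    moreover have "conf hf H \<Sigma> (mP, insert s hP, i) (mV, insert s hV, i) sI"
      using conf by (simp add: conf_def st)
    ultimately show ?thesis by blast
  next
    \<comment> \<open>No hash is compared yet: supplying the arguments only creates the suspended
      computation.\<close>
    case (op2_unauth t)
    from y[unfolded op2_unauth] obtain d where d: "yP = eviP d" "yV = eviV d" "yI = EUnit" "hasevi d t" by (rule canon_evi)
    from ev op2_unauth d have "w = munauthP (eviP d) xP \<and> sP' = sP"
      by (simp add: sx ev_val v c munauthP_def)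
    moreover have "ev hf (EApp (fV yV) xV) sV (munauthV (eviV d) xV) sV" "ev hf (EApp (fI yI) xI) sI (mretI xI) sI"
      unfolding op2_unauth d by (simp_all add: sx ev_val v c munauthV_def mretI_def)
    moreover have "vrel H \<Sigma> (munauthP (eviP d) xP) (munauthV (eviV d) xV) (mretI xI) c"
      using x by (intro rel.R_MUnauth[OF d(4)]) (simp_all add: op2_unauth TE_refl)
    ultimately show ?thesis using conf by blast
  qed
qed

subsection \<open>Simulation\<close>

lemma rel_lit [simp]:
  "rel H \<Sigma> \<Gamma> EUnit EUnit EUnit tunit" "rel H \<Sigma> \<Gamma> (EBool c) (EBool c) (EBool c) tbool"
  "rel H \<Sigma> \<Gamma> (EInt n) (EInt n) (EInt n) tint" "rel H \<Sigma> \<Gamma> (EStr s) (EStr s) (EStr s) tstring"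
  by (simp_all add: rel.R_Unit rel.R_Bool rel.R_Int rel.R_Str)

lemma rel_InjL: "rel H \<Sigma> \<Gamma> eP eV eI \<tau>1 \<Longrightarrow> rel H \<Sigma> \<Gamma> (EInjL eP) (EInjL eV) (EInjL eI) (tsum \<tau>1 \<tau>2)"
  and rel_InjR: "rel H \<Sigma> \<Gamma> eP eV eI \<tau>2 \<Longrightarrow> rel H \<Sigma> \<Gamma> (EInjR eP) (EInjR eV) (EInjR eI) (tsum \<tau>1 \<tau>2)"
  using rel.R_InjL[of H \<Sigma> \<Gamma> eP eV eI \<tau>1 \<tau>2 "tsum \<tau>1 \<tau>2"] rel.R_InjR[of H \<Sigma> \<Gamma> eP eV eI \<tau>2 \<tau>1 "tsum \<tau>1 \<tau>2"]
  by (simp_all add: TE_refl)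

text \<open>Operators, equality among them, are typed at base types only, where related values are
  literally the same. Equality at an abstract type could tell the implementations apart.\<close>

lemma binop_rel:
  assumes "binop_ty op \<tau>1 \<tau>2 \<tau>" "vrel H \<Sigma> vP vV vI \<tau>1" "is_val vP" "vrel H \<Sigma> uP uV uI \<tau>2" "is_val uP"
    and "bin_eval op vP uP = Some w"
  shows "bin_eval op vV uV = Some w \<and> bin_eval op vI uI = Some w \<and> vrel H \<Sigma> w w w \<tau>"
proof -
  have base: "vV = vP \<and> vI = vP" if "base_eq_ty t" "vrel H \<Sigma> vP vV vI t" "is_val vP" for t vP vV vI
    using that by (cases rule: base_eq_ty.cases) (auto dest: canon_unit canon_bool canon_int canon_str)
  from assms(1) have "base_eq_ty \<tau>1 \<and> base_eq_ty \<tau>2"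
    by cases (auto intro: base_eq_ty.intros)
  with base assms(2-5) have "vV = vP \<and> vI = vP \<and> uV = uP \<and> uI = uP" by blast
  moreover have "vrel H \<Sigma> w w w \<tau>"
    using assms(1) by cases (use assms(6) in \<open>auto simp: op_eval_iff\<close>)
  ultimately show ?thesis using assms(6) by simp
qed

lemma unop_rel:
  assumes "unop_ty op \<tau>1 \<tau>" "vrel H \<Sigma> vP vV vI \<tau>1" "is_val vP" and "un_eval op vP = Some w"
  shows "un_eval op vV = Some w \<and> un_eval op vI = Some w \<and> vrel H \<Sigma> w w w \<tau>"
proof -
  from assms(1) have "vV = vP \<and> vI = vP"
    by cases (use assms(2,3) canon_bool canon_int canon_str in blast)+
  moreover have "vrel H \<Sigma> w w w \<tau>"
    using assms(1)
  proof cases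
    case 3
    with assms(4) show ?thesis
      by (auto simp: op_eval_iff ENone_def ESome_def split: option.splits
          intro!: rel_InjL rel_InjR)
  qed (use assms(4) in \<open>auto simp: op_eval_iff\<close>)
  ultimately show ?thesis using assms(4) by simp
qed

text \<open>The simulation follows a given prover run: its result and final state are parameters,
  while the runs of the other two and the extended store typing are to be found.\<close>

definition outcome ::
  "('i \<Rightarrow> string \<Rightarrow> string) \<Rightarrow> (string \<Rightarrow> string) \<Rightarrow> (loc \<rightharpoonup> ty) \<Rightarrow> expr \<Rightarrow> 'i state \<Rightarrow> expr \<Rightarrow> 'i state \<Rightarrow> expr \<Rightarrow> 'i state \<Rightarrow> ty \<Rightarrow> bool" where
  "outcome hf H \<Sigma> vP sP' eV sV eI sI \<tau> \<longleftrightarrow> (\<exists>\<Sigma>' vV sV' vI sI'. \<Sigma> \<subseteq>\<^sub>m \<Sigma>' \<and>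
     ev hf eV sV vV sV' \<and> ev hf eI sI vI sI' \<and> vrel H \<Sigma>' vP vV vI \<tau> \<and> conf hf H \<Sigma>' sP' sV' sI')"

lemma outcome_val:
  "conf hf H \<Sigma> sP sV sI \<Longrightarrow> vrel H \<Sigma> vP vV vI \<tau> \<Longrightarrow> is_val vP \<Longrightarrow> outcome hf H \<Sigma> vP sP vV sV vI sI \<tau>"
  unfolding outcome_def using rel_val[of H \<Sigma> Map.empty vP vV vI \<tau>] ev_val map_le_refl by metis

lemma outcome_conv: "outcome hf H \<Sigma> vP sP eV sV eI sI \<tau> \<Longrightarrow> tequiv \<tau> \<tau>' \<Longrightarrow> outcome hf H \<Sigma> vP sP eV sV eI sI \<tau>'"
  unfolding outcome_def by (blast intro: rel_conv)

lemma outcome_red: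
  assumes "outcome hf H \<Sigma> vP sP cV sV cI sI \<tau>"
    and "\<And>v \<sigma>'. ev hf cV sV v \<sigma>' \<Longrightarrow> ev hf eV sV v \<sigma>'" "\<And>v \<sigma>'. ev hf cI sI v \<sigma>' \<Longrightarrow> ev hf eI sI v \<sigma>'"
  shows "outcome hf H \<Sigma> vP sP eV sV eI sI \<tau>"
  using assms unfolding outcome_def by blast

lemma ev_bind:
  assumes "ev hf e \<sigma> v \<sigma>1" "frame_ok F" "ev hf (fill_frame F v) \<sigma>1 w \<sigma>'"
  shows "ev hf (fill_frame F e) \<sigma> w \<sigma>'"
  by (rule ev_frame[OF _ assms(2,3)]) (simp add: ev_val[OF ev_is_val[OF assms(1)]] assms(1))

text \<open>Sequencing for simulations: evaluate the hole, then continue with its value. The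
  verifier and ideal frames are separate because each contains the unevaluated subterms of its own
  side.\<close>

lemma outcome_bind:
  assumes "outcome hf H \<Sigma> vP sP' eV sV eI sI \<tau>"
    and "\<And>\<Sigma>' vV sV' vI sI'. \<Sigma> \<subseteq>\<^sub>m \<Sigma>' \<Longrightarrow> vrel H \<Sigma>' vP vV vI \<tau> \<Longrightarrow> is_val vV \<Longrightarrow> is_val vI \<Longrightarrow>
      conf hf H \<Sigma>' sP' sV' sI' \<Longrightarrow> outcome hf H \<Sigma>' wP sP'' (fill_frame FV vV) sV' (fill_frame FI vI) sI' \<tau>'"
    and "frame_ok FV" "frame_ok FI"
  shows "outcome hf H \<Sigma> wP sP'' (fill_frame FV eV) sV (fill_frame FI eI) sI \<tau>'"
proof -
  from assms(1) obtain \<Sigma>' vV sV' vI sI' where 1: "\<Sigma> \<subseteq>\<^sub>m \<Sigma>'" "ev hf eV sV vV sV'" "ev hf eI sI vI sI'"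
    "vrel H \<Sigma>' vP vV vI \<tau>" "conf hf H \<Sigma>' sP' sV' sI'"
    unfolding outcome_def by blast
  from assms(2)[OF 1(1,4) ev_is_val[OF 1(2)] ev_is_val[OF 1(3)] 1(5)] obtain \<Sigma>'' wV sV'' wI sI'' where
    2: "\<Sigma>' \<subseteq>\<^sub>m \<Sigma>''" "ev hf (fill_frame FV vV) sV' wV sV''" "ev hf (fill_frame FI vI) sI' wI sI''"
    "vrel H \<Sigma>'' wP wV wI \<tau>'" "conf hf H \<Sigma>'' sP'' sV'' sI''"
    unfolding outcome_def by blast
  from 2(4,5) map_le_trans[OF 1(1) 2(1)] ev_bind[OF 1(2) assms(3) 2(2)] ev_bind[OF 1(3) assms(4) 2(3)]
  show ?thesis unfolding outcome_def by blast
qed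

lemma outcome_con:
  assumes "outcome hf H \<Sigma> v sP' eV sV eI sI \<tau>0" "frame_ok F" "is_val (fill_frame F v)"
    and "\<And>\<Sigma>' vV vI. vrel H \<Sigma>' v vV vI \<tau>0 \<Longrightarrow>
      vrel H \<Sigma>' (fill_frame F v) (fill_frame F vV) (fill_frame F vI) \<tau>"
  shows "outcome hf H \<Sigma> (fill_frame F v) sP' (fill_frame F eV) sV (fill_frame F eI) sI \<tau>"
  by (rule outcome_bind[where FV = F and FI = F, OF assms(1) _ assms(2,2)])
    (rule outcome_val[OF _ assms(4,3)])

text \<open>Allocation may return any free location, so the other two runs can copy the prover's
  choice \<open>l\<close>; equality of the domains guarantees that it is free for them.\<close>

lemma conf_alloc:
  assumes "conf hf H \<Sigma> (mP, hP, i) sV sI" "mP l = None" "vrel H \<Sigma> vP vV vI \<tau>" "is_val vP"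
  obtains mV hV mI hI where "sV = (mV, hV, i)" "sI = (mI, hI, i)" "mV l = None" "mI l = None" "\<Sigma> \<subseteq>\<^sub>m \<Sigma>(l \<mapsto> \<tau>)"
    "conf hf H (\<Sigma>(l \<mapsto> \<tau>)) (mP(l \<mapsto> vP), hP, i) (mV(l \<mapsto> vV), hV, i) (mI(l \<mapsto> vI), hI, i)"
proof -
  from assms(1) obtain mV hV mI hI where s: "sV = (mV, hV, i)" "sI = (mI, hI, i)" "hf i = H"
    and c: "\<And>l. cell_rel H \<Sigma> (mP l) (mV l) (mI l) (\<Sigma> l)"
    unfolding conf_def by auto
  have l: "\<Sigma> l = None" "mV l = None" "mI l = None" using c[of l] assms(2) by (auto simp: cell_rel_def split: option.splits)
  then have le: "\<Sigma> \<subseteq>\<^sub>m \<Sigma>(l \<mapsto> \<tau>)" by (auto simp: map_le_def)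
  have "cell_rel H (\<Sigma>(l \<mapsto> \<tau>)) ((mP(l \<mapsto> vP)) l') ((mV(l \<mapsto> vV)) l') ((mI(l \<mapsto> vI)) l') ((\<Sigma>(l \<mapsto> \<tau>)) l')" for l'
    using cell_rel_mono[OF c[of l'] le] rel_store_mono[OF assms(3) le] assms(4)
    by (cases "l' = l") (simp_all add: cell_rel_def[of _ _ "Some _" "Some _" "Some _" "Some _"])
  then show thesis using that[OF s(1,2) l(2,3) le] s(3) unfolding conf_def by blast
qed

lemma conf_load:
  assumes "conf hf H \<Sigma> (mP, hP, i) sV sI" "\<Sigma> l = Some \<tau>"
  obtains mV hV mI hI uP uV uI where "sV = (mV, hV, i)" "sI = (mI, hI, i)"
    "mP l = Some uP" "mV l = Some uV" "mI l = Some uI" "is_val uP" "vrel H \<Sigma> uP uV uI \<tau>"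
proof -
  from assms(1) obtain mV hV mI hI where s: "sV = (mV, hV, i)" "sI = (mI, hI, i)"
    and c: "cell_rel H \<Sigma> (mP l) (mV l) (mI l) (\<Sigma> l)"
    unfolding conf_def by auto
  from c assms(2) that[OF s] show thesis by (auto simp: cell_rel_def)
qed

lemma conf_store:
  assumes "conf hf H \<Sigma> (mP, hP, i) (mV, hV, i) (mI, hI, i)" "\<Sigma> l = Some \<tau>"
    "vrel H \<Sigma> vP vV vI \<tau>" "is_val vP"
  shows "conf hf H \<Sigma> (mP(l \<mapsto> vP), hP, i) (mV(l \<mapsto> vV), hV, i) (mI(l \<mapsto> vI), hI, i)"
proof -
  from assms(1) have H: "hf i = H"
    and c: "\<And>l. cell_rel H \<Sigma> (mP l) (mV l) (mI l) (\<Sigma> l)"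
    unfolding conf_def by auto
  have "cell_rel H \<Sigma> ((mP(l \<mapsto> vP)) l') ((mV(l \<mapsto> vV)) l') ((mI(l \<mapsto> vI)) l') (\<Sigma> l')" for l'
    using c[of l'] assms(2-4)
    by (cases "l' = l") (simp_all add: cell_rel_def[of _ _ "Some _" "Some _" "Some _" "Some _"])
  with H show ?thesis unfolding conf_def by blast
qed

lemma conf_hash:
  assumes "conf hf H \<Sigma> (mP, hP, i) sV sI"
  obtains mV hV mI hI where "sV = (mV, hV, i)" "sI = (mI, hI, i)" "hf i = H"
    "\<And>hP hV hI. conf hf H \<Sigma> (mP, hP, i) (mV, hV, i) (mI, hI, i)"
  using assms unfolding conf_def by auto

text \<open>Only a client closure runs client code, and only there is the induction hypothesis for
  the body needed. A library operation just builds a closure, or serializes and hashes, and is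
  covered by direct computation.\<close>

lemma apply_sim:
  assumes IH: "\<And>bP bV bI w sP'. big hf n bP sP w sP' \<Longrightarrow> vrel H \<Sigma> bP bV bI \<tau>2 \<Longrightarrow>
      outcome hf H \<Sigma> w sP' bV sV bI sI \<tau>2"
    and big: "big hf n (subst f (ERec f x b) (subst x aP b)) sP w sP'"
    and f: "vrel H \<Sigma> (ERec f x b) fV fI (tarr \<tau>1 \<tau>2)"
    and a: "vrel H \<Sigma> aP aV aI \<tau>1" "is_val aP" and conf: "conf hf H \<Sigma> sP sV sI"
  shows "outcome hf H \<Sigma> w sP' (EApp fV aV) sV (EApp fI aI) sI \<tau>2"
proof -
  note va = conjunct1[OF rel_val[OF a]] conjunct2[OF rel_val[OF a]]
  have ev: "ev hf (EApp (ERec f x b) aP) sP w sP'"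
    using big unfolding ev_App_ERec ev_val[OF a(2)] by (auto simp: ev_def)
  from f is_val.simps(2)[of f x b, THEN iffD2, OF TrueI] show ?thesis
  proof (cases rule: canon_arr)
    case (rec g y t u bP bV bI)
    from rec(4) have "vrel H \<Sigma> (subst f (ERec f x bP) (subst x aP bP)) (subst f (ERec f x bV) (subst x aV bV))
     (subst f (ERec f x bI) (subst x aI bI)) u"
      using rec(1) by (intro rel_beta[OF _ rel_conv[OF a(1) TE_sym[OF rec(5)]]]) simp_all
    from IH[OF _ rel_conv[OF this rec(6)]] big rec have
      "outcome hf H \<Sigma> w sP' (subst f (ERec f x bV) (subst x aV bV)) sV (subst f (ERec f x bI) (subst x aI bI)) sI \<tau>2"
      by simp
    then show ?thesis
      by (rule outcome_red) (use rec va in \<open>simp_all add: ev_App_ERec ev_val\<close>)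
  next
    case (op1 t u)
    from op1_apply[OF op1(1) rel_conv[OF a(1) TE_sym[OF op1(2)]] a(2) ev] obtain wV wI where
      r: "sP' = sP" "ev hf (EApp fV aV) sV wV sV" "ev hf (EApp fI aI) sI wI sI" "vrel H \<Sigma> w wV wI u"
      by blast
    from r(2,3) rel_conv[OF r(4) op1(3)] conf r(1) show ?thesis
      unfolding outcome_def using map_le_refl by blast
  next
    case (op2 t u c gP gV gI)
    note at = rel_conv[OF a(1) TE_sym[OF op2(2)]]
    note clv = rel_cl[OF a(1)]
    have "w = gP aP" "sP' = sP" using op2_ev(1)[OF op2(1) a(2) conjunct1[OF clv], THEN iffD1, OF ev] by auto
    moreover have "outcome hf H \<Sigma> (gP aP) sP (EApp fV aV) sV (EApp fI aI) sI \<tau>2"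
    proof (rule outcome_red)
      have "vrel H \<Sigma> (gP aP) (gV aV) (gI aI) (tarr u c)"
        by (rule rel.R_Part[OF op2(1) at a(2) _ refl refl refl]) (simp add: TE_refl)
      from outcome_val[OF conf rel_conv[OF this op2(3)]] op2_part_val(1)[OF op2(1)]
      show "outcome hf H \<Sigma> (gP aP) sP (gV aV) sV (gI aI) sI \<tau>2" by blast
    qed (use op2_ev(2,3)[OF op2(1)] va clv ev_val op2_part_val(1)[OF op2(1)] in blast)+
    ultimately show ?thesis by simp
  next
    case (part t u c cP cV cI gP gV gI yP yV yI)
    from part_apply[OF part(1,2,3) rel_conv[OF a(1) TE_sym[OF part(7)]] a(2) ev[unfolded part(4)] conf]
    obtain wV wI sV' sI' where r: "ev hf (EApp fV aV) sV wV sV'" "ev hf (EApp fI aI) sI wI sI'"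
      "vrel H \<Sigma> w wV wI c" "conf hf H \<Sigma> sP' sV' sI'" unfolding part(5,6) by blast
    from r(1,2,4) rel_conv[OF r(3) part(8)] show ?thesis
      unfolding outcome_def using map_le_refl by blast
  qed
qed

section \<open>Inversion of evaluations into strictly smaller ones\<close>

lemma big_App:
  assumes "big hf n (EApp e1 e2) \<sigma> w \<sigma>'"
  obtains n1 n2 n3 f x b \<sigma>1 v \<sigma>2 where "n1 < n" "n2 < n" "n3 < n"
    "big hf n1 e1 \<sigma> (ERec f x b) \<sigma>1" "big hf n2 e2 \<sigma>1 v \<sigma>2" "big hf n3 (subst f (ERec f x b) (subst x v b)) \<sigma>2 w \<sigma>'"
  using assms
  by (elim big_cases) (simp, (rule that; (assumption | simp))+)

lemma big_TApp:
  assumes "big hf n (ETApp e) \<sigma> w \<sigma>'"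
  obtains n1 n2 b \<sigma>1 where "n1 < n" "n2 < n"
    "big hf n1 e \<sigma> (ETLam b) \<sigma>1" "big hf n2 b \<sigma>1 w \<sigma>'"
  using assms
  by (elim big_cases) (simp, (rule that; (assumption | simp))+)

lemma big_Pack:
  assumes "big hf n (EPack e) \<sigma> w \<sigma>'" "\<not> is_val (EPack e)"
  obtains n1 v where "n1 < n"
    "big hf n1 e \<sigma> v \<sigma>'" "w = EPack v"
  using assms
  by (elim big_cases) (simp, (rule that; (assumption | simp))+)

lemma big_Unpack:
  assumes "big hf n (EUnpack e x e2) \<sigma> w \<sigma>'"
  obtains n1 n2 v \<sigma>1 where "n1 < n" "n2 < n"
    "big hf n1 e \<sigma> (EPack v) \<sigma>1" "big hf n2 (subst x v e2) \<sigma>1 w \<sigma>'"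
  using assms
  by (elim big_cases) (simp, (rule that; (assumption | simp))+)

lemma big_Fold:
  assumes "big hf n (EFold e) \<sigma> w \<sigma>'" "\<not> is_val (EFold e)"
  obtains n1 v where "n1 < n"
    "big hf n1 e \<sigma> v \<sigma>'" "w = EFold v"
  using assms
  by (elim big_cases) (simp, (rule that; (assumption | simp))+)

lemma big_Unfold:
  assumes "big hf n (EUnfold e) \<sigma> w \<sigma>'"
  obtains n1  where "n1 < n"
    "big hf n1 e \<sigma> (EFold w) \<sigma>'"
  using assms
  by (elim big_cases) (simp, (rule that; (assumption | simp))+)

lemma big_Bin:
  assumes "big hf n (EBin op e1 e2) \<sigma> w \<sigma>'"
  obtains n1 n2 v1 v2 \<sigma>1 where "n1 < n" "n2 < n"
    "big hf n1 e1 \<sigma> v1 \<sigma>1" "big hf n2 e2 \<sigma>1 v2 \<sigma>'" "bin_eval op v1 v2 = Some w"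
  using assms
  by (elim big_cases) (simp, (rule that; (assumption | simp))+)

lemma big_Un:
  assumes "big hf n (EUn uop e) \<sigma> w \<sigma>'"
  obtains n1 v where "n1 < n"
    "big hf n1 e \<sigma> v \<sigma>'" "un_eval uop v = Some w"
  using assms
  by (elim big_cases) (simp, (rule that; (assumption | simp))+)

lemma big_Substr:
  assumes "big hf n (ESubstr e1 e2 e3) \<sigma> w \<sigma>'"
  obtains n1 n2 n3 s a b \<sigma>1 \<sigma>2 where "n1 < n" "n2 < n" "n3 < n"
    "big hf n1 e1 \<sigma> (EStr s) \<sigma>1" "big hf n2 e2 \<sigma>1 (EInt a) \<sigma>2" "big hf n3 e3 \<sigma>2 (EInt b) \<sigma>'" "w = EStr (take (nat b) (drop (nat a) s))"
  using assms
  by (elim big_cases) (simp, (rule that; (assumption | simp))+)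

lemma big_If:
  assumes "big hf n (EIf e e1 e2) \<sigma> w \<sigma>'"
  obtains (true) n1 n2 \<sigma>1 where "n1 < n" "n2 < n" "big hf n1 e \<sigma> (EBool True) \<sigma>1" "big hf n2 e1 \<sigma>1 w \<sigma>'"
  | (false) n1 n2 \<sigma>1 where "n1 < n" "n2 < n" "big hf n1 e \<sigma> (EBool False) \<sigma>1" "big hf n2 e2 \<sigma>1 w \<sigma>'"
  using assms
  by (elim big_cases) (simp, (rule true; (assumption | simp)), (rule false; (assumption | simp)))

lemma big_Pair:
  assumes "big hf n (EPair e1 e2) \<sigma> w \<sigma>'" "\<not> is_val (EPair e1 e2)"
  obtains n1 n2 v1 v2 \<sigma>1 where "n1 < n" "n2 < n"
    "big hf n1 e1 \<sigma> v1 \<sigma>1" "big hf n2 e2 \<sigma>1 v2 \<sigma>'" "w = EPair v1 v2"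
  using assms
  by (elim big_cases) (simp, (rule that; (assumption | simp))+)

lemma big_Fst:
  assumes "big hf n (EFst e) \<sigma> w \<sigma>'"
  obtains n1 v where "n1 < n"
    "big hf n1 e \<sigma> (EPair w v) \<sigma>'"
  using assms
  by (elim big_cases) (simp, (rule that; (assumption | simp))+)

lemma big_Snd:
  assumes "big hf n (ESnd e) \<sigma> w \<sigma>'"
  obtains n1 v where "n1 < n"
    "big hf n1 e \<sigma> (EPair v w) \<sigma>'"
  using assms
  by (elim big_cases) (simp, (rule that; (assumption | simp))+)

lemma big_InjL:
  assumes "big hf n (EInjL e) \<sigma> w \<sigma>'" "\<not> is_val (EInjL e)"
  obtains n1 v where "n1 < n"
    "big hf n1 e \<sigma> v \<sigma>'" "w = EInjL v"
  using assms
  by (elim big_cases) (simp, (rule that; (assumption | simp))+)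

lemma big_InjR:
  assumes "big hf n (EInjR e) \<sigma> w \<sigma>'" "\<not> is_val (EInjR e)"
  obtains n1 v where "n1 < n"
    "big hf n1 e \<sigma> v \<sigma>'" "w = EInjR v"
  using assms
  by (elim big_cases) (simp, (rule that; (assumption | simp))+)

lemma big_Alloc:
  assumes "big hf n (EAlloc e) \<sigma> w \<sigma>'"
  obtains n1 v m h i l where "n1 < n"
    "big hf n1 e \<sigma> v (m, h, i)" "m l = None" "w = ELoc l" "\<sigma>' = (m(l \<mapsto> v), h, i)"
  using assms
  by (elim big_cases) (simp, (rule that; (assumption | simp))+)

lemma big_Load:
  assumes "big hf n (ELoad e) \<sigma> w \<sigma>'"
  obtains n1 n2 u m h i l where "n1 < n" "n2 < n"
    "big hf n1 e \<sigma> (ELoc l) (m, h, i)" "big hf n2 u (m, h, i) w \<sigma>'" "m l = Some u"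
  using assms
  by (elim big_cases) (simp, (rule that; (assumption | simp))+)

lemma big_Store:
  assumes "big hf n (EStore e1 e2) \<sigma> w \<sigma>'"
  obtains n1 n2 v m h i l \<sigma>1 where "n1 < n" "n2 < n"
    "big hf n1 e1 \<sigma> (ELoc l) \<sigma>1" "big hf n2 e2 \<sigma>1 v (m, h, i)" "w = EUnit" "\<sigma>' = (m(l \<mapsto> v), h, i)"
  using assms
  by (elim big_cases) (simp, (rule that; (assumption | simp))+)

lemma big_Hash:
  assumes "big hf n (EHash e) \<sigma> w \<sigma>'"
  obtains n1 s m h i where "n1 < n"
    "big hf n1 e \<sigma> (EStr s) (m, h, i)" "w = EStr (hf i s)" "\<sigma>' = (m, insert s h, i)"
  using assms
  by (elim big_cases) (simp, (rule that; (assumption | simp))+)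

lemma big_Case:
  assumes "big hf n (ECase e x1 e1 x2 e2) \<sigma> w \<sigma>'"
  obtains (inl) n1 n2 v \<sigma>1 where "n1 < n" "n2 < n" "big hf n1 e \<sigma> (EInjL v) \<sigma>1" "big hf n2 (subst x1 v e1) \<sigma>1 w \<sigma>'"
  | (inr) n1 n2 v \<sigma>1 where "n1 < n" "n2 < n" "big hf n1 e \<sigma> (EInjR v) \<sigma>1" "big hf n2 (subst x2 v e2) \<sigma>1 w \<sigma>'"
  using assms
  by (elim big_cases) (simp, (rule inl; (assumption | simp)), (rule inr; (assumption | simp)))

text \<open>After a beta step the evaluated term is a substitution instance and no subterm, so
  induction on the relation would not do; the evaluation size decreases, and related terms remain
  related by \<open>rel_beta\<close>.\<close>

lemma sim:
  "big hf n eP sP vP sP' \<Longrightarrow> vrel H \<Sigma> eP eV eI \<tau> \<Longrightarrow> conf hf H \<Sigma> sP sV sI \<Longrightarrow>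
   outcome hf H \<Sigma> vP sP' eV sV eI sI \<tau>"
proof (induction n arbitrary: eP sP vP sP' \<Sigma> eV eI \<tau> sV sI rule: less_induct)
  case (less n)
  show ?case
  proof (cases "is_val eP")
    case True
    \<comment> \<open>This settles all literals, closures and library values together. What remains
      are computations and constructors with an unevaluated argument.\<close>
    with big_val_cong[OF True less.prems(1)] less.prems show ?thesis by (simp add: outcome_val)
  next
    case False
    note prems = less.prems(1,3)
    from less.prems(2) False show ?thesis
    proof (cases rule: rel.cases)
      case (R_App fP fV fI \<tau>1 \<tau>2 aP aV aI)
      from prems(1)[unfolded R_App(1)] obtain n1 n2 n3 f x b \<sigma>1 u \<sigma>2 where
        n: "n1 < n" "n2 < n" "n3 < n" and b: "big hf n1 fP sP (ERec f x b) \<sigma>1" "big hf n2 aP \<sigma>1 u \<sigma>2"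
        "big hf n3 (subst f (ERec f x b) (subst x u b)) \<sigma>2 vP sP'"
        by (rule big_App)
      have "outcome hf H \<Sigma> vP sP' (EApp fV aV) sV (EApp fI aI) sI \<tau>2"
      proof (rule outcome_bind[OF less.IH[OF n(1) b(1) R_App(4) prems(2)], where FV = "FAppL aV" and FI = "FAppL aI", simplified], goal_cases)
        case (1 \<Sigma>1 wV sV1 wI sI1)
        show ?case
        proof (rule outcome_bind[OF less.IH[OF n(2) b(2) rel_store_mono[OF R_App(5) 1(1)] 1(5)], where FV = "FAppR wV" and FI = "FAppR wI", simplified])
          fix \<Sigma>2 uV sV2 uI sI2
          assume 2: "\<Sigma>1 \<subseteq>\<^sub>m \<Sigma>2" "vrel H \<Sigma>2 u uV uI \<tau>1" "conf hf H \<Sigma>2 \<sigma>2 sV2 sI2"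
          show "outcome hf H \<Sigma>2 vP sP' (EApp wV uV) sV2 (EApp wI uI) sI2 \<tau>2"
            by (rule apply_sim[OF less.IH[OF n(3) _ _ 2(3)] b(3) rel_store_mono[OF 1(2) 2(1)] 2(2) big_is_val[OF b(2)] 2(3)])
        qed (simp_all add: frame_ok_def 1)
      qed (simp_all add: frame_ok_def)
      then show ?thesis unfolding R_App(2,3) by (rule outcome_conv) (rule R_App(6))
    next
      case (R_TApp eP eV eI \<kappa> F \<sigma>)
      from prems(1)[unfolded R_TApp(1)] obtain n1 n2 b \<sigma>1 where
        n: "n1 < n" "n2 < n" and b: "big hf n1 eP sP (ETLam b) \<sigma>1" "big hf n2 b \<sigma>1 vP sP'"
        by (rule big_TApp)
      show ?thesis unfolding R_TApp(2,3)
      proof (rule outcome_bind[OF less.IH[OF n(1) b(1) R_TApp(4) prems(2)], where FV = "FTApp" and FI = "FTApp", simplified], goal_cases)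
        case (1 \<Sigma>1 wV sV1 wI sI1)
        note v = big_is_val[OF b(1)]
        show ?case
          using 1(2) is_val.simps(4)[of b, THEN iffD2, OF TrueI]
        proof (cases rule: canon_forall)
          case (1 bP bV bI)
          with b(2) have "big hf n2 bP \<sigma>1 vP sP'" by simp
          from less.IH[OF n(2) this rel_conv[OF 1(4) R_TApp(5)] \<open>conf hf H \<Sigma>1 \<sigma>1 sV1 sI1\<close>]
          show ?thesis by (rule outcome_red) (simp_all add: 1 ev_simps)
        qed
      qed (simp_all add: frame_ok_def)
    next
      case (R_Pack eP eV eI F \<sigma> \<kappa>)
      from prems(1)[unfolded R_Pack(1)] False[unfolded R_Pack(1)] obtain n1 v where
        n: "n1 < n" and b: "big hf n1 eP sP v sP'" "vP = EPack v"
        by (rule big_Pack)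
      show ?thesis unfolding R_Pack(2,3) b(2)
        by (rule outcome_con[OF less.IH[OF n b(1) R_Pack(4) prems(2)], where F = FPack, simplified])
          (simp_all add: frame_ok_def big_is_val[OF b(1)] rel.R_Pack[OF _ R_Pack(5)])
    next
      case (R_Fold eP eV eI F \<kappa> args)
      from prems(1)[unfolded R_Fold(1)] False[unfolded R_Fold(1)] obtain n1 v where
        n: "n1 < n" and b: "big hf n1 eP sP v sP'" "vP = EFold v"
        by (rule big_Fold)
      show ?thesis unfolding R_Fold(2,3) b(2)
        by (rule outcome_con[OF less.IH[OF n b(1) R_Fold(4) prems(2)], where F = FFold, simplified])
          (simp_all add: frame_ok_def big_is_val[OF b(1)] rel.R_Fold[OF _ R_Fold(5)])
    next
      case (R_InjL eP eV eI \<tau>1 \<tau>2)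
      from prems(1)[unfolded R_InjL(1)] False[unfolded R_InjL(1)] obtain n1 v where
        n: "n1 < n" and b: "big hf n1 eP sP v sP'" "vP = EInjL v"
        by (rule big_InjL)
      show ?thesis unfolding R_InjL(2,3) b(2)
        by (rule outcome_con[OF less.IH[OF n b(1) R_InjL(4) prems(2)], where F = FInjL, simplified])
          (simp_all add: frame_ok_def big_is_val[OF b(1)] rel.R_InjL[OF _ R_InjL(5)])
    next
      case (R_InjR eP eV eI \<tau>2 \<tau>1)
      from prems(1)[unfolded R_InjR(1)] False[unfolded R_InjR(1)] obtain n1 v where
        n: "n1 < n" and b: "big hf n1 eP sP v sP'" "vP = EInjR v"
        by (rule big_InjR)
      show ?thesis unfolding R_InjR(2,3) b(2)
        by (rule outcome_con[OF less.IH[OF n b(1) R_InjR(4) prems(2)], where F = FInjR, simplified])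
          (simp_all add: frame_ok_def big_is_val[OF b(1)] rel.R_InjR[OF _ R_InjR(5)])
    next
      case (R_Unfold eP eV eI \<kappa> F args)
      from prems(1)[unfolded R_Unfold(1)] obtain n1 where
        n: "n1 < n" and b: "big hf n1 eP sP (EFold vP) sP'"
        by (rule big_Unfold)
      show ?thesis unfolding R_Unfold(2,3)
      proof (rule outcome_bind[OF less.IH[OF n(1) b(1) R_Unfold(4) prems(2)], where FV = "FUnfold" and FI = "FUnfold", simplified], goal_cases)
        case (1 \<Sigma>1 wV sV1 wI sI1)
        note v = big_is_val[OF b(1)]
        show ?case
          using 1(2) v
        proof (cases rule: canon_mu)
          case (1 uP uV uI)
          with v have "is_val vP" "is_val uV" "is_val uI" using rel_val[OF 1(4)] by simp_all
          from outcome_val[OF \<open>conf hf H \<Sigma>1 sP' sV1 sI1\<close> rel_conv[OF 1(4) R_Unfold(5)]] 1 this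
          have "outcome hf H \<Sigma>1 vP sP' uV sV1 uI sI1 \<tau>" by simp
          then show ?thesis
            by (rule outcome_red) (use 1 \<open>is_val uV\<close> \<open>is_val uI\<close> in \<open>simp_all add: ev_simps ev_constr\<close>)
        qed
      qed (simp_all add: frame_ok_def)
    next
      case (R_Fst eP eV eI \<tau>1 \<tau>2)
      from prems(1)[unfolded R_Fst(1)] obtain n1 u where
        n: "n1 < n" and b: "big hf n1 eP sP (EPair vP u) sP'"
        by (rule big_Fst)
      show ?thesis unfolding R_Fst(2,3)
      proof (rule outcome_bind[OF less.IH[OF n(1) b(1) R_Fst(4) prems(2)], where FV = "FFst" and FI = "FFst", simplified], goal_cases)
        case (1 \<Sigma>1 wV sV1 wI sI1)
        note v = big_is_val[OF b(1)]
        show ?case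
          using 1(2) v
        proof (cases rule: canon_prod)
          case (1 uP uV uI tP tV tI)
          with \<open>is_val wV\<close> \<open>is_val wI\<close> v have w: "is_val vP" "is_val uV" "is_val uI" "is_val tV" "is_val tI" by simp_all
          from outcome_val[OF \<open>conf hf H \<Sigma>1 sP' sV1 sI1\<close> rel_conv[OF 1(4) R_Fst(5)]] 1 w
          have "outcome hf H \<Sigma>1 vP sP' uV sV1 uI sI1 \<tau>" by simp
          then show ?thesis
            by (rule outcome_red) (use 1 w in \<open>simp_all add: ev_simps ev_constr ev_val\<close>)
        qed
      qed (simp_all add: frame_ok_def)
    next
      case (R_Snd eP eV eI \<tau>1 \<tau>2)
      from prems(1)[unfolded R_Snd(1)] obtain n1 u where
        n: "n1 < n" and b: "big hf n1 eP sP (EPair u vP) sP'"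
        by (rule big_Snd)
      show ?thesis unfolding R_Snd(2,3)
      proof (rule outcome_bind[OF less.IH[OF n(1) b(1) R_Snd(4) prems(2)], where FV = "FSnd" and FI = "FSnd", simplified], goal_cases)
        case (1 \<Sigma>1 wV sV1 wI sI1)
        note v = big_is_val[OF b(1)]
        show ?case
          using 1(2) v
        proof (cases rule: canon_prod)
          case (1 tP tV tI uP uV uI)
          with \<open>is_val wV\<close> \<open>is_val wI\<close> v have w: "is_val vP" "is_val uV" "is_val uI" "is_val tV" "is_val tI" by simp_all
          from outcome_val[OF \<open>conf hf H \<Sigma>1 sP' sV1 sI1\<close> rel_conv[OF 1(5) R_Snd(5)]] 1 w
          have "outcome hf H \<Sigma>1 vP sP' uV sV1 uI sI1 \<tau>" by simp
          then show ?thesis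
            by (rule outcome_red) (use 1 w in \<open>simp_all add: ev_simps ev_constr ev_val\<close>)
        qed
      qed (simp_all add: frame_ok_def)
    next
      case (R_Un uop \<tau>1 \<tau>0 eP eV eI)
      from prems(1)[unfolded R_Un(1)] obtain n1 v where
        n: "n1 < n" and b: "big hf n1 eP sP v sP'" "un_eval uop v = Some vP"
        by (rule big_Un)
      show ?thesis unfolding R_Un(2,3)
      proof (rule outcome_bind[OF less.IH[OF n(1) b(1) R_Un(5) prems(2)], where FV = "FUn uop" and FI = "FUn uop", simplified], goal_cases)
        case (1 \<Sigma>1 wV sV1 wI sI1)
        note v = big_is_val[OF b(1)]
        show ?case
        proof (rule outcome_red)
          note u = unop_rel[OF R_Un(4) 1(2) v b(2)]
          then show "outcome hf H \<Sigma>1 vP sP' vP sV1 vP sI1 \<tau>"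
            by (intro outcome_val[OF 1(5)] rel_conv[OF _ R_Un(6)]) (auto intro: un_eval_val)
        qed (use unop_rel[OF R_Un(4) 1(2) v b(2)] 1(3,4) un_eval_val[OF b(2)] in \<open>simp_all add: ev_simps ev_val\<close>)
      qed (simp_all add: frame_ok_def)
    next
      case (R_Hash eP eV eI)
      from prems(1)[unfolded R_Hash(1)] obtain n1 s m h i where
        n: "n1 < n" and b: "big hf n1 eP sP (EStr s) (m, h, i)" "vP = EStr (hf i s)" "sP' = (m, insert s h, i)"
        by (rule big_Hash)
      show ?thesis unfolding R_Hash(2,3)
      proof (rule outcome_bind[OF less.IH[OF n(1) b(1) R_Hash(4) prems(2)], where FV = "FHash" and FI = "FHash", simplified], goal_cases)
        case (1 \<Sigma>1 wV sV1 wI sI1)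
        note v = big_is_val[OF b(1)]
        show ?case
        proof -
          from canon_str[OF 1(2)] have w: "wV = EStr s" "wI = EStr s" by auto
          from 1(5) obtain mV hV mI hI where st: "sV1 = (mV, hV, i)" "sI1 = (mI, hI, i)" "hf i = H"
            "\<And>hP hV hI. conf hf H \<Sigma>1 (m, hP, i) (mV, hV, i) (mI, hI, i)" by (rule conf_hash) blast
          have "outcome hf H \<Sigma>1 vP sP' (EStr (H s)) (mV, insert s hV, i) (EStr (H s)) (mI, insert s hI, i) \<tau>"
            unfolding b(2,3) st(3) by (rule outcome_val[OF st(4)]) (simp_all add: rel.R_Str R_Hash(5))
          then show ?thesis unfolding outcome_def w st(1,2)
            by (simp add: ev_simps st(3))
        qed
      qed (simp_all add: frame_ok_def)
    next
      case (R_Alloc eP eV eI \<tau>0)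
      from prems(1)[unfolded R_Alloc(1)] obtain n1 v m h i l where
        n: "n1 < n" and b: "big hf n1 eP sP v (m, h, i)" "m l = None" "vP = ELoc l" "sP' = (m(l \<mapsto> v), h, i)"
        by (rule big_Alloc)
      show ?thesis unfolding R_Alloc(2,3)
      proof (rule outcome_bind[OF less.IH[OF n(1) b(1) R_Alloc(4) prems(2)], where FV = "FAlloc" and FI = "FAlloc", simplified], goal_cases)
        case (1 \<Sigma>1 wV sV1 wI sI1)
        note v = big_is_val[OF b(1)]
        show ?case
          using 1(5) b(2) 1(2) v
        proof (rule conf_alloc)
          fix mV hV mI hI
          assume c: "sV1 = (mV, hV, i)" "sI1 = (mI, hI, i)" "mV l = None" "mI l = None" "\<Sigma>1 \<subseteq>\<^sub>m \<Sigma>1(l \<mapsto> \<tau>0)"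
            "conf hf H (\<Sigma>1(l \<mapsto> \<tau>0)) (m(l \<mapsto> v), h, i) (mV(l \<mapsto> wV), hV, i) (mI(l \<mapsto> wI), hI, i)"
          have "ev hf (EAlloc wV) sV1 (ELoc l) (mV(l \<mapsto> wV), hV, i)" "ev hf (EAlloc wI) sI1 (ELoc l) (mI(l \<mapsto> wI), hI, i)"
            using c(3,4) 1(3,4) by (auto simp: ev_simps ev_val c(1,2))
          moreover have "rel H (\<Sigma>1(l \<mapsto> \<tau>0)) Map.empty vP (ELoc l) (ELoc l) \<tau>"
            unfolding b(3) by (rule rel.R_Loc[OF _ R_Alloc(5)]) simp
          ultimately show ?thesis using c(5,6) unfolding outcome_def b(4) by blast
        qed
      qed (simp_all add: frame_ok_def)
    next
      case (R_Load eP eV eI \<tau>0)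
      from prems(1)[unfolded R_Load(1)] obtain n1 n2 u m h i l where
        n: "n1 < n" "n2 < n" and b: "big hf n1 eP sP (ELoc l) (m, h, i)" "big hf n2 u (m, h, i) vP sP'" "m l = Some u"
        by (rule big_Load)
      show ?thesis unfolding R_Load(2,3)
      proof (rule outcome_bind[OF less.IH[OF n(1) b(1) R_Load(4) prems(2)], where FV = "FLoad" and FI = "FLoad", simplified], goal_cases)
        case (1 \<Sigma>1 wV sV1 wI sI1)
        note v = big_is_val[OF b(1)]
        show ?case
          using 1(2) v
        proof (cases rule: canon_ref)
          case (1 l' \<tau>1)
          note r = this
          from \<open>conf hf H \<Sigma>1 (m, h, i) sV1 sI1\<close> r(4) show ?thesis
          proof (rule conf_load)
            fix mV hV mI hI uP uV uI
            assume c: "sV1 = (mV, hV, i)" "sI1 = (mI, hI, i)" "m l' = Some uP" "mV l' = Some uV" "mI l' = Some uI"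
              "is_val uP" "vrel H \<Sigma>1 uP uV uI \<tau>1"
            \<comment> \<open>Related heaps hold values in typed cells, so evaluating the loaded
              content changes nothing.\<close>
            have u: "u = uP" using b(3) c(3) r(1) by simp
            with big_val_cong[OF c(6)] b(2) have p: "vP = uP" "sP' = (m, h, i)" by blast+
            from outcome_val[OF \<open>conf hf H \<Sigma>1 (m, h, i) sV1 sI1\<close> rel_conv[OF rel_conv[OF c(7) r(5)] R_Load(5)] c(6)]
            have "outcome hf H \<Sigma>1 vP sP' uV sV1 uI sI1 \<tau>" unfolding p .
            then show ?thesis
              by (rule outcome_red) (simp_all add: r c ev_simps)
          qed
        qed
      qed (simp_all add: frame_ok_def)
    next
      case (R_Unpack eP eV eI \<kappa> F x bP bV bI)
      from prems(1)[unfolded R_Unpack(1)] obtain n1 n2 v \<sigma>1 where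
        n: "n1 < n" "n2 < n" and b: "big hf n1 eP sP (EPack v) \<sigma>1" "big hf n2 (subst x v bP) \<sigma>1 vP sP'"
        by (rule big_Unpack)
      show ?thesis unfolding R_Unpack(2,3)
      proof (rule outcome_bind[OF less.IH[OF n(1) b(1) R_Unpack(4) prems(2)], where FV = "FUnpack x bV" and FI = "FUnpack x bI", simplified], goal_cases)
        case (1 \<Sigma>1 wV sV1 wI sI1)
        note v = big_is_val[OF b(1)]
        show ?case
          using 1(2) v
        proof (cases rule: canon_exists)
          case (1 uP uV uI \<sigma>)
          have w: "is_val uV" "is_val uI" using \<open>is_val wV\<close> \<open>is_val wI\<close> 1 by simp_all
          from 1 have "v = uP" by simp
          with b(2) have b2: "big hf n2 (subst x uP bP) \<sigma>1 vP sP'" by simp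
          \<comment> \<open>The bodies are related for every type of the unpacked variable, in
            particular for the witness \<open>\<sigma>\<close> hidden in the package.\<close>
          from less.IH[OF n(2) this rel_subst1[OF rel_store_mono[OF R_Unpack(5) \<open>\<Sigma> \<subseteq>\<^sub>m \<Sigma>1\<close>] 1(4)] \<open>conf hf H \<Sigma>1 \<sigma>1 sV1 sI1\<close>]
          show ?thesis by (rule outcome_red) (use w in \<open>simp_all add: 1 ev_simps ev_constr ev_val\<close>)
        qed
      qed (simp_all add: frame_ok_def)
    next
      case (R_If eP eV eI aP aV aI bP bV bI)
      from prems(1)[unfolded R_If(1)] show ?thesis
      proof (cases rule: big_If)
        case (true n1 n2 \<sigma>1)
        show ?thesis unfolding R_If(2,3)
        proof (rule outcome_bind[OF less.IH[OF true(1) true(3) R_If(4) prems(2)], where FV = "FIf aV bV" and FI = "FIf aI bI", simplified], goal_cases)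
          case (1 \<Sigma>1 wV sV1 wI sI1)
          note v = big_is_val[OF true(3)]
          show ?case
          proof -
            from canon_bool[OF 1(2)] have w: "wV = EBool True" "wI = EBool True" by auto
            show ?thesis
              by (rule outcome_red[OF less.IH[OF true(2,4) rel_store_mono[OF R_If(5) 1(1)] 1(5)]])
                (simp_all add: w ev_simps)
          qed
        qed (simp_all add: frame_ok_def)
      next
        case (false n1 n2 \<sigma>1)
        show ?thesis unfolding R_If(2,3)
        proof (rule outcome_bind[OF less.IH[OF false(1) false(3) R_If(4) prems(2)], where FV = "FIf aV bV" and FI = "FIf aI bI", simplified], goal_cases)
          case (1 \<Sigma>1 wV sV1 wI sI1)
          note v = big_is_val[OF false(3)]
          show ?case
          proof -
            from canon_bool[OF 1(2)] have w: "wV = EBool False" "wI = EBool False" by auto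
            show ?thesis
              by (rule outcome_red[OF less.IH[OF false(2,4) rel_store_mono[OF R_If(6) 1(1)] 1(5)]])
                (simp_all add: w ev_simps)
          qed
        qed (simp_all add: frame_ok_def)
      qed
    next
      case (R_Case eP eV eI \<tau>1 \<tau>2 x1 aP aV aI x2 bP bV bI)
      from prems(1)[unfolded R_Case(1)] show ?thesis
      proof (cases rule: big_Case)
        case (inl n1 n2 v0 \<sigma>1)
        show ?thesis unfolding R_Case(2,3)
        proof (rule outcome_bind[OF less.IH[OF inl(1) inl(3) R_Case(4) prems(2)], where FV = "FCase x1 aV x2 bV" and FI = "FCase x1 aI x2 bI", simplified], goal_cases)
          case (1 \<Sigma>1 wV sV1 wI sI1)
          note v = big_is_val[OF inl(3)]
          show ?case
            using 1(2) v
          proof (cases rule: canon_sum)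
            case (inl uP uV uI)
            note u = this
            have w: "is_val uV" "is_val uI" using \<open>is_val wV\<close> \<open>is_val wI\<close> u by simp_all
            from u(1) have "v0 = uP" by simp
            with \<open>big hf n2 (subst x1 v0 aP) \<sigma>1 vP sP'\<close> have b2: "big hf n2 (subst x1 uP aP) \<sigma>1 vP sP'" by simp
            from less.IH[OF \<open>n2 < n\<close> b2 rel_subst1[OF rel_store_mono[OF R_Case(5) 1(1)] u(4)] 1(5)]
            show ?thesis by (rule outcome_red) (use w in \<open>auto simp: u ev_simps ev_constr ev_val\<close>)
          qed simp
        qed (simp_all add: frame_ok_def)
      next
        case (inr n1 n2 v0 \<sigma>1)
        show ?thesis unfolding R_Case(2,3)
        proof (rule outcome_bind[OF less.IH[OF inr(1) inr(3) R_Case(4) prems(2)], where FV = "FCase x1 aV x2 bV" and FI = "FCase x1 aI x2 bI", simplified], goal_cases)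
          case (1 \<Sigma>1 wV sV1 wI sI1)
          note v = big_is_val[OF inr(3)]
          show ?case
            using 1(2) v
          proof (cases rule: canon_sum)
            case (inr uP uV uI)
            note u = this
            have w: "is_val uV" "is_val uI" using \<open>is_val wV\<close> \<open>is_val wI\<close> u by simp_all
            from u(1) have "v0 = uP" by simp
            with \<open>big hf n2 (subst x2 v0 bP) \<sigma>1 vP sP'\<close> have b2: "big hf n2 (subst x2 uP bP) \<sigma>1 vP sP'" by simp
            from less.IH[OF \<open>n2 < n\<close> b2 rel_subst1[OF rel_store_mono[OF R_Case(6) 1(1)] u(4)] 1(5)]
            show ?thesis by (rule outcome_red) (use w in \<open>auto simp: u ev_simps ev_constr ev_val\<close>)
          qed simp
        qed (simp_all add: frame_ok_def)
      qed
    next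
      case (R_Bin op \<tau>1 \<tau>2 \<tau>0 eP eV eI aP aV aI)
      from prems(1)[unfolded R_Bin(1)] obtain n1 n2 v1 v2 \<sigma>1 where
        n: "n1 < n" "n2 < n" and b: "big hf n1 eP sP v1 \<sigma>1" "big hf n2 aP \<sigma>1 v2 sP'" "bin_eval op v1 v2 = Some vP"
        by (rule big_Bin)
      show ?thesis unfolding R_Bin(2,3)
      proof (rule outcome_bind[OF less.IH[OF n(1) b(1) R_Bin(5) prems(2)], where FV = "FBinL op aV" and FI = "FBinL op aI", simplified], goal_cases)
        case (1 \<Sigma>1 wV sV1 wI sI1)
        show ?case
        proof (rule outcome_bind[OF less.IH[OF n(2) b(2) rel_store_mono[OF R_Bin(6) 1(1)] 1(5)], where FV = "FBinR op wV" and FI = "FBinR op wI", simplified], goal_cases)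
          case 2: (1 \<Sigma>2 uV sV2 uI sI2)
          note v = big_is_val[OF b(1)] big_is_val[OF b(2)]
          note w = rel_store_mono[OF 1(2) 2(1)]
          show ?case
          proof -
            from binop_rel[OF R_Bin(4) w v(1) 2(2) v(2) b(3)] have
              u: "bin_eval op wV uV = Some vP" "bin_eval op wI uI = Some vP" "vrel H \<Sigma>2 vP vP vP \<tau>0" by auto
            show ?thesis
              by (rule outcome_red[OF outcome_val[OF 2(5) rel_conv[OF u(3) R_Bin(7)] bin_eval_val[OF b(3)]]])
                (simp_all add: ev_simps ev_val[OF 1(3)] ev_val[OF 1(4)] ev_val[OF 2(3)] ev_val[OF 2(4)]
                  ev_val[OF bin_eval_val[OF b(3)]] u(1,2))
          qed
        qed (simp_all add: frame_ok_def 1)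
      qed (simp_all add: frame_ok_def)
    next
      case (R_Pair eP eV eI \<tau>1 aP aV aI \<tau>2)
      from prems(1)[unfolded R_Pair(1)] False[unfolded R_Pair(1)] obtain n1 n2 v1 v2 \<sigma>1 where
        n: "n1 < n" "n2 < n" and b: "big hf n1 eP sP v1 \<sigma>1" "big hf n2 aP \<sigma>1 v2 sP'" "vP = EPair v1 v2"
        by (rule big_Pair)
      show ?thesis unfolding R_Pair(2,3)
      proof (rule outcome_bind[OF less.IH[OF n(1) b(1) R_Pair(4) prems(2)], where FV = "FPairL aV" and FI = "FPairL aI", simplified], goal_cases)
        case (1 \<Sigma>1 wV sV1 wI sI1)
        show ?case
        proof (rule outcome_bind[OF less.IH[OF n(2) b(2) rel_store_mono[OF R_Pair(5) 1(1)] 1(5)], where FV = "FPairR wV" and FI = "FPairR wI", simplified], goal_cases)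
          case 2: (1 \<Sigma>2 uV sV2 uI sI2)
          note v = big_is_val[OF b(1)] big_is_val[OF b(2)]
          note w = rel_store_mono[OF 1(2) 2(1)]
          show ?case
            unfolding b(3) by (rule outcome_val[OF 2(5) rel.R_Pair[OF w 2(2) R_Pair(6)]]) (simp add: v)
        qed (simp_all add: frame_ok_def 1)
      qed (simp_all add: frame_ok_def)
    next
      case (R_Store eP eV eI \<tau>0 aP aV aI)
      from prems(1)[unfolded R_Store(1)] obtain n1 n2 v2 m h i l \<sigma>1 where
        n: "n1 < n" "n2 < n" and b: "big hf n1 eP sP (ELoc l) \<sigma>1" "big hf n2 aP \<sigma>1 v2 (m, h, i)" "vP = EUnit" "sP' = (m(l \<mapsto> v2), h, i)"
        by (rule big_Store)
      show ?thesis unfolding R_Store(2,3)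
      proof (rule outcome_bind[OF less.IH[OF n(1) b(1) R_Store(4) prems(2)], where FV = "FStoreL aV" and FI = "FStoreL aI", simplified], goal_cases)
        case (1 \<Sigma>1 wV sV1 wI sI1)
        show ?case
        proof (rule outcome_bind[OF less.IH[OF n(2) b(2) rel_store_mono[OF R_Store(5) 1(1)] 1(5)], where FV = "FStoreR wV" and FI = "FStoreR wI", simplified], goal_cases)
          case 2: (1 \<Sigma>2 uV sV2 uI sI2)
          note v = big_is_val[OF b(1)] big_is_val[OF b(2)]
          note w = rel_store_mono[OF 1(2) 2(1)]
          show ?case
            using w v(1)
          proof (cases rule: canon_ref)
            case (1 l' \<tau>1)
            note r = this
            from 2(5) r(4) show ?thesis
            proof (rule conf_load)
              fix mV hV mI hI xP xV xI
              assume c: "sV2 = (mV, hV, i)" "sI2 = (mI, hI, i)" "mV l' = Some xV" "mI l' = Some xI"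
              have l: "l' = l" using r(1) by simp
              have "conf hf H \<Sigma>2 sP' (mV(l \<mapsto> uV), hV, i) (mI(l \<mapsto> uI), hI, i)"
                unfolding b(4) using 2(5) r(4) rel_conv[OF 2(2) TE_sym[OF r(5)]] v(2) unfolding c l by (rule conf_store)
              from outcome_val[OF this rel.R_Unit[OF R_Store(6)]]
              have "outcome hf H \<Sigma>2 vP sP' EUnit (mV(l \<mapsto> uV), hV, i) EUnit (mI(l \<mapsto> uI), hI, i) \<tau>" unfolding b(3) by simp
              then show ?thesis using c(3,4) 2(3,4) unfolding outcome_def
                by (simp add: ev_simps ev_val r(2,3) c(1,2) l[symmetric])
            qed
          qed
        qed (simp_all add: frame_ok_def 1)
      qed (simp_all add: frame_ok_def)
    next
      case (R_Substr eP eV eI aP aV aI bP bV bI)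
      from prems(1)[unfolded R_Substr(1)] obtain n1 n2 n3 s a b \<sigma>1 \<sigma>2 where
        n: "n1 < n" "n2 < n" "n3 < n" and b: "big hf n1 eP sP (EStr s) \<sigma>1" "big hf n2 aP \<sigma>1 (EInt a) \<sigma>2"
        "big hf n3 bP \<sigma>2 (EInt b) sP'" "vP = EStr (take (nat b) (drop (nat a) s))"
        by (rule big_Substr)
      show ?thesis unfolding R_Substr(2,3)
      proof (rule outcome_bind[OF less.IH[OF n(1) b(1) R_Substr(4) prems(2)], where FV = "FSubstr1 aV bV" and FI = "FSubstr1 aI bI", simplified], goal_cases)
        case (1 \<Sigma>1 wV sV1 wI sI1)
        show ?case
        proof (rule outcome_bind[OF less.IH[OF n(2) b(2) rel_store_mono[OF R_Substr(5) 1(1)] 1(5)], where FV = "FSubstr2 wV bV" and FI = "FSubstr2 wI bI", simplified], goal_cases)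
          case 2: (1 \<Sigma>2 uV sV2 uI sI2)
          show ?case
          proof (rule outcome_bind[OF less.IH[OF n(3) b(3) rel_store_mono[OF R_Substr(6) map_le_trans[OF 1(1) 2(1)]] 2(5)], where FV = "FSubstr3 wV uV" and FI = "FSubstr3 wI uI", simplified])
            fix \<Sigma>3 tV sV3 tI sI3
            assume 3: "vrel H \<Sigma>3 (EInt b) tV tI tint" "conf hf H \<Sigma>3 sP' sV3 sI3"
            from canon_str[OF 1(2)] canon_int[OF 2(2)] canon_int[OF 3(1)]
            have w: "wV = EStr s" "wI = EStr s" "uV = EInt a" "uI = EInt a" "tV = EInt b" "tI = EInt b" by auto
            have "outcome hf H \<Sigma>3 vP sP' vP sV3 vP sI3 \<tau>"
              unfolding b(4) by (rule outcome_val[OF 3(2) rel.R_Str[OF R_Substr(7)]]) simp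
            then show "outcome hf H \<Sigma>3 vP sP' (ESubstr wV uV tV) sV3 (ESubstr wI uI tI) sI3 \<tau>"
              by (rule outcome_red) (simp_all add: w b(4) ev_simps)
          qed (simp_all add: frame_ok_def 1 2)
        qed (simp_all add: frame_ok_def 1)
      qed (simp_all add: frame_ok_def)
    qed (use False in \<open>auto dest: op1_val op2_val op2_part_val(1) srel_val\<close>)
  qed
qed

subsection \<open>Running authenticated computations\<close>

definition plist :: "string list \<Rightarrow> expr" where
  "plist ss = foldr (\<lambda>s t. consE (EStr s) t) ss nilE"

lemma plist_simps [simp]: "plist [] = nilE" "plist (s # ss) = consE (EStr s) (plist ss)"
  by (simp_all add: plist_def)

lemma is_val_plist [simp]: "is_val (plist ss)"
  by (induction ss) auto

lemma cl_plist [simp]: "cl (plist ss)"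
  by (induction ss) (auto simp: cl_def)

lemma list_inject [simp]:
  "EFold w = nilE \<longleftrightarrow> w = EInjL EUnit" "EFold w = consE a b \<longleftrightarrow> w = EInjR (EPair a b)"
  by (auto simp: nilE_def consE_def)

definition appendAt :: "expr \<Rightarrow> expr" where
  "appendAt l = Lam ''r''
     (ECase (EUnfold l) ''_u'' (V ''r'')
        ''p'' (consE (EFst (V ''p'')) (EApp2 appendE (ESnd (V ''p'')) (V ''r''))))"

lemma is_val_appendAt [simp]: "is_val (appendAt l)"
  by (simp add: appendAt_def)

lemma ev_appendE:
  "is_val l \<Longrightarrow> cl l \<Longrightarrow> ev hf (EApp appendE l) \<sigma> w \<sigma>' \<longleftrightarrow> w = appendAt l \<and> \<sigma>' = \<sigma>"
  by (subst appendE_def, simp add: ev_App_ERec ev_val ev_code appendAt_def)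
    (simp add: appendE_def; rule conj_commute)

lemma ev_append:
  "ev hf (EApp (appendAt (plist xs)) (plist ys)) \<sigma> w \<sigma>' \<longleftrightarrow> w = plist (xs @ ys) \<and> \<sigma>' = \<sigma>"
proof (induction xs arbitrary: w \<sigma>')
  case Nil
  show ?case by (subst appendAt_def) (simp add: sx ev_val; rule conj_commute)
next
  case (Cons x xs)
  then show ?case by (subst appendAt_def) (simp add: sx ev_val ev_appendE; rule conj_commute)
qed

text \<open>The code of bind calls client functions, so its evaluation cannot be computed away; it
  is inverted with sizes to keep the induction hypothesis of \<open>run_sim\<close>
  applicable.\<close>

lemma big_Lam:
  assumes "big hf n (EApp (Lam x b) a) \<sigma> w \<sigma>'"
  obtains n1 n2 v \<sigma>1 where "n1 < n" "n2 < n" "big hf n1 a \<sigma> v \<sigma>1"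
    "big hf n2 (subst '''' (Lam x b) (subst x v b)) \<sigma>1 w \<sigma>'"
  using assms unfolding Lam_def
proof (rule big_App)
  fix n1 n2 n3 f y c \<sigma>1 v \<sigma>2
  assume "n2 < n" "n3 < n" "big hf n1 (ERec '''' x b) \<sigma> (ERec f y c) \<sigma>1" "big hf n2 a \<sigma>1 v \<sigma>2"
    "big hf n3 (subst f (ERec f y c) (subst y v c)) \<sigma>2 w \<sigma>'"
  moreover from big_val_cong[OF _ this(3)] have "f = ''''" "y = x" "c = b" "\<sigma>1 = \<sigma>" by auto
  ultimately show thesis using that by (simp add: Lam_def)
qed

lemma sim_ev:
  assumes "ev hf eP sP vP sP'" "vrel H \<Sigma> eP eV eI \<tau>" "conf hf H \<Sigma> sP sV sI"
  obtains \<Sigma>' vV sV' vI sI' where "\<Sigma> \<subseteq>\<^sub>m \<Sigma>'" "ev hf eV sV vV sV'" "ev hf eI sI vI sI'"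
    "vrel H \<Sigma>' vP vV vI \<tau>" "conf hf H \<Sigma>' sP' sV' sI'"
  using assms sim unfolding ev_def outcome_def by metis

lemmas ev_App_funI = ev_bind[where F = "FAppL a" for a, simplified frame_ok_def fill_frame.simps frame.case, OF _ TrueI]
lemmas ev_App_argI = ev_bind[where F = "FAppR f" for f, simplified frame_ok_def fill_frame.simps frame.case]

text \<open>Here \<open>c\<close> and \<open>f\<close> are arbitrary values whose runs are known
  only through the hypotheses, so the run of bind is assembled from them by hand.\<close>

lemma ev_mbindV:
  assumes "ev hf (EApp c p) \<sigma> (ESome (EPair q a)) \<sigma>1" "ev hf (EApp (EApp f a) q) \<sigma>1 w \<sigma>'"
    and v: "is_val f" "is_val p" "is_val q" "is_val a" and c: "cl c" "cl f" "cl p" "cl q" "cl a"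
  shows "ev hf (EApp (mbindV c f) p) \<sigma> w \<sigma>'"
proof -
  from iffD1[OF ev_App_fun assms(2)] obtain g \<sigma>2 where
    g: "ev hf (EApp f a) \<sigma>1 g \<sigma>2" "ev hf (EApp g q) \<sigma>2 w \<sigma>'" unfolding is_val.simps by blast
  have "ev hf (EApp f (ESnd (EPair q a))) \<sigma>1 g \<sigma>2"
    using g(1) by (simp add: ev_App_arg v ev_simps ev_constr ev_val)
  moreover have "ev hf (EApp g (EFst (EPair q a))) \<sigma>2 w \<sigma>'"
    using g(2) by (simp add: ev_App_arg v ev_is_val[OF g(1)] ev_simps ev_constr ev_val)
  ultimately have 1: "ev hf (EApp (EApp f (ESnd (EPair q a))) (EFst (EPair q a))) \<sigma>1 w \<sigma>'"
    by (rule ev_App_funI)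
  have "ev hf (ECase (EApp c p) ''_none'' ENone ''r'' (EApp2 f (ESnd (V ''r'')) (EFst (V ''r'')))) \<sigma> w \<sigma>'"
    unfolding ev_simps(18)
    by (rule exI[of _ "EInjR (EPair q a)"], rule exI[of _ \<sigma>1])
      (use assms(1) 1 c in \<open>simp add: ESome_def EApp2_def\<close>)
  then show ?thesis
    using c v by (simp add: mbindV_def ev_App_Lam ev_val ev_code(8))
qed

lemma ev_mbindI:
  assumes "ev hf (EApp c EUnit) \<sigma> a \<sigma>1" "ev hf (EApp (EApp f a) EUnit) \<sigma>1 w \<sigma>'"
    and v: "is_val f" and c: "cl c" "cl f"
  shows "ev hf (EApp (mbindI c f) EUnit) \<sigma> w \<sigma>'"
proof -
  from iffD1[OF ev_App_fun assms(2)] obtain g \<sigma>2 where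
    g: "ev hf (EApp f a) \<sigma>1 g \<sigma>2" "ev hf (EApp g EUnit) \<sigma>2 w \<sigma>'" unfolding is_val.simps by blast
  have "ev hf (EApp f (EApp c EUnit)) \<sigma> g \<sigma>2"
    by (rule ev_App_argI[OF assms(1) v g(1)])
  from this g(2) have "ev hf (EApp (EApp f (EApp c EUnit)) EUnit) \<sigma> w \<sigma>'"
    by (rule ev_App_funI)
  then show ?thesis
    using c v by (simp add: mbindI_def ev_App_Lam ev_simps(7) ev_code(7))
qed

text \<open>The quantification over the rest \<open>rs\<close> is what makes bind compose: the first
  computation consumes its prefix of the proof and leaves the second one's strings in front of
  \<open>rs\<close>. Value and final state of the verifier are chosen before \<open>rs\<close> and
  do not depend on it.\<close>

lemma run_sim:
  "big hf n (EApp cP EUnit) sP w sP' \<Longrightarrow> vrel H \<Sigma> cP cV cI (tm \<tau>) \<Longrightarrow> is_val cP \<Longrightarrow>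
   conf hf H \<Sigma> sP sV sI \<Longrightarrow>
   \<exists>\<Sigma>' ss aP aV sV' aI sI'. w = EPair (plist ss) aP \<and> is_val aP \<and> \<Sigma> \<subseteq>\<^sub>m \<Sigma>' \<and>
     (\<forall>rs. ev hf (EApp cV (plist (ss @ rs))) sV (ESome (EPair (plist rs) aV)) sV') \<and>
     ev hf (EApp cI EUnit) sI aI sI' \<and> vrel H \<Sigma>' aP aV aI \<tau> \<and> conf hf H \<Sigma>' sP' sV' sI'"
proof (induction n arbitrary: cP sP w sP' \<Sigma> cV cI \<tau> sV sI rule: less_induct)
  case (less n)
  have ev: "ev hf (EApp cP EUnit) sP w sP'" using less.prems(1) by (auto simp: ev_def)
  from less.prems(2,3) show ?case
  proof (cases rule: canon_m)
    case (ret aP aV aI)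
    note v = ret(5) rel_val[OF ret(4,5)] rel_cl[OF ret(4)]
    from ev have w: "w = EPair (plist []) aP" "sP' = sP"
      by (simp_all add: ret mretP_def sx ev_val v)
    have "ev hf (EApp cV (plist ([] @ rs))) sV (ESome (EPair (plist rs) aV)) sV" for rs
      by (simp add: ret mretV_def sx ev_val v)
    moreover have "ev hf (EApp cI EUnit) sI aI sI"
      by (simp add: ret mretI_def sx ev_val v)
    ultimately show ?thesis using less.prems(4) ret(4,5) w map_le_refl by blast
  next
    case (unauth d xP xV xI)
    from unauth(5,6) show ?thesis
    proof (cases rule: canon_auth)
      case (1 d' aP aV s)
      \<comment> \<open>\<open>d'\<close> was used when the value was authenticated,
        \<open>d\<close> is the evidence now given to unauth; both belong to the same type.\<close>
      have d: "d' = d" using hasevi_unique[OF unauth(4) 1(4)] .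
      note v = srel_val[OF 1(3)] rel_cl[OF 1(5)]
      from less.prems(4) obtain mP mV mI hP hV hI i where
        st: "sP = (mP, hP, i)" "sV = (mV, hV, i)" "sI = (mI, hI, i)" and H: "hf i = H" by (auto simp: conf_def)
      from ev have w: "w = EPair (plist [s]) aP" "sP' = sP"
        by (simp_all add: unauth 1 munauthP_def sx ev_val v ev_serP[OF 1(3)[unfolded d]])
      have "ev hf (EApp cV (plist ([s] @ rs))) sV (ESome (EPair (plist rs) aV)) (mV, insert s hV, i)" for rs
        by (simp add: unauth 1 munauthV_def sx ev_val v ev_deserializeE ev_deserializeAt[OF 1(3)[unfolded d]] st H)
      moreover have "ev hf (EApp cI EUnit) sI xI sI"
        using 1(6) by (simp add: unauth mretI_def sx ev_val v)
      moreover have "conf hf H \<Sigma> sP (mV, insert s hV, i) sI" using less.prems(4) by (simp add: conf_def st)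
      ultimately show ?thesis using 1(5) v w map_le_refl by blast
    qed
  next
    case (bind bP bV bI fP fV fI \<tau>1)
    let ?L = "\<lambda>r1. EPair (EApp2 appendE (EFst r1) (EFst (V ''r2''))) (ESnd (V ''r2''))"
    let ?K = "ELet ''r2'' (EApp2 fP (ESnd (V ''r1'')) EUnit) (EPair (EApp2 appendE (EFst (V ''r1'')) (EFst (V ''r2''))) (ESnd (V ''r2'')))"
    note v = bind(5,7) rel_val[OF bind(4,5)] rel_val[OF bind(6,7)] rel_cl[OF bind(4)] rel_cl[OF bind(6)]
    from less.prems(1)[unfolded bind(1) mbindP_def] obtain n1 where n1: "n1 < n"
      and b1: "big hf n1 (ELet ''r1'' (EApp bP EUnit)
       ?K) sP w sP'"
    proof (rule big_Lam)
      fix n1 n2 u \<sigma>1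
      assume "n2 < n" "big hf n1 EUnit sP u \<sigma>1" and b: "big hf n2 (subst '''' (Lam ''u'' (ELet ''r1'' (EApp bP EUnit)
       ?K))
        (subst ''u'' u (ELet ''r1'' (EApp bP EUnit)
       ?K))) \<sigma>1 w sP'"
      moreover from big_val_cong[OF _ this(2)] have "\<sigma>1 = sP" by auto
      ultimately show thesis using that[of n2] v by simp
    qed
    from b1[unfolded ELet_def[of "''r1''"]] obtain n2 n3 r1 \<sigma>1 where n: "n2 < n1" "n3 < n1"
      and c1: "big hf n2 (EApp bP EUnit) sP r1 \<sigma>1"
      and c2: "big hf n3 (subst '''' (Lam ''r1'' ?K)
          (subst ''r1'' r1 ?K)) \<sigma>1 w sP'"
      by (rule big_Lam)
    have "n2 < n" using n n1 by simp
    from less.IH[OF this c1 bind(4,5) less.prems(4)] obtain \<Sigma>1 ss1 aP aV sV1 aI sI1 where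
      r1: "r1 = EPair (plist ss1) aP" "is_val aP" "\<Sigma> \<subseteq>\<^sub>m \<Sigma>1"
      and V1: "\<And>rs. ev hf (EApp bV (plist (ss1 @ rs))) sV (ESome (EPair (plist rs) aV)) sV1"
      and I1: "ev hf (EApp bI EUnit) sI aI sI1" and a: "vrel H \<Sigma>1 aP aV aI \<tau>1"
      and conf1: "conf hf H \<Sigma>1 \<sigma>1 sV1 sI1"
      by blast
    note va = r1(2) rel_val[OF a r1(2)] rel_cl[OF a]
    from c2 have "big hf n3 (EApp (Lam ''r2'' (?L r1))
        (EApp (EApp fP (ESnd r1)) EUnit)) \<sigma>1 w sP'"
      using va v by (simp add: r1(1) ELet_def EApp2_def)
    then obtain n4 n5 r2 \<sigma>2 where n4: "n4 < n3"
      and d1: "big hf n4 (EApp (EApp fP (ESnd r1)) EUnit) \<sigma>1 r2 \<sigma>2"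
      and d2: "big hf n5 (subst '''' (Lam ''r2'' (?L r1))
         (subst ''r2'' r2 (?L r1))) \<sigma>2 w sP'"
      by (rule big_Lam)
    from d1 obtain m1 m2 m3 g x b \<sigma>3 u \<sigma>4 where m3: "m3 < n4"
      and e1: "big hf m1 (EApp fP (ESnd r1)) \<sigma>1 (ERec g x b) \<sigma>3" and e2: "big hf m2 EUnit \<sigma>3 u \<sigma>4"
      and e3: "big hf m3 (subst g (ERec g x b) (subst x u b)) \<sigma>4 r2 \<sigma>2"
      by (rule big_App)
    from big_val_cong[OF _ e2] have u: "u = EUnit" "\<sigma>4 = \<sigma>3" by auto
    \<comment> \<open>The induction hypothesis speaks about a computation applied to unit, so this
      application is rebuilt around the already evaluated function. Its size \<open>Suc m3\<close>
      is at most \<open>n4\<close>, which is below \<open>n\<close>.\<close>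
    have e4: "big hf (Suc (0 + 0 + m3)) (EApp (ERec g x b) EUnit) \<sigma>3 r2 \<sigma>2"
      by (rule B_App[OF B_Val B_Val e3[unfolded u]]) simp_all
    have "ev hf (EApp fP (ESnd r1)) \<sigma>1 (ERec g x b) \<sigma>3" using e1 by (auto simp: ev_def)
    then have f: "ev hf (EApp fP aP) \<sigma>1 (ERec g x b) \<sigma>3"
      by (simp add: ev_App_arg v r1(1) ev_simps ev_constr ev_val va)
    \<comment> \<open>Computing the continuation from the first result is client code, so
      \<open>sim\<close> applies and returns three related computations, possibly in a larger
      store.\<close>
    have "vrel H \<Sigma>1 (EApp fP aP) (EApp fV aV) (EApp fI aI) (tm \<tau>)"
      by (rule rel.R_App[OF rel_store_mono[OF bind(6) r1(3)] a TE_refl])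
    from f this conf1 obtain \<Sigma>2 gV sV2 gI sI2 where g: "\<Sigma>1 \<subseteq>\<^sub>m \<Sigma>2" "ev hf (EApp fV aV) sV1 gV sV2"
      "ev hf (EApp fI aI) sI1 gI sI2" "vrel H \<Sigma>2 (ERec g x b) gV gI (tm \<tau>)" "conf hf H \<Sigma>2 \<sigma>3 sV2 sI2"
      by (rule sim_ev)
    have "Suc (0 + 0 + m3) < n" using m3 n4 n n1 by simp
    from less.IH[OF this e4 g(4) is_val.simps(2)[THEN iffD2, OF TrueI] g(5)] obtain \<Sigma>3 ss2 zP zV sV3 zI sI3 where
      r2: "r2 = EPair (plist ss2) zP" "is_val zP" "\<Sigma>2 \<subseteq>\<^sub>m \<Sigma>3"
      and V2: "\<And>rs. ev hf (EApp gV (plist (ss2 @ rs))) sV2 (ESome (EPair (plist rs) zV)) sV3"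
      and I2: "ev hf (EApp gI EUnit) sI2 zI sI3" and z: "vrel H \<Sigma>3 zP zV zI \<tau>"
      and conf2: "conf hf H \<Sigma>3 \<sigma>2 sV3 sI3" by blast
    note vz = r2(2) rel_val[OF z r2(2)] rel_cl[OF z]
    from d2 have "ev hf (EPair (EApp2 appendE (EFst r1) (EFst r2)) (ESnd r2)) \<sigma>2 w sP'"
      using va vz by (auto simp: r1(1) r2(1) ev_def)
    then have w: "w = EPair (plist (ss1 @ ss2)) zP" "sP' = \<sigma>2"
      by (simp_all add: r1(1) r2(1) sx ev_val va vz ev_appendE ev_append)
    have "ev hf (EApp cV (plist ((ss1 @ ss2) @ rs))) sV (ESome (EPair (plist rs) zV)) sV3" for rs
    proof -
      have "ev hf (EApp (EApp fV aV) (plist (ss2 @ rs))) sV1 (ESome (EPair (plist rs) zV)) sV3"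
        by (rule ev_App_funI[OF g(2) V2])
      from ev_mbindV[OF V1[of "ss2 @ rs"] this] v va show ?thesis unfolding bind(2) by simp
    qed
    moreover have "ev hf (EApp cI EUnit) sI zI sI3"
    proof -
      have "ev hf (EApp (EApp fI aI) EUnit) sI1 zI sI3"
        by (rule ev_App_funI[OF g(3) I2])
      from ev_mbindI[OF I1 this] v show ?thesis unfolding bind(3) by simp
    qed
    moreover have "\<Sigma> \<subseteq>\<^sub>m \<Sigma>3" using r1(3) g(1) r2(3) by (blast intro: map_le_trans)
    ultimately show ?thesis using w r2(2) z conf2 by blast
  qed
qed

subsection \<open>Typed terms are related to themselves\<close>

lemma tms_simps [simp]:
  "tms s tunit = tunit" "tms s tbool = tbool" "tms s tint = tint" "tms s tstring = tstring"
  "tms s (tprod a b) = tprod (tms s a) (tms s b)" "tms s (tsum a b) = tsum (tms s a) (tms s b)"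
  "tms s (tarr a b) = tarr (tms s a) (tms s b)" "tms s (tref a) = tref (tms s a)"
  "tms s (tmu \<kappa> F) = tmu \<kappa> (tms s F)"
  by (simp_all add: tunit_def tbool_def tint_def tstring_def tprod_def tsum_def tarr_def tref_def tmu_def)

lemma tms_tapps [simp]: "tms s (tapps t as) = tapps (tms s t) (map (tms s) as)"
  by (induction as arbitrary: t) auto

definition tms_env :: "(nat \<Rightarrow> ty) \<Rightarrow> tenv \<Rightarrow> tenv" where
  "tms_env s \<Gamma> x = map_option (tms s) (\<Gamma> x)"

lemma tms_env_upd: "tms_env s (\<Gamma>(x \<mapsto> t)) = (tms_env s \<Gamma>)(x \<mapsto> tms s t)"
  by (auto simp: fun_eq_iff tms_env_def)

lemma tms_env_lift: "tms_env (case_nat u s) (lift_env \<Gamma>) = tms_env s \<Gamma>"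
  by (auto simp: fun_eq_iff tms_env_def lift_env_def option.map_comp comp_def tms_lift)

lemma binop_ty_tms: "binop_ty op a b c \<Longrightarrow> binop_ty op (tms s a) (tms s b) (tms s c)"
  by (induction rule: binop_ty.induct) (auto intro!: binop_ty.intros elim!: base_eq_ty.cases intro: base_eq_ty.intros)

lemma unop_ty_tms: "unop_ty op a b \<Longrightarrow> unop_ty op (tms s a) (tms s b)"
  by (induction rule: unop_ty.induct) (auto intro: unop_ty.intros)

lemma rel_tforall:
  assumes "\<And>u. rel H \<Sigma> \<Gamma> eP eV eI (tsubst 0 u t)"
  shows "rel H \<Sigma> \<Gamma> (ETLam eP) (ETLam eV) (ETLam eI) (tforall \<kappa> t)"
  unfolding tforall_def
  by (rule rel.R_TLam[where F = "TAbs \<kappa> t" and \<kappa> = \<kappa>], rule rel_conv[OF assms TE_sym[OF TE_beta]]) (simp add: TE_refl)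

text \<open>Fundamental property. The substitution \<open>s\<close> replaces the free type variables
  by arbitrary types; at a type abstraction and at unpack, the induction hypothesis for
  \<open>case_nat u s\<close> with every \<open>u\<close> provides the premises that range over all
  types.\<close>

lemma typed_rel:
  "typed \<Delta> \<Gamma> e \<tau> \<Longrightarrow> rel H \<Sigma> (tms_env s \<Gamma>) e e e (tms s \<tau>)"
proof (induction arbitrary: s rule: typed.induct)
  case (T_Var \<Gamma> x \<tau> \<Delta>)
  then show ?case by (intro rel.R_Var) (auto simp: tms_env_def TE_refl)
next
  case (T_Rec \<Delta> \<tau>1 \<tau>2 \<Gamma> f x e)
  from T_Rec.IH[of s] show ?case
    by (intro rel.R_Rec[of _ _ _ _ "tms s \<tau>1" "tms s \<tau>2"]) (simp_all only: tms_env_upd tms_simps, simp add: TE_refl)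
next
  case (T_App \<Delta> \<Gamma> e1 \<tau>1 \<tau>2 e2)
  from T_App.IH(1)[of s] T_App.IH(2)[of s] show ?case by (simp, intro rel.R_App[OF _ _ TE_refl])
next
  case (T_TLam \<kappa> \<Delta> \<Gamma> e \<tau>)
  have "rel H \<Sigma> (tms_env s \<Gamma>) e e e (tsubst 0 u (tms (up s) \<tau>))" for u
    using T_TLam.IH[of "case_nat u s"] unfolding tms_env_lift tsubst_tms_up .
  from rel_tforall[OF this] show ?case by (simp add: tforall_def)
next
  case (T_TApp \<Delta> \<Gamma> e \<kappa> F \<sigma>)
  from T_TApp.IH[of s] show ?case by (simp, intro rel.R_TApp[OF _ TE_refl])
next
  case (T_Pack \<Delta> F \<kappa> \<sigma> \<Gamma> e)
  from T_Pack.IH[of s] show ?case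
    by (simp, intro rel.R_Pack[where \<kappa> = \<kappa> and F = "tms s F"]) (simp_all add: TE_refl)
next
  case (T_Unpack \<Delta> \<Gamma> e1 \<kappa> F \<tau> x e2)
  have "rel H \<Sigma> ((tms_env s \<Gamma>)(x \<mapsto> TAp (tms s F) u)) e2 e2 e2 (tms s \<tau>)" for u
    using T_Unpack.IH(2)[of "case_nat u s"] by (simp only: tms_env_upd tms_env_lift tms_lift tms.simps nat.case)
  with T_Unpack.IH(1)[of s] show ?case by (simp, intro rel.R_Unpack[where \<kappa> = \<kappa> and F = "tms s F"])
next
  case (T_Fold \<Delta> \<kappa> F args \<Gamma> e)
  from T_Fold.IH[of s] show ?case
    by (simp, intro rel.R_Fold[where \<kappa> = \<kappa> and F = "tms s F" and args = "map (tms s) args"])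
      (simp_all add: TE_refl list.rel_refl)
next
  case (T_Unfold \<Delta> F \<kappa> args \<Gamma> e)
  from T_Unfold.IH[of s] show ?case by (simp, intro rel.R_Unfold[OF _ TE_refl])
next
  case (T_Bin op \<tau>1 \<tau>2 \<tau> \<Delta> \<Gamma> e1 e2)
  from rel.R_Bin[OF binop_ty_tms[OF T_Bin.hyps(1)] T_Bin.IH TE_refl] show ?case .
next
  case (T_Un op \<tau>1 \<tau> \<Delta> \<Gamma> e)
  from rel.R_Un[OF unop_ty_tms[OF T_Un.hyps(1)] T_Un.IH TE_refl] show ?case .
next
  case (T_Substr \<Delta> \<Gamma> e1 e2 e3)
  from T_Substr.IH[of s] show ?case by (simp add: rel.R_Substr)
next
  case (T_If \<Delta> \<Gamma> e0 e1 \<tau> e2)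
  from T_If.IH[of s] show ?case by (simp add: rel.R_If)
next
  case (T_Pair \<Delta> \<Gamma> e1 \<tau>1 e2 \<tau>2)
  from rel.R_Pair[OF T_Pair.IH(1)[of s] T_Pair.IH(2)[of s]] show ?case by (simp add: TE_refl)
next
  case (T_Fst \<Delta> \<Gamma> e \<tau>1 \<tau>2)
  from T_Fst.IH[of s] show ?case by (simp, intro rel.R_Fst[OF _ TE_refl])
next
  case (T_Snd \<Delta> \<Gamma> e \<tau>1 \<tau>2)
  from T_Snd.IH[of s] show ?case by (simp, intro rel.R_Snd[OF _ TE_refl])
next
  case (T_InjL \<Delta> \<tau>2 \<Gamma> e \<tau>1)
  from rel_InjL[OF T_InjL.IH[of s]] show ?case by simp
next
  case (T_InjR \<Delta> \<tau>1 \<Gamma> e \<tau>2)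
  from rel_InjR[OF T_InjR.IH[of s]] show ?case by simp
next
  case (T_Case \<Delta> \<Gamma> e0 \<tau>1 \<tau>2 x1 e1 \<tau> x2 e2)
  from T_Case.IH[of s] show ?case by (simp only: tms_env_upd tms_simps, intro rel.R_Case)
next
  case (T_Alloc \<Delta> \<Gamma> e \<tau>)
  from rel.R_Alloc[OF T_Alloc.IH[of s]] show ?case by (simp add: TE_refl)
next
  case (T_Load \<Delta> \<Gamma> e \<tau>)
  from T_Load.IH[of s] show ?case by (simp, intro rel.R_Load[OF _ TE_refl])
next
  case (T_Store \<Delta> \<Gamma> e1 \<tau> e2)
  from T_Store.IH(1)[of s] T_Store.IH(2)[of s] show ?case by (simp, intro rel.R_Store) simp_all
next
  case (T_Hash \<Delta> \<Gamma> e)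
  from T_Hash.IH[of s] show ?case by (simp add: rel.R_Hash)
next
  case (T_Conv \<Delta> \<Gamma> e \<tau> \<tau>')
  from rel_conv[OF T_Conv.IH tequiv_tms[OF T_Conv.hyps(2)]] show ?case .
qed simp_all

subsection \<open>The three implementations are related\<close>

lemma ty_simps [simp]:
  "tlift k tunit = tunit" "tlift k tbool = tbool" "tlift k tint = tint" "tlift k tstring = tstring"
  "tlift k (tprod a b) = tprod (tlift k a) (tlift k b)" "tlift k (tsum a b) = tsum (tlift k a) (tlift k b)"
  "tlift k (tarr a b) = tarr (tlift k a) (tlift k b)" "tlift k (tmu \<kappa> F) = tmu \<kappa> (tlift k F)"
  "tlift k (tforall \<kappa> t) = tforall \<kappa> (tlift (Suc k) t)" "tlift k (texists \<kappa> t) = texists \<kappa> (tlift (Suc k) t)"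
  "tsubst k u tunit = tunit" "tsubst k u tbool = tbool" "tsubst k u tint = tint" "tsubst k u tstring = tstring"
  "tsubst k u (tprod a b) = tprod (tsubst k u a) (tsubst k u b)" "tsubst k u (tsum a b) = tsum (tsubst k u a) (tsubst k u b)"
  "tsubst k u (tarr a b) = tarr (tsubst k u a) (tsubst k u b)" "tsubst k u (tmu \<kappa> F) = tmu \<kappa> (tsubst k u F)"
  "tsubst k u (tforall \<kappa> t) = tforall \<kappa> (tsubst (Suc k) (tlift 0 u) t)"
  "tsubst k u (texists \<kappa> t) = texists \<kappa> (tsubst (Suc k) (tlift 0 u) t)"
  by (simp_all add: tunit_def tbool_def tint_def tstring_def tprod_def tsum_def tarr_def tmu_def tforall_def texists_def)

lemma prim_ty_tsubst: "prim_ty \<tau> \<Longrightarrow> tsubst k u \<tau> = \<tau>"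
  by (induction rule: prim_ty.induct) auto

lemma rel_op1: "op1 cP cV cI a b \<Longrightarrow> rel H \<Sigma> \<Gamma> cP cV cI (tarr a b)"
  by (erule rel.R_Op1) (simp add: TE_refl)

lemma rel_op2: "op2 cP cV cI fP fV fI a b c \<Longrightarrow> rel H \<Sigma> \<Gamma> cP cV cI (tarr a (tarr b c))"
  by (erule rel.R_Op2) (simp add: TE_refl)

lemma rel_pair: "rel H \<Sigma> \<Gamma> eP eV eI a \<Longrightarrow> rel H \<Sigma> \<Gamma> fP fV fI b \<Longrightarrow>
   rel H \<Sigma> \<Gamma> (EPair eP fP) (EPair eV fV) (EPair eI fI) (tprod a b)"
  by (erule (1) rel.R_Pair) (simp add: TE_refl)

lemma rel_evi: "hasevi d a \<Longrightarrow> rel H \<Sigma> \<Gamma> (eviP d) (eviV d) EUnit (tevi a)"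
  by (erule rel.R_Evi) (simp add: TE_refl)

lemma rel_texists:
  assumes "rel H \<Sigma> \<Gamma> eP eV eI (tsubst 0 u t)"
  shows "rel H \<Sigma> \<Gamma> (EPack eP) (EPack eV) (EPack eI) (texists \<kappa> t)"
  unfolding texists_def
  by (rule rel.R_Pack[where F = "TAbs \<kappa> t" and \<kappa> = \<kappa>], rule rel_conv[OF assms TE_sym[OF TE_beta]]) (simp add: TE_refl)

lemma rel_Authentikit:
  "rel H \<Sigma> \<Gamma> AuthentikitP AuthentikitV AuthentikitI (authentikit_func_ty tunit tbool)"
proof -
  \<comment> \<open>The three libraries are rewritten into the closure shapes listed in
    \<open>op1\<close> and \<open>op2\<close> and into evidence codes, so that their components
    match the rules of the relation.\<close>
  have P: "AuthentikitP = EPair (ETLam (Lam ''a'' (mretP (V ''a''))))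
     (EPair (ETLam (ETLam (Lam ''c'' (Lam ''f'' (mbindP (V ''c'') (V ''f'')))))) (EPack
     (EPair (ETLam (eviP DAuth)) (EPair (ETLam (ETLam (Lam ''ea'' (Lam ''eb'' (pairP (V ''ea'') (V ''eb''))))))
     (EPair (ETLam (ETLam (Lam ''ea'' (Lam ''eb'' (sumP (V ''ea'') (V ''eb''))))))
     (EPair (eviP DStr) (EPair (eviP DInt) (EPair (ETLam (Lam ''ef'' (muP (V ''ef''))))
     (EPair (ETLam (Lam ''ev'' (authFP (V ''ev''))))
       (ETLam (Lam ''ev'' (Lam ''x'' (munauthP (V ''ev'') (V ''x''))))))))))))))"
    by (simp add: AuthentikitP_def retP_def bindP_def eviAuthP_def eviPairP_def eviSumP_def eviMuP_def authP_def
        unauthP_def opcode_defs)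
  have V: "AuthentikitV = EPair (ETLam (Lam ''a'' (mretV (V ''a''))))
     (EPair (ETLam (ETLam (Lam ''c'' (Lam ''f'' (mbindV (V ''c'') (V ''f'')))))) (EPack
     (EPair (ETLam (eviV DAuth)) (EPair (ETLam (ETLam (Lam ''ea'' (Lam ''eb'' (pairV (V ''ea'') (V ''eb''))))))
     (EPair (ETLam (ETLam (Lam ''ea'' (Lam ''eb'' (sumV (V ''ea'') (V ''eb''))))))
     (EPair (eviV DStr) (EPair (eviV DInt) (EPair (ETLam (Lam ''ef'' (muV (V ''ef''))))
     (EPair (ETLam (Lam ''ev'' (authFV (V ''ev''))))
       (ETLam (Lam ''ev'' (Lam ''h'' (munauthV (V ''ev'') (V ''h''))))))))))))))"
    by (simp add: AuthentikitV_def retV_def bindV_def eviAuthV_def eviPairV_def eviSumV_def eviMuV_def authV_def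
        unauthV_def opcode_defs)
  have I: "AuthentikitI = EPair (ETLam (Lam ''a'' (mretI (V ''a''))))
     (EPair (ETLam (ETLam (Lam ''c'' (Lam ''f'' (mbindI (V ''c'') (V ''f'')))))) (EPack
     (EPair (ETLam EUnit) (EPair (ETLam (ETLam (Lam ''ea'' (Lam ''eb'' EUnit))))
     (EPair (ETLam (ETLam (Lam ''ea'' (Lam ''eb'' EUnit))))
     (EPair EUnit (EPair EUnit (EPair (ETLam (Lam ''ef'' EUnit))
     (EPair (ETLam (Lam ''ev'' (Lam ''a'' (V ''a''))))
       (ETLam (Lam ''ev'' (Lam ''a'' (mretI (V ''a''))))))))))))))"
    by (simp add: AuthentikitI_def opcode_defs)
  have evi: "hasevi DAuth (tauth a)" "hasevi DStr tstring" "hasevi DInt tint" for a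
    by (auto intro: hasevi.intros simp: TE_refl intro!: hasevi.HE_Auth[where a = a])
  show ?thesis unfolding P V I authentikit_func_ty_def ret_ty_def bind_ty_def authenticatable_ty_def Let_def S_def
    \<comment> \<open>The existential is witnessed by \<open>tint\<close>, because
      \<open>TAp tint a\<close> is by definition \<open>tevi a\<close>.\<close>
    by (intro rel_pair rel_tforall rel_texists[where u = tint]; (simp del: eviP.simps eviV.simps)?;
        (intro rel_pair rel_tforall)?; (simp del: eviP.simps eviV.simps)?;
        (intro rel_tforall)?; (simp del: eviP.simps eviV.simps)?; (fold tauth_def tm_def tevi_def)?;
        (rule rel_op1 rel_op2 rel_evi; rule evi op1.intros op2.intros))
qed

text \<open>\<open>R_TApp\<close> imposes no kind on its argument, so the two quantifiers can be
  instantiated with \<open>tunit\<close> and \<open>tbool\<close>; the library then has its abstract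
  types, and the result type becomes \<open>tm \<tau>\<close>.\<close>

lemma client_rel:
  assumes "prim_ty \<tau>" "typed [] Map.empty e (client_ty \<tau>)"
  shows "vrel H \<Sigma> (inst e AuthentikitP) (inst e AuthentikitV) (inst e AuthentikitI) (tm \<tau>)"
proof -
  note prim = prim_ty_tsubst[OF assms(1)]
  have "tms_env TV Map.empty = Map.empty" by (simp add: tms_env_def fun_eq_iff)
  with typed_rel[OF assms(2), of H \<Sigma> TV] have "vrel H \<Sigma> e e e (client_ty \<tau>)" by simp
  then have 1: "vrel H \<Sigma> e e e (TAp (TC (TForallC SS)) (TAbs SS (tforall SS
      (tarr (authentikit_func_ty (TV 1) (TV 0)) (TAp (TV 0) \<tau>)))))"
    by (simp add: client_ty_def tforall_def)
  have "tequiv (TAp (TAbs SS (tforall SS (tarr (authentikit_func_ty (TV 1) (TV 0)) (TAp (TV 0) \<tau>)))) tunit)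
      (tforall SS (tarr (authentikit_func_ty tunit (TV 0)) (TAp (TV 0) \<tau>)))"
    using TE_beta[of SS "tforall SS (tarr (authentikit_func_ty (TV 1) (TV 0)) (TAp (TV 0) \<tau>))" tunit]
    by (simp add: authentikit_func_ty_def ret_ty_def bind_ty_def authenticatable_ty_def Let_def prim)
  from rel.R_TApp[OF 1 this] have 2: "vrel H \<Sigma> (ETApp e) (ETApp e) (ETApp e)
      (TAp (TC (TForallC SS)) (TAbs SS (tarr (authentikit_func_ty tunit (TV 0)) (TAp (TV 0) \<tau>))))"
    by (simp add: tforall_def)
  have "tequiv (TAp (TAbs SS (tarr (authentikit_func_ty tunit (TV 0)) (TAp (TV 0) \<tau>))) tbool)
      (tarr (authentikit_func_ty tunit tbool) (tm \<tau>))"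
    using TE_beta[of SS "tarr (authentikit_func_ty tunit (TV 0)) (TAp (TV 0) \<tau>)" tbool]
    by (simp add: authentikit_func_ty_def ret_ty_def bind_ty_def authenticatable_ty_def Let_def prim tm_def)
  from rel.R_App[OF rel.R_TApp[OF 2 this] rel_Authentikit TE_refl] show ?thesis
    by (simp add: inst_def)
qed

lemma prim_ty_rel:
  "prim_ty \<tau> \<Longrightarrow> vrel H \<Sigma> vP vV vI \<tau> \<Longrightarrow> is_val vP \<Longrightarrow> vV = vP \<and> vI = vP"
proof (induction arbitrary: vP vV vI rule: prim_ty.induct)
  case (5 a b)
  from 5(5,6) show ?case
    by (cases rule: canon_prod) (use 5(3,4,6) in auto)
next
  case (6 a b)
  from 6(5,6) show ?case
    by (cases rule: canon_sum) (use 6(3,4,6) in auto)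
qed (auto dest: canon_unit canon_bool canon_int canon_str)

theorem theorem6:
  fixes hashf :: "'i \<Rightarrow> string \<Rightarrow> string"
    and e :: expr and \<tau> :: ty and i :: 'i and p v :: expr and \<sigma>1 :: "'i state"
  assumes "prim_ty \<tau>"
    and "typed [] Map.empty e (client_ty \<tau>)"
    and "is_val p" and "is_val v"
    and "cf_steps hashf (EApp runP (inst e AuthentikitP), init_state i) (EPair p v, \<sigma>1)"
  shows "\<exists>\<sigma>2 \<sigma>3.
           steps hashf (EApp2 runV (inst e AuthentikitV) p, init_state i) (ESome v, \<sigma>2)
         \<and> steps hashf (EApp runI (inst e AuthentikitI), init_state i) (v, \<sigma>3)"
proof -
  let ?H = "hashf i" and ?\<sigma> = "init_state i"
  have "steps hashf (EApp runP (inst e AuthentikitP), ?\<sigma>) (EPair p v, \<sigma>1)"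
    by (rule predicate2D[OF rtranclp_mono assms(5)]) (auto simp: cf_step_def)
  then have "ev hashf (EApp runP (inst e AuthentikitP)) ?\<sigma> (EPair p v) \<sigma>1"
    using assms(3,4) by (intro steps_ev) simp_all
  \<comment> \<open>The run splits in two: evaluating the client to a computation \<open>cP\<close>,
    handled by \<open>sim\<close>, and running \<open>cP\<close>, handled by
    \<open>run_sim\<close>.\<close>
  then obtain cP sP where cP: "ev hashf (inst e AuthentikitP) ?\<sigma> cP sP"
    and run: "ev hashf (subst '''' (Lam ''c'' (EApp (V ''c'') EUnit)) (subst ''c'' cP (EApp (V ''c'') EUnit))) sP (EPair p v) \<sigma>1"
    unfolding runP_def ev_App_Lam by blast
  have conf0: "conf hashf ?H Map.empty ?\<sigma> ?\<sigma> ?\<sigma>" by (simp add: conf_def cell_rel_def init_state_def)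
  obtain \<Sigma> cV sV cI sI where
    cV: "ev hashf (inst e AuthentikitV) ?\<sigma> cV sV" and cI: "ev hashf (inst e AuthentikitI) ?\<sigma> cI sI"
    and c: "rel ?H \<Sigma> Map.empty cP cV cI (tm \<tau>)" and conf: "conf hashf ?H \<Sigma> sP sV sI"
    by (rule sim_ev[OF cP client_rel[OF assms(1,2)] conf0])
  note cl = rel_cl[OF c]
  from run cl have "ev hashf (EApp cP EUnit) sP (EPair p v) \<sigma>1" by simp
  then obtain n where "big hashf n (EApp cP EUnit) sP (EPair p v) \<sigma>1" unfolding ev_def by blast
  from run_sim[OF this c ev_is_val[OF cP] conf] obtain \<Sigma>' ss aP aV sV' aI sI' where
    pv: "EPair p v = EPair (plist ss) aP"
    and V: "\<forall>rs. ev hashf (EApp cV (plist (ss @ rs))) sV (ESome (EPair (plist rs) aV)) sV'"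
    and I: "ev hashf (EApp cI EUnit) sI aI sI'" and a: "rel ?H \<Sigma>' Map.empty aP aV aI \<tau>" by blast
  from pv prim_ty_rel[OF assms(1) a] assms(4) have eq: "p = plist ss" "aP = v" "aV = v" "aI = v" by auto
  have v: "cl v" using rel_cl[OF a] eq by simp
  \<comment> \<open>With an empty rest the verifier consumes the entire proof, so what it leaves
    over is the empty list.\<close>
  have "ev hashf (EApp cV p) sV (ESome (EPair nilE v)) sV'"
    using V[rule_format, of "[]"] eq by simp
  then have "ev hashf (EMatch (EApp cV p) ENone ''r'' (ESome (ESnd (V ''r'')))) sV (ESome v) sV'"
    unfolding ev_code(8) ev_simps(18)
    by (intro exI[of _ "ESome (EPair nilE v)"] exI[of _ sV'] conjI disjI2 exI[of _ "EPair nilE v"])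
      (use assms(4) in \<open>simp_all add: ev_code ev_simps ev_constr ev_val\<close>)
  then have 1: "ev hashf (EApp (Lam ''p'' (EMatch (EApp cV (V ''p'')) ENone ''r'' (ESome (ESnd (V ''r''))))) p) sV (ESome v) sV'"
    using cl assms(3) cl_plist[of ss] by (simp add: ev_App_Lam ev_val eq(1))
  have "ev hashf (EApp runV (inst e AuthentikitV)) ?\<sigma>
      (Lam ''p'' (EMatch (EApp cV (V ''p'')) ENone ''r'' (ESome (ESnd (V ''r''))))) sV"
    unfolding runV_def ev_App_Lam by (intro exI conjI, rule cV) (use cl in \<open>simp add: ev_code\<close>)
  from ev_App_funI[OF this 1] have "steps hashf (EApp2 runV (inst e AuthentikitV) p, ?\<sigma>) (ESome v, sV')"
    unfolding EApp2_def by (rule ev_steps)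
  moreover have "ev hashf (EApp runI (inst e AuthentikitI)) ?\<sigma> v sI'"
    unfolding runI_def ev_App_Lam by (intro exI conjI, rule cI) (use cl I eq in simp)
  then have "steps hashf (EApp runI (inst e AuthentikitI), ?\<sigma>) (v, sI')" by (rule ev_steps)
  ultimately show ?thesis by blast
qed

end
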